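(* For every $n\geq 1$ there exists a first-order sentence $\Phi_n$ in the signature $\{+,<,1,X\}$, where $X$ is an $n$-ary relation symbol ($\Phi_n$ depends only on $n$, i.e. is uniform in $X$), such that for every relation $X\subseteq\mathbb{R}^n$ with the property that every nonempty $\langle \mathbb{R},+,<,1,X\rangle$-definable relation contains a point with rational components, $\Phi_n$ holds in $\langle \mathbb{R},+,<,1,X\rangle$ if and only if $X$ is $\langle \mathbb{R},+,<,1\rangle$-definable.
   Context: Definable means first-order definable without parameters: for a structure $\mathcal{M}$ with domain $D$, a relation $Y\subseteq D^m$ ($m\geq 1$) is $\mathcal{M}$-definable if there is a first-order formula (with equality) in the signature of $\mathcal{M}$, without parameters, defining $Y$ in $\mathcal{M}$. *)

theory Defs
  imports Complex_Main
begin

text \<open>First-order syntax over the signature {+, <, 1, X} with equality and named variables. The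
  omitted connectives and the universal quantifier are the usual abbreviations. A single formula
  type serves both signatures: the reduct {+, <, 1} is carved out by \<open>X_free\<close>,
  and the arity of \<open>X\<close> is imposed by \<open>X_arity\<close>.\<close>

datatype tm = Var nat | One | Add tm tm

datatype fm =
    Eq tm tm
  | Less tm tm
  | RelX "tm list"
  | Neg fm
  | Conj fm fm
  | Ex nat fm

fun vars_tm :: "tm \<Rightarrow> nat set" where
  "vars_tm (Var i) = {i}"
| "vars_tm One = {}"
| "vars_tm (Add s t) = vars_tm s \<union> vars_tm t"

fun free_vars :: "fm \<Rightarrow> nat set" where
  "free_vars (Eq s t) = vars_tm s \<union> vars_tm t"
| "free_vars (Less s t) = vars_tm s \<union> vars_tm t"
| "free_vars (RelX ts) = (\<Union>t\<in>set ts. vars_tm t)"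
| "free_vars (Neg \<phi>) = free_vars \<phi>"
| "free_vars (Conj \<phi> \<psi>) = free_vars \<phi> \<union> free_vars \<psi>"
| "free_vars (Ex i \<phi>) = free_vars \<phi> - {i}"

fun X_arity :: "nat \<Rightarrow> fm \<Rightarrow> bool" where
  "X_arity n (Eq s t) \<longleftrightarrow> True"
| "X_arity n (Less s t) \<longleftrightarrow> True"
| "X_arity n (RelX ts) \<longleftrightarrow> length ts = n"
| "X_arity n (Neg \<phi>) \<longleftrightarrow> X_arity n \<phi>"
| "X_arity n (Conj \<phi> \<psi>) \<longleftrightarrow> X_arity n \<phi> \<and> X_arity n \<psi>"
| "X_arity n (Ex i \<phi>) \<longleftrightarrow> X_arity n \<phi>"

fun X_free :: "fm \<Rightarrow> bool" where
  "X_free (Eq s t) \<longleftrightarrow> True"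
| "X_free (Less s t) \<longleftrightarrow> True"
| "X_free (RelX ts) \<longleftrightarrow> False"
| "X_free (Neg \<phi>) \<longleftrightarrow> X_free \<phi>"
| "X_free (Conj \<phi> \<psi>) \<longleftrightarrow> X_free \<phi> \<and> X_free \<psi>"
| "X_free (Ex i \<phi>) \<longleftrightarrow> X_free \<phi>"

definition is_sentence :: "nat \<Rightarrow> fm \<Rightarrow> bool" where
  "is_sentence n \<phi> \<longleftrightarrow> X_arity n \<phi> \<and> free_vars \<phi> = {}"

fun eval_tm :: "(nat \<Rightarrow> real) \<Rightarrow> tm \<Rightarrow> real" where
  "eval_tm e (Var i) = e i"
| "eval_tm e One = 1"
| "eval_tm e (Add s t) = eval_tm e s + eval_tm e t"

fun sat :: "real list set \<Rightarrow> (nat \<Rightarrow> real) \<Rightarrow> fm \<Rightarrow> bool" where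
  "sat X e (Eq s t) \<longleftrightarrow> eval_tm e s = eval_tm e t"
| "sat X e (Less s t) \<longleftrightarrow> eval_tm e s < eval_tm e t"
| "sat X e (RelX ts) \<longleftrightarrow> map (eval_tm e) ts \<in> X"
| "sat X e (Neg \<phi>) \<longleftrightarrow> \<not> sat X e \<phi>"
| "sat X e (Conj \<phi> \<psi>) \<longleftrightarrow> sat X e \<phi> \<and> sat X e \<psi>"
| "sat X e (Ex i \<phi>) \<longleftrightarrow> (\<exists>a. sat X (e(i := a)) \<phi>)"

definition holds :: "real list set \<Rightarrow> fm \<Rightarrow> bool" where
  "holds X \<phi> \<longleftrightarrow> (\<forall>e. sat X e \<phi>)"

text \<open>Points of \<open>\<real>\<close>-space of dimension \<open>m\<close> are lists of length \<open>m\<close>.\<close>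

definition tuples :: "nat \<Rightarrow> real list set" where
  "tuples m = {xs. length xs = m}"

text \<open>Parameter-free definability of an \<open>m\<close>-ary relation, \<open>m \<ge> 1\<close>. The free variables of the
  defining formula are among \<open>0, \<dots>, m - 1\<close>, so the values of the assignment \<open>nth xs\<close> at indices
  beyond the length of \<open>xs\<close> play no role.\<close>

definition definable_RX :: "nat \<Rightarrow> real list set \<Rightarrow> nat \<Rightarrow> real list set \<Rightarrow> bool" where
  "definable_RX n X m Y \<longleftrightarrow> m \<ge> 1 \<and> Y \<subseteq> tuples m \<and>
     (\<exists>\<phi>. X_arity n \<phi> \<and> free_vars \<phi> \<subseteq> {..<m} \<and>
          (\<forall>xs\<in>tuples m. xs \<in> Y \<longleftrightarrow> sat X (nth xs) \<phi>))"

text \<open>In the structure without \<open>X\<close> the relation argument of \<open>sat\<close> is a dummy, since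
  the formula does not mention \<open>X\<close>.\<close>

definition definable_R :: "nat \<Rightarrow> real list set \<Rightarrow> bool" where
  "definable_R m Y \<longleftrightarrow> m \<ge> 1 \<and> Y \<subseteq> tuples m \<and>
     (\<exists>\<phi>. X_free \<phi> \<and> free_vars \<phi> \<subseteq> {..<m} \<and>
          (\<forall>xs\<in>tuples m. xs \<in> Y \<longleftrightarrow> sat {} (nth xs) \<phi>))"

end

theory Submission
  imports Defs "HOL-Library.Nat_Bijection"
begin

text \<open>
  Fix the first \<open>k\<close> coordinates of a point \<open>y\<close>. The vectors along whose small real multiples the
  relation is invariant near \<open>y\<close> form a subspace, the strata of \<open>y\<close>. The sentence says that for
  every \<open>k\<close> and every choice of the first \<open>k\<close> coordinates only finitely many values of
  coordinate \<open>k\<close> are taken by points without a stratum transversal to the hyperplanes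
  \<open>y k = const\<close>; finiteness is expressed as boundedness plus uniform separation.

  A semilinear relation satisfies it because whether a point is bad depends only on the set of
  hyperplanes of the arrangement through it, and that set determines coordinate \<open>k\<close> of a bad point.

  Conversely, descend on \<open>k\<close>. The bad values are rational, since they can be isolated, and the
  sections at rational values are semilinear by induction. Between two bad values every germ can be
  transported along strata to a fixed rational section, where it is constant on each of finitely many
  cells. So the strip meets only finitely many flats \<open>y + strata y\<close>, each of them rational because \<open>y\<close>
  can be chosen rational. If two points of the strip lie on the same side of all forms defining these
  flats, their difference is a stratum at each point of the segment joining them, so membership is
  constant along that segment.
\<close>

section \<open>Expressible predicates\<close>

text \<open>Local translation invariance does not see slopes: the line \<open>y 1 = c * y 0\<close>
  with irrational \<open>c\<close> satisfies the sentence for \<open>n = 2\<close> without being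
  definable. Rationality can come only from the hypothesis on \<open>X\<close>, which enters at
  three places: a rational representative is chosen in a cell, a bad value is recognised as the only
  one in a rational interval, and a small multiple of a basis vector as the only period with given
  rational entries. All three work with rational parameters, so the descent passes only through
  rational prefixes, although the sentence, which cannot speak of rationality, quantifies over all
  real ones. In the other direction, semilinear sets are shown to be tame with real coefficients
  allowed in the forms; the coefficient set is therefore a parameter of
  \<open>affine_on\<close>.\<close>

lemma eval_tm_cong: "(\<And>v. v \<in> vars_tm t \<Longrightarrow> e v = e' v) \<Longrightarrow> eval_tm e t = eval_tm e' t"
  by (induction t) auto

lemma sat_cong: "(\<And>v. v \<in> free_vars \<phi> \<Longrightarrow> e v = e' v) \<Longrightarrow> sat X e \<phi> \<longleftrightarrow> sat X e' \<phi>"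
proof (induction \<phi> arbitrary: e e')
  case (Eq s t)
  then show ?case using eval_tm_cong[of s e e'] eval_tm_cong[of t e e'] by auto
next
  case (Less s t)
  then show ?case using eval_tm_cong[of s e e'] eval_tm_cong[of t e e'] by auto
next
  case (RelX ts)
  then have "map (eval_tm e) ts = map (eval_tm e') ts"
    by (auto intro!: eval_tm_cong)
  then show ?case by (simp only: sat.simps)
next
  case (Neg \<phi>)
  then show ?case by (metis free_vars.simps(4) sat.simps(4))
next
  case (Conj \<phi> \<psi>)
  have "sat X e \<phi> \<longleftrightarrow> sat X e' \<phi>" "sat X e \<psi> \<longleftrightarrow> sat X e' \<psi>"
    using Conj.prems by (auto intro!: Conj.IH)
  then show ?case by simp
next
  case (Ex i \<phi>)
  have "sat X (e(i := a)) \<phi> \<longleftrightarrow> sat X (e'(i := a)) \<phi>" for a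
    using Ex.prems by (auto intro!: Ex.IH)
  then show ?case by simp
qed

text \<open>\<open>None\<close> stands for the signature without the relation symbol,
  \<open>Some n\<close> for the one with an \<open>n\<close>-ary symbol. Defining formulas need the
  former, the sentence and the formulas put into the hypothesis on \<open>X\<close> the latter; the
  closure lemmas are shared.\<close>

fun admissible :: "nat option \<Rightarrow> fm \<Rightarrow> bool" where
  "admissible None \<phi> = X_free \<phi>"
| "admissible (Some n) \<phi> = X_arity n \<phi>"

lemma admissible_simps [simp]:
  "admissible c (Eq s t)" "admissible c (Less s t)"
  "admissible c (Neg \<phi>) = admissible c \<phi>"
  "admissible c (Conj \<phi> \<psi>) \<longleftrightarrow> admissible c \<phi> \<and> admissible c \<psi>"
  "admissible c (Ex i \<phi>) = admissible c \<phi>"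
  by (cases c; simp)+

text \<open>The formula is chosen before \<open>X\<close>, which is where the uniformity of the
  sentence comes from.\<close>

definition expressible :: "nat option \<Rightarrow> nat set \<Rightarrow> (real list set \<Rightarrow> (nat \<Rightarrow> real) \<Rightarrow> bool) \<Rightarrow> bool" where
  "expressible c S Q \<longleftrightarrow>
     (\<exists>\<phi>. admissible c \<phi> \<and> free_vars \<phi> \<subseteq> S \<and> (\<forall>X e. sat X e \<phi> \<longleftrightarrow> Q X e))"

lemma expressibleI:
  "admissible c \<phi> \<Longrightarrow> free_vars \<phi> \<subseteq> S \<Longrightarrow> (\<And>X e. sat X e \<phi> \<longleftrightarrow> Q X e) \<Longrightarrow> expressible c S Q"
  unfolding expressible_def by blast

lemma expressible_neg:
  assumes "expressible c S Q"
  shows "expressible c S (\<lambda>X e. \<not> Q X e)"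
proof -
  from assms obtain \<phi> where "admissible c \<phi>" "free_vars \<phi> \<subseteq> S" "\<forall>X e. sat X e \<phi> \<longleftrightarrow> Q X e"
    unfolding expressible_def by blast
  then show ?thesis by (intro expressibleI[of c "Neg \<phi>"]) auto
qed

lemma expressible_conj:
  assumes "expressible c S Q" "expressible c S R"
  shows "expressible c S (\<lambda>X e. Q X e \<and> R X e)"
proof -
  from assms(1) obtain \<phi> where "admissible c \<phi>" "free_vars \<phi> \<subseteq> S" "\<forall>X e. sat X e \<phi> \<longleftrightarrow> Q X e"
    unfolding expressible_def by blast
  moreover from assms(2) obtain \<psi> where "admissible c \<psi>" "free_vars \<psi> \<subseteq> S" "\<forall>X e. sat X e \<psi> \<longleftrightarrow> R X e"
    unfolding expressible_def by blast
  ultimately show ?thesis by (intro expressibleI[of c "Conj \<phi> \<psi>"]) auto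
qed

lemma expressible_imp:
  assumes "expressible c S Q" "expressible c S R"
  shows "expressible c S (\<lambda>X e. Q X e \<longrightarrow> R X e)"
  using expressible_neg[OF expressible_conj[OF assms(1) expressible_neg[OF assms(2)]]] by simp

lemma expressible_iff:
  assumes "expressible c S Q" "expressible c S R"
  shows "expressible c S (\<lambda>X e. Q X e \<longleftrightarrow> R X e)"
  using expressible_conj[OF expressible_imp[OF assms] expressible_imp[OF assms(2,1)]]
  by (simp add: iff_conv_conj_imp)

lemma expressible_const: "expressible c S (\<lambda>X e. b)"
proof (cases b)
  case True
  then show ?thesis by (intro expressibleI[of c "Eq One One"]) auto
next
  case False
  then show ?thesis by (intro expressibleI[of c "Neg (Eq One One)"]) auto
qed

lemma expressible_ball:
  assumes "finite I" "\<And>i. i \<in> I \<Longrightarrow> expressible c S (Q i)"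
  shows "expressible c S (\<lambda>X e. \<forall>i\<in>I. Q i X e)"
  using assms by (induction I) (auto intro!: expressible_const expressible_conj)

lemma expressible_bex:
  assumes "finite I" "\<And>i. i \<in> I \<Longrightarrow> expressible c S (Q i)"
  shows "expressible c S (\<lambda>X e. \<exists>i\<in>I. Q i X e)"
  using expressible_neg[OF expressible_ball[of I c S "\<lambda>i X e. \<not> Q i X e"]] assms expressible_neg
  by auto

section \<open>Affine forms as terms of the language\<close>

definition affine_on :: "real set \<Rightarrow> nat \<Rightarrow> ((nat \<Rightarrow> real) \<Rightarrow> real) \<Rightarrow> bool" where
  "affine_on K n h \<longleftrightarrow>
     (\<exists>c a. c \<in> K \<and> (\<forall>i. a i \<in> K) \<and> (\<forall>e. h e = c + (\<Sum>i<n. a i * e i)))"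

text \<open>The language has no zero, so even an empty sum has to contain \<open>One\<close>. The
  resulting offset cancels when two such terms are compared.\<close>

lemma nat_affine_term:
  fixes c :: nat and a v :: "nat \<Rightarrow> nat"
  shows "\<exists>t. vars_tm t \<subseteq> v ` {..<n} \<and>
    (\<forall>e. eval_tm e t = 1 + real c + (\<Sum>i<n. real (a i) * e (v i)))"
proof -
  have mult: "\<exists>t'. vars_tm t' \<subseteq> vars_tm t \<union> vars_tm s \<and>
      (\<forall>e. eval_tm e t' = eval_tm e t + real m * eval_tm e s)" for t s and m :: nat
  proof (induction m)
    case 0
    show ?case by (intro exI[of _ t]) auto
  next
    case (Suc m)
    then obtain t' where "vars_tm t' \<subseteq> vars_tm t \<union> vars_tm s"
      "\<forall>e. eval_tm e t' = eval_tm e t + real m * eval_tm e s" by blast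
    then show ?case by (intro exI[of _ "Add t' s"]) (auto simp: algebra_simps)
  qed
  show ?thesis
  proof (induction n)
    case 0
    from mult[of One One c] show ?case by simp
  next
    case (Suc n)
    then obtain t where t: "vars_tm t \<subseteq> v ` {..<n}"
      "\<forall>e. eval_tm e t = 1 + real c + (\<Sum>i<n. real (a i) * e (v i))" by blast
    from mult[of t "Var (v n)" "a n"] obtain t' where "vars_tm t' \<subseteq> vars_tm t \<union> {v n}"
      "\<forall>e. eval_tm e t' = eval_tm e t + real (a n) * e (v n)" by auto
    with t show ?case by (intro exI[of _ t']) (auto simp: lessThan_Suc)
  qed
qed

lemma common_denominator:
  fixes a :: "nat \<Rightarrow> real"
  assumes "\<And>i. a i \<in> \<rat>"
  shows "\<exists>D::nat. D > 0 \<and> (\<forall>i<n. real D * a i \<in> \<int>)"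
proof (induction n)
  case 0
  show ?case by (intro exI[of _ 1]) auto
next
  case (Suc n)
  then obtain D :: nat where D: "D > 0" "\<forall>i<n. real D * a i \<in> \<int>" by blast
  from assms[of n] obtain p :: int and q :: nat where pq: "q > 0" "a n = of_int p / real q"
    by (metis Rats_cases' of_int_of_nat_eq pos_int_cases zero_less_imp_eq_int)
  have "real (D * q) * a i \<in> \<int>" if "i < Suc n" for i
  proof (cases "i = n")
    case True
    then have "real (D * q) * a i = of_int (int D * p)" using pq by simp
    then show ?thesis by (metis Ints_of_int)
  next
    case False
    then have "i < n" using that by simp
    then have "real D * a i \<in> \<int>" using D by blast
    from Ints_mult[OF Ints_of_nat this] have "real q * (real D * a i) \<in> \<int>" .
    moreover have "real (D * q) * a i = real q * (real D * a i)" by simp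
    ultimately show ?thesis by (simp only:)
  qed
  then show ?case using D pq by (intro exI[of _ "D * q"]) auto
qed

text \<open>Neither subtraction nor division is available: a common denominator is cleared and the
  negative coefficients go to the other side of the comparison.\<close>

lemma rational_affine_terms:
  assumes "affine_on \<rat> n h"
  shows "\<exists>s t (D::nat). D > 0 \<and> vars_tm s \<subseteq> v ` {..<n} \<and> vars_tm t \<subseteq> v ` {..<n} \<and>
    (\<forall>e. eval_tm e s - eval_tm e t = real D * h (\<lambda>i. e (v i)))"
proof -
  from assms obtain c a where h: "c \<in> \<rat>" "\<And>i. a i \<in> \<rat>" "\<And>e. h e = c + (\<Sum>i<n. a i * e i)"
    unfolding affine_on_def by blast
  \<comment> \<open>Index \<open>n\<close> stores the constant term, so that one denominator serves
    it together with the coefficients.\<close>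
  define b where "b = (\<lambda>i. if i < n then a i else c)"
  have "b i \<in> \<rat>" for i using h by (simp add: b_def)
  from common_denominator[of b "Suc n", OF this] obtain D :: nat
    where D: "D > 0" "\<forall>i<Suc n. real D * b i \<in> \<int>" by blast
  then have "\<forall>i<Suc n. \<exists>z::int. real D * b i = of_int z" by (auto elim: Ints_cases)
  then obtain z :: "nat \<Rightarrow> int" where z: "\<And>i. i < Suc n \<Longrightarrow> real D * b i = of_int (z i)" by metis
  define p q where "p = (\<lambda>i. nat (z i))" and "q = (\<lambda>i. nat (- z i))"
  have pq: "real (p i) - real (q i) = real D * b i" if "i < Suc n" for i
    using z[OF that] by (cases "z i \<ge> 0") (auto simp: p_def q_def)
  obtain s where s: "vars_tm s \<subseteq> v ` {..<n}"
    "\<And>e. eval_tm e s = 1 + real (p n) + (\<Sum>i<n. real (p i) * e (v i))"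
    using nat_affine_term[of v n "p n" p] by blast
  obtain t where t: "vars_tm t \<subseteq> v ` {..<n}"
    "\<And>e. eval_tm e t = 1 + real (q n) + (\<Sum>i<n. real (q i) * e (v i))"
    using nat_affine_term[of v n "q n" q] by blast
  have "eval_tm e s - eval_tm e t = real D * h (\<lambda>i. e (v i))" for e
  proof -
    have "eval_tm e s - eval_tm e t
        = (real (p n) - real (q n)) + (\<Sum>i<n. (real (p i) - real (q i)) * e (v i))"
      by (simp add: s t left_diff_distrib sum_subtractf)
    also have "\<dots> = real D * c + (\<Sum>i<n. real D * a i * e (v i))"
      using pq by (auto simp: b_def intro!: sum.cong arg_cong2[where f = "(+)"])
    also have "\<dots> = real D * h (\<lambda>i. e (v i))"
      by (simp add: h(3) distrib_left sum_distrib_left mult_ac)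
    finally show ?thesis .
  qed
  with D s t show ?thesis by blast
qed

lemma expressible_affine:
  assumes "affine_on \<rat> n h" "v ` {..<n} \<subseteq> S"
  shows "expressible c S (\<lambda>X e. h (\<lambda>i. e (v i)) = 0)" "expressible c S (\<lambda>X e. h (\<lambda>i. e (v i)) < 0)"
proof -
  obtain s t D where D: "(D::nat) > 0" and "vars_tm s \<subseteq> v ` {..<n}" "vars_tm t \<subseteq> v ` {..<n}"
    and st: "\<And>e. eval_tm e s - eval_tm e t = real D * h (\<lambda>i. e (v i))"
    using rational_affine_terms[OF assms(1), of v] by metis
  then have vs: "vars_tm s \<subseteq> S" "vars_tm t \<subseteq> S" using assms(2) by auto
  have "eval_tm e s = eval_tm e t \<longleftrightarrow> h (\<lambda>i. e (v i)) = 0" for e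
    using st[of e] D by auto
  then show "expressible c S (\<lambda>X e. h (\<lambda>i. e (v i)) = 0)"
    using vs by (intro expressibleI[of c "Eq s t"]) auto
  have "eval_tm e s < eval_tm e t \<longleftrightarrow> real D * h (\<lambda>i. e (v i)) < 0" for e
    using st[of e] by linarith
  then have "eval_tm e s < eval_tm e t \<longleftrightarrow> h (\<lambda>i. e (v i)) < 0" for e
    using D by (simp add: mult_less_0_iff)
  then show "expressible c S (\<lambda>X e. h (\<lambda>i. e (v i)) < 0)"
    using vs by (intro expressibleI[of c "Less s t"]) auto
qed

text \<open>A semilinear set is represented by a finite \<open>H\<close> of affine forms with \<open>sign_det H UNIV A\<close>.\<close>

definition sign_det :: "((nat \<Rightarrow> real) \<Rightarrow> real) set \<Rightarrow> (nat \<Rightarrow> real) set \<Rightarrow> (nat \<Rightarrow> real) set \<Rightarrow> bool" where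
  "sign_det H S A \<longleftrightarrow>
     (\<forall>x\<in>S. \<forall>y\<in>S. (\<forall>h\<in>H. sgn (h x) = sgn (h y)) \<longrightarrow> (x \<in> A \<longleftrightarrow> y \<in> A))"

text \<open>A sign vector, coded by the forms that vanish and those that are negative; as a pair of
  subsets of \<open>H\<close> it ranges over a finite set.\<close>

definition cell_of :: "((nat \<Rightarrow> real) \<Rightarrow> real) set \<Rightarrow> (nat \<Rightarrow> real) \<Rightarrow>
    ((nat \<Rightarrow> real) \<Rightarrow> real) set \<times> ((nat \<Rightarrow> real) \<Rightarrow> real) set" where
  "cell_of H x = ({h \<in> H. h x = 0}, {h \<in> H. h x < 0})"

lemma cell_of_eq_iff: "cell_of H x = cell_of H y \<longleftrightarrow> (\<forall>h\<in>H. sgn (h x) = sgn (h y))"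
proof
  assume *: "cell_of H x = cell_of H y"
  show "\<forall>h\<in>H. sgn (h x) = sgn (h y)"
  proof
    fix h assume "h \<in> H"
    with * have "h x = 0 \<longleftrightarrow> h y = 0" "h x < 0 \<longleftrightarrow> h y < 0"
      by (auto simp: cell_of_def set_eq_iff)
    then show "sgn (h x) = sgn (h y)" by (auto simp: sgn_if)
  qed
next
  assume *: "\<forall>h\<in>H. sgn (h x) = sgn (h y)"
  have "h x = 0 \<longleftrightarrow> h y = 0" "h x < 0 \<longleftrightarrow> h y < 0" if "h \<in> H" for h
    using bspec[OF * that] by (auto simp: sgn_if split: if_splits)
  then show "cell_of H x = cell_of H y" by (auto simp: cell_of_def)
qed

lemma finite_cells: "finite H \<Longrightarrow> finite (cell_of H ` S)"
  by (rule finite_subset[of _ "Pow H \<times> Pow H"]) (auto simp: cell_of_def)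

text \<open>Only the signs of the forms at \<open>y\<close> enter the formula, as constants, so a
  possibly irrational \<open>y\<close> does not become a parameter.\<close>

lemma expressible_cell:
  assumes "finite H" "\<And>h. h \<in> H \<Longrightarrow> affine_on \<rat> n h" "v ` {..<n} \<subseteq> S"
  shows "expressible c S (\<lambda>X e. cell_of H (\<lambda>i. e (v i)) = cell_of H y)"
proof -
  have eq: "cell_of H x = cell_of H y \<longleftrightarrow>
      (\<forall>h\<in>H. (h x = 0 \<longleftrightarrow> h y = 0) \<and> (h x < 0 \<longleftrightarrow> h y < 0))" for x
    by (auto simp: cell_of_def set_eq_iff)
  show ?thesis unfolding eq
    by (intro expressible_ball expressible_conj expressible_iff expressible_const
        expressible_affine[where n = n and v = v] assms)
qed

text \<open>A set that depends only on signs is the union of the cells it meets. These are finitely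
  many, and the defining formula is their disjunction.\<close>

lemma sign_det_imp_definable:
  assumes "n \<ge> 1" "X \<subseteq> tuples n" "finite H" "\<And>h. h \<in> H \<Longrightarrow> affine_on \<rat> n h"
    and det: "sign_det H UNIV {x. map x [0..<n] \<in> X}"
  shows "definable_R n X"
proof -
  define C where "C = cell_of H ` {x. map x [0..<n] \<in> X}"
  have "finite C" unfolding C_def using assms(3) by (rule finite_cells)
  have "expressible None {..<n} (\<lambda>X e. \<exists>c\<in>C. cell_of H (\<lambda>i. e i) = c)"
  proof (rule expressible_bex[OF \<open>finite C\<close>])
    fix c assume "c \<in> C"
    then obtain y where "c = cell_of H y" unfolding C_def by blast
    then show "expressible None {..<n} (\<lambda>X e. cell_of H (\<lambda>i. e i) = c)"
      using expressible_cell[OF assms(3,4), of "\<lambda>i. i"] by auto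
  qed
  then obtain \<phi> where \<phi>: "X_free \<phi>" "free_vars \<phi> \<subseteq> {..<n}"
      "\<And>X e. sat X e \<phi> \<longleftrightarrow> cell_of H e \<in> C"
    unfolding expressible_def by auto
  have "xs \<in> X \<longleftrightarrow> sat {} (nth xs) \<phi>" if "xs \<in> tuples n" for xs
  proof -
    have "map (nth xs) [0..<n] = xs" using that by (auto simp: tuples_def map_nth)
    moreover have "cell_of H (nth xs) \<in> C \<longleftrightarrow> map (nth xs) [0..<n] \<in> X"
    proof
      assume "cell_of H (nth xs) \<in> C"
      then obtain y where "map y [0..<n] \<in> X" "\<forall>h\<in>H. sgn (h (nth xs)) = sgn (h y)"
        unfolding C_def by (auto simp: cell_of_eq_iff)
      with det show "map (nth xs) [0..<n] \<in> X" unfolding sign_det_def by blast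
    qed (auto simp: C_def)
    ultimately show ?thesis by (simp add: \<phi>)
  qed
  then show ?thesis unfolding definable_R_def using assms(1,2) \<phi> by blast
qed

section \<open>Closure properties of affine forms\<close>

definition coeff_ring :: "real set \<Rightarrow> bool" where
  "coeff_ring K \<longleftrightarrow> 0 \<in> K \<and> 1 \<in> K \<and> (\<forall>a\<in>K. \<forall>b\<in>K. a + b \<in> K \<and> a * b \<in> K)"

lemma coeff_ring_UNIV [simp]: "coeff_ring UNIV" and coeff_ring_Rats [simp]: "coeff_ring \<rat>"
  by (auto simp: coeff_ring_def)

lemma affine_onI: "c \<in> K \<Longrightarrow> (\<And>i. a i \<in> K) \<Longrightarrow> (\<And>e. h e = c + (\<Sum>i<n. a i * e i)) \<Longrightarrow> affine_on K n h"
  unfolding affine_on_def by blast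

lemma affine_on_const: "coeff_ring K \<Longrightarrow> c \<in> K \<Longrightarrow> affine_on K n (\<lambda>_. c)"
  by (rule affine_onI[where c = c and a = "\<lambda>_. 0"]) (auto simp: coeff_ring_def)

lemma affine_on_coord:
  assumes "coeff_ring K" "i < n"
  shows "affine_on K n (\<lambda>e. e i)"
proof (rule affine_onI[where c = 0 and a = "\<lambda>j. if j = i then 1 else 0"])
  fix e :: "nat \<Rightarrow> real"
  have "(\<Sum>j<n. (if j = i then 1 else 0) * e j) = (\<Sum>j<n. if j = i then e j else 0)"
    by (rule sum.cong) auto
  then show "e i = 0 + (\<Sum>j<n. (if j = i then 1 else 0) * e j)" using assms(2) by simp
qed (use assms(1) in \<open>auto simp: coeff_ring_def\<close>)

lemma affine_on_lincomb:
  assumes "coeff_ring K" "affine_on K n f" "affine_on K n g" "s \<in> K" "t \<in> K"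
  shows "affine_on K n (\<lambda>e. s * f e + t * g e)"
proof -
  obtain c a where f: "c \<in> K" "\<And>i. a i \<in> K" "\<And>e. f e = c + (\<Sum>i<n. a i * e i)"
    using assms(2) unfolding affine_on_def by blast
  obtain d b where g: "d \<in> K" "\<And>i. b i \<in> K" "\<And>e. g e = d + (\<Sum>i<n. b i * e i)"
    using assms(3) unfolding affine_on_def by blast
  show ?thesis
    by (rule affine_onI[where c = "s * c + t * d" and a = "\<lambda>i. s * a i + t * b i"])
      (use assms f g in \<open>auto simp: coeff_ring_def algebra_simps sum.distrib sum_distrib_left\<close>)
qed

lemma affine_on_diff:
  assumes "affine_on K n f" "affine_on K n g" "coeff_ring K" "-1 \<in> K"
  shows "affine_on K n (\<lambda>e. f e - g e)"
  using affine_on_lincomb[OF assms(3,1,2), of 1 "-1"] assms(3,4) by (simp add: coeff_ring_def)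

lemma affine_on_sum:
  assumes "coeff_ring K" "finite I" "\<And>p. p \<in> I \<Longrightarrow> affine_on K n (f p)" "\<And>p. p \<in> I \<Longrightarrow> b p \<in> K"
  shows "affine_on K n (\<lambda>e. \<Sum>p\<in>I. f p e * b p)"
  using assms(2,3,4)
proof (induction I)
  case empty
  show ?case using assms(1) affine_on_const[of K 0] by (simp add: coeff_ring_def)
next
  case (insert p I)
  have "affine_on K n (\<lambda>e. b p * f p e + 1 * (\<Sum>p\<in>I. f p e * b p))"
    using insert assms(1) by (intro affine_on_lincomb) (auto simp: coeff_ring_def)
  with insert show ?case by (simp add: mult.commute)
qed

lemma affine_on_mono:
  assumes "affine_on K n h" "n \<le> m" "0 \<in> K"
  shows "affine_on K m h"
proof -
  obtain c a where h: "c \<in> K" "\<And>i. a i \<in> K" "\<And>e. h e = c + (\<Sum>i<n. a i * e i)"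
    using assms(1) unfolding affine_on_def by blast
  show ?thesis
  proof (rule affine_onI[where c = c and a = "\<lambda>i. if i < n then a i else 0"])
    fix e :: "nat \<Rightarrow> real"
    have "(\<Sum>i<m. (if i < n then a i else 0) * e i) = (\<Sum>i<n. a i * e i)"
      using assms(2) by (intro sum.mono_neutral_cong_right) auto
    then show "h e = c + (\<Sum>i<m. (if i < n then a i else 0) * e i)" by (simp add: h)
  qed (use h assms in auto)
qed

lemma affine_on_restrict:
  assumes "affine_on K n h" "0 \<in> K"
  shows "affine_on K n (\<lambda>e. h (\<lambda>i. if i \<in> I then e i else 0))"
proof -
  obtain c a where h: "c \<in> K" "\<And>i. a i \<in> K" "\<And>e. h e = c + (\<Sum>i<n. a i * e i)"
    using assms(1) unfolding affine_on_def by blast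
  show ?thesis
    by (rule affine_onI[where c = c and a = "\<lambda>i. if i \<in> I then a i else 0"])
      (use h assms(2) in \<open>auto intro!: sum.cong\<close>)
qed

text \<open>Quantifier elimination yields forms that may mention variables from \<open>n\<close> on;
  setting these to 0 leaves a form in \<open>n\<close> coordinates.\<close>

lemma affine_on_truncate:
  assumes "affine_on K N h" "0 \<in> K"
  shows "affine_on K n (\<lambda>e. h (\<lambda>i. if i < n then e i else 0))"
proof -
  obtain c a where h: "c \<in> K" "\<And>i. a i \<in> K" "\<And>e. h e = c + (\<Sum>i<N. a i * e i)"
    using assms(1) unfolding affine_on_def by blast
  show ?thesis
  proof (rule affine_onI[where c = c and a = "\<lambda>i. if i < N then a i else 0"])
    fix e :: "nat \<Rightarrow> real"
    have "(\<Sum>i<N. a i * (if i < n then e i else 0)) = (\<Sum>i<min n N. a i * e i)"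
      by (rule sum.mono_neutral_cong_right) auto
    also have "\<dots> = (\<Sum>i<n. (if i < N then a i else 0) * e i)"
      by (rule sum.mono_neutral_cong_left) auto
    finally show "h (\<lambda>i. if i < n then e i else 0) = c + (\<Sum>i<n. (if i < N then a i else 0) * e i)"
      by (simp add: h)
  qed (use h assms in auto)
qed

lemma affine_on_update:
  assumes "affine_on K n h"
  shows "\<exists>\<alpha>. \<forall>e t. h (e(i := t)) = h (e(i := 0)) + \<alpha> * t"
proof -
  obtain c a where h: "\<And>e. h e = c + (\<Sum>i<n. a i * e i)"
    using assms unfolding affine_on_def by blast
  have "h (e(i := t)) = h (e(i := 0)) + (if i < n then a i else 0) * t" for e t
  proof -
    have "(\<Sum>j<n. a j * (e(i := t)) j) = (\<Sum>j<n. a j * (e(i := 0)) j + (if j = i then a j * t else 0))"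
      by (rule sum.cong) auto
    then show ?thesis by (simp add: h sum.distrib)
  qed
  then show ?thesis by blast
qed

text \<open>The base point \<open>u\<close> is kept apart from the segment from \<open>x\<close> to
  \<open>y\<close>, because the same identity serves for walking along the segment and for
  translating nearby points in its direction.\<close>

lemma affine_on_segment:
  assumes "affine_on K n h"
  shows "h (\<lambda>i. u i + t * (y i - x i)) = h u + t * (h y - h x)"
proof -
  obtain c a where h: "\<And>e. h e = c + (\<Sum>i<n. a i * e i)"
    using assms unfolding affine_on_def by blast
  show ?thesis
    by (simp add: h algebra_simps sum.distrib sum_subtractf sum_distrib_left)
qed

lemma affine_on_cong: "affine_on K n h \<Longrightarrow> (\<And>i. i < n \<Longrightarrow> x i = y i) \<Longrightarrow> h x = h y"
  unfolding affine_on_def by (auto intro!: sum.cong)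

section \<open>Quantifier elimination\<close>

text \<open>A value that coincides with some \<open>\<rho> g\<close> is answered by
  \<open>\<rho>' g\<close>. Any other value lies in a gap of the finitely many
  \<open>\<rho> h\<close>, and the corresponding gap on the other side is nonempty because the order
  is dense without endpoints.\<close>

lemma order_type_transfer:
  fixes \<rho> \<rho>' :: "'a \<Rightarrow> real"
  assumes "finite S" and same: "\<And>g h. g \<in> S \<Longrightarrow> h \<in> S \<Longrightarrow> sgn (\<rho> g - \<rho> h) = sgn (\<rho>' g - \<rho>' h)"
  shows "\<exists>t'. \<forall>h\<in>S. sgn (t - \<rho> h) = sgn (t' - \<rho>' h)"
proof (cases "\<exists>g\<in>S. t = \<rho> g")
  case True
  then show ?thesis using same by blast
next
  case False
  \<comment> \<open>The images of the values below and above \<open>t\<close>; the new point has to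
    separate them.\<close>
  define L U where "L = \<rho>' ` {h \<in> S. \<rho> h < t}" and "U = \<rho>' ` {h \<in> S. \<rho> h > t}"
  have fin: "finite L" "finite U" using assms(1) by (auto simp: L_def U_def)
  have "\<rho>' g < \<rho>' h" if "g \<in> S" "h \<in> S" "\<rho> g < t" "t < \<rho> h" for g h
    using same[OF that(1,2)] that by (auto simp: sgn_if split: if_splits)
  then have LU: "l < u" if "l \<in> L" "u \<in> U" for l u using that by (auto simp: L_def U_def)
  obtain t' where t': "\<forall>l\<in>L. l < t'" "\<forall>u\<in>U. t' < u"
  proof (cases "L = {}")
    case True
    show ?thesis
    proof (cases "U = {}")
      case False
      have "Min U - 1 < u" if "u \<in> U" for u using Min_le[OF fin(2) that] by simp
      with True that show ?thesis by blast
    qed (use True that in auto)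
  next
    case ne: False
    show ?thesis
    proof (cases "U = {}")
      case True
      have "l < Max L + 1" if "l \<in> L" for l using Max_ge[OF fin(1) that] by simp
      with True that show ?thesis by blast
    next
      case False
      then have "Max L < Min U" using LU ne fin by simp
      then obtain t' where "Max L < t'" "t' < Min U" using dense by blast
      then show ?thesis using that fin ne False by (metis Max_less_iff Min_gr_iff)
    qed
  qed
  have "sgn (t - \<rho> h) = sgn (t' - \<rho>' h)" if "h \<in> S" for h
  proof (cases "\<rho> h < t")
    case True
    then have "\<rho>' h < t'" using that t' by (auto simp: L_def)
    with True show ?thesis by simp
  next
    case False
    with that \<open>\<not> (\<exists>g\<in>S. t = \<rho> g)\<close> have "\<rho> h > t" by force
    moreover from this have "t' < \<rho>' h" using that t' by (auto simp: U_def)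
    ultimately show ?thesis by simp
  qed
  then show ?thesis by blast
qed

lemma sign_det_subset: "sign_det H S A \<Longrightarrow> H \<subseteq> H' \<Longrightarrow> T \<subseteq> S \<Longrightarrow> sign_det H' T A"
  unfolding sign_det_def by (meson subset_iff)

text \<open>Fourier-Motzkin elimination: the roots in the eliminated variable are compared pairwise.\<close>

lemma sign_det_exists:
  assumes "finite H" and aff: "\<And>h. h \<in> H \<Longrightarrow> affine_on UNIV n h" and det: "sign_det H UNIV A"
  shows "\<exists>H'. finite H' \<and> (\<forall>h\<in>H'. affine_on UNIV n h) \<and> sign_det H' UNIV {e. \<exists>t. e(i := t) \<in> A}"
proof -
  have "\<forall>h\<in>H. \<exists>\<alpha>. \<forall>e t. h (e(i := t)) = h (e(i := 0)) + \<alpha> * t"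
    using affine_on_update[OF aff] by blast
  from bchoice[OF this] obtain \<alpha>
    where \<alpha>: "\<And>h e t. h \<in> H \<Longrightarrow> h (e(i := t)) = h (e(i := 0)) + \<alpha> h * t" by auto
  define h0 where "h0 = (\<lambda>h (e::nat \<Rightarrow> real). h (e(i := 0)) :: real)"
  define S where "S = {h \<in> H. \<alpha> h \<noteq> 0}"
  define \<rho> where "\<rho> = (\<lambda>e h. - h0 h e / \<alpha> h)"
  \<comment> \<open>\<open>\<rho> e h\<close> is the root of \<open>h\<close> in the eliminated
    variable. Forms without that variable are covered by \<open>h0\<close>; the differences record
    the order of the roots.\<close>
  define H' where "H' = h0 ` H \<union> (\<lambda>(g, h) e. \<rho> e g - \<rho> e h) ` (S \<times> S)"
  have "finite S" "S \<subseteq> H" using assms(1) by (auto simp: S_def)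
  have aff0: "affine_on UNIV n (h0 h)" if "h \<in> H" for h
  proof -
    have "(\<lambda>j. if j \<in> - {i} then e j else 0) = e(i := 0)" for e :: "nat \<Rightarrow> real" by auto
    with affine_on_restrict[OF aff[OF that], of "- {i}"] show ?thesis by (simp add: h0_def)
  qed
  have aff\<rho>: "affine_on UNIV n (\<lambda>e. \<rho> e h)" if "h \<in> S" for h
  proof -
    have "h \<in> H" using that \<open>S \<subseteq> H\<close> by blast
    from affine_on_lincomb[OF coeff_ring_UNIV aff0[OF this] aff0[OF this], of "- 1 / \<alpha> h" 0]
    show ?thesis by (simp add: \<rho>_def)
  qed
  have key: "e'(i := t') \<in> A \<longleftrightarrow> e(i := t) \<in> A" if "\<forall>h\<in>H'. sgn (h e) = sgn (h e')"
    and "\<forall>h\<in>S. sgn (t - \<rho> e h) = sgn (t' - \<rho> e' h)" for e e' t t'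
  proof -
    have "sgn (h (e(i := t))) = sgn (h (e'(i := t')))" if "h \<in> H" for h
    proof (cases "\<alpha> h = 0")
      case True
      have "h0 h \<in> H'" using that by (auto simp: H'_def)
      then have "sgn (h0 h e) = sgn (h0 h e')" using \<open>\<forall>h\<in>H'. sgn (h e) = sgn (h e')\<close> by blast
      then show ?thesis using True that by (simp add: \<alpha>[OF that, of _ t] \<alpha>[OF that, of _ t'] h0_def)
    next
      case False
      \<comment> \<open>The sign of \<open>h\<close> is that of its slope times that of the distance
        to its root, so only the position of \<open>t\<close> among the roots matters.\<close>
      have eq: "h (e(i := t)) = \<alpha> h * (t - \<rho> e h)" for e t
        using False \<alpha>[OF that, of e t] by (simp add: \<rho>_def h0_def field_simps)
      have "h \<in> S" using False that by (simp add: S_def)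
      then have "sgn (t - \<rho> e h) = sgn (t' - \<rho> e' h)"
        using \<open>\<forall>h\<in>S. sgn (t - \<rho> e h) = sgn (t' - \<rho> e' h)\<close> by blast
      then show ?thesis by (simp add: eq sgn_mult)
    qed
    with det show ?thesis unfolding sign_det_def by blast
  qed
  have "sign_det H' UNIV {e. \<exists>t. e(i := t) \<in> A}"
    unfolding sign_det_def
  proof (intro ballI impI)
    fix e e' :: "nat \<Rightarrow> real" assume sg: "\<forall>h\<in>H'. sgn (h e) = sgn (h e')"
    have imp: "\<exists>t'. e'(i := t') \<in> A" if "e(i := t) \<in> A" "\<forall>h\<in>H'. sgn (h e) = sgn (h e')" for e e' t
    proof -
      have "sgn (\<rho> e g - \<rho> e h) = sgn (\<rho> e' g - \<rho> e' h)" if "g \<in> S" "h \<in> S" for g h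
      proof -
        have "(\<lambda>e. \<rho> e g - \<rho> e h) \<in> H'" using that by (force simp: H'_def)
        with \<open>\<forall>h\<in>H'. sgn (h e) = sgn (h e')\<close> show ?thesis by (rule bspec)
      qed
      from order_type_transfer[OF \<open>finite S\<close>, of "\<rho> e" "\<rho> e'", OF this] obtain t'
        where "\<forall>h\<in>S. sgn (t - \<rho> e h) = sgn (t' - \<rho> e' h)" by blast
      with key that show ?thesis by blast
    qed
    show "e \<in> {e. \<exists>t. e(i := t) \<in> A} \<longleftrightarrow> e' \<in> {e. \<exists>t. e(i := t) \<in> A}"
      using imp[of e _ e'] imp[of e' _ e] sg by auto
  qed
  moreover have "finite H'" using \<open>finite S\<close> assms(1) by (simp add: H'_def)
  moreover have "\<forall>h\<in>H'. affine_on UNIV n h"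
    using aff0 aff\<rho> by (auto simp: H'_def intro!: affine_on_diff)
  ultimately show ?thesis by blast
qed

lemma eval_tm_affine: "\<exists>n. affine_on UNIV n (\<lambda>e. eval_tm e t)"
proof (induction t)
  case (Var i)
  then show ?case using affine_on_coord[of UNIV i "Suc i"] by auto
next
  case One
  then show ?case using affine_on_const[of UNIV 1] by auto
next
  case (Add s t)
  then obtain m n where "affine_on UNIV m (\<lambda>e. eval_tm e s)" "affine_on UNIV n (\<lambda>e. eval_tm e t)"
    by blast
  then have "affine_on UNIV (max m n) (\<lambda>e. eval_tm e s)" "affine_on UNIV (max m n) (\<lambda>e. eval_tm e t)"
    by (auto elim: affine_on_mono)
  from affine_on_lincomb[OF coeff_ring_UNIV this, of 1 1] show ?case by auto
qed

lemma X_free_sign_det: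
  assumes "X_free \<phi>"
  shows "\<exists>n H. finite H \<and> (\<forall>h\<in>H. affine_on UNIV n h) \<and> sign_det H UNIV {e. sat X e \<phi>}"
proof -
  have atom: "\<exists>n. \<forall>h\<in>{\<lambda>e. eval_tm e s - eval_tm e t}. affine_on UNIV n h" for s t
  proof -
    obtain m n where "affine_on UNIV m (\<lambda>e. eval_tm e s)" "affine_on UNIV n (\<lambda>e. eval_tm e t)"
      using eval_tm_affine by blast
    then have "affine_on UNIV (max m n) (\<lambda>e. eval_tm e s)" "affine_on UNIV (max m n) (\<lambda>e. eval_tm e t)"
      by (auto elim: affine_on_mono)
    from affine_on_diff[OF this] show ?thesis by auto
  qed
  show ?thesis using assms
  proof (induction \<phi>)
    case (Eq s t)
    have "sign_det {\<lambda>e. eval_tm e s - eval_tm e t} UNIV {e. sat X e (Eq s t)}"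
      by (auto simp: sign_det_def sgn_if split: if_splits)
    then show ?case using atom[of s t] by blast
  next
    case (Less s t)
    have "sign_det {\<lambda>e. eval_tm e s - eval_tm e t} UNIV {e. sat X e (Less s t)}"
      by (auto simp: sign_det_def sgn_if split: if_splits)
    then show ?case using atom[of s t] by blast
  next
    case (Neg \<phi>)
    then have "X_free \<phi>" by simp
    moreover have "sign_det H UNIV {e. sat X e (Neg \<phi>)} \<longleftrightarrow> sign_det H UNIV {e. sat X e \<phi>}" for H
      unfolding sign_det_def by (intro ball_cong refl imp_cong) auto
    ultimately show ?case using Neg.IH by simp
  next
    case (Conj \<phi> \<psi>)
    then obtain m n G H where GH: "finite G" "finite H" "\<forall>h\<in>G. affine_on UNIV m h"
      "\<forall>h\<in>H. affine_on UNIV n h"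
      and det: "sign_det G UNIV {e. sat X e \<phi>}" "sign_det H UNIV {e. sat X e \<psi>}" by auto
    have "\<forall>h\<in>G \<union> H. affine_on UNIV (max m n) h"
      using GH(3,4) affine_on_mono[of UNIV m _ "max m n"] affine_on_mono[of UNIV n _ "max m n"] by auto
    moreover have "sign_det (G \<union> H) UNIV {e. sat X e (Conj \<phi> \<psi>)}"
      using sign_det_subset[OF det(1), of "G \<union> H" UNIV] sign_det_subset[OF det(2), of "G \<union> H" UNIV]
      unfolding sign_det_def mem_Collect_eq sat.simps by blast
    moreover have "finite (G \<union> H)" using GH by simp
    ultimately show ?case by blast
  next
    case (Ex i \<phi>)
    then obtain n H where "finite H" "\<forall>h\<in>H. affine_on UNIV n h" "sign_det H UNIV {e. sat X e \<phi>}"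
      by auto
    from sign_det_exists[OF this(1) _ this(3), of n i] this(2) show ?case by auto
  qed auto
qed

lemma definable_imp_sign_det:
  assumes "definable_R n X"
  shows "\<exists>H. finite H \<and> (\<forall>h\<in>H. affine_on UNIV n h) \<and> sign_det H UNIV {x. map x [0..<n] \<in> X}"
proof -
  from assms obtain \<phi> where \<phi>: "X_free \<phi>" "free_vars \<phi> \<subseteq> {..<n}"
    "\<And>xs. xs \<in> tuples n \<Longrightarrow> xs \<in> X \<longleftrightarrow> sat {} (nth xs) \<phi>" unfolding definable_R_def by blast
  \<comment> \<open>No free variable of \<open>\<phi>\<close> lies at or beyond \<open>n\<close>, so
    the values there may be set to 0; the same substitution is then made in the forms.\<close>
  have A: "map x [0..<n] \<in> X \<longleftrightarrow> sat {} (\<lambda>i. if i < n then x i else 0) \<phi>" for x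
  proof -
    have "map x [0..<n] \<in> X \<longleftrightarrow> sat {} (nth (map x [0..<n])) \<phi>"
      by (rule \<phi>) (simp add: tuples_def)
    also have "\<dots> \<longleftrightarrow> sat {} (\<lambda>i. if i < n then x i else 0) \<phi>"
      using \<phi>(2) by (intro sat_cong) auto
    finally show ?thesis .
  qed
  obtain N H where H: "finite H" "\<forall>h\<in>H. affine_on UNIV N h" "sign_det H UNIV {e. sat {} e \<phi>}"
    using X_free_sign_det[OF \<phi>(1)] by blast
  define H' where "H' = (\<lambda>h x. h (\<lambda>i. if i < n then x i else 0)) ` H"
  have "sign_det H' UNIV {x. map x [0..<n] \<in> X}"
    using H(3) unfolding sign_det_def H'_def by (simp add: A)
  moreover have "\<forall>h\<in>H'. affine_on UNIV n h"
    using H(2) by (auto simp: H'_def intro!: affine_on_truncate)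
  moreover have "finite H'" using H by (simp add: H'_def)
  ultimately show ?thesis by blast
qed

section \<open>Subspaces of coordinate spaces\<close>

definition subsp :: "nat set \<Rightarrow> (nat \<Rightarrow> real) set \<Rightarrow> bool" where
  "subsp N V \<longleftrightarrow> (\<lambda>_. 0) \<in> V \<and>
     (\<forall>u\<in>V. \<forall>v\<in>V. \<forall>t. (\<lambda>i. u i + t * v i) \<in> V) \<and> (\<forall>v\<in>V. \<forall>i. i \<notin> N \<longrightarrow> v i = 0)"

lemma subsp_zero: "subsp N V \<Longrightarrow> (\<lambda>_. 0) \<in> V"
  and subsp_comb: "subsp N V \<Longrightarrow> u \<in> V \<Longrightarrow> v \<in> V \<Longrightarrow> (\<lambda>i. u i + t * v i) \<in> V"
  and subsp_support: "subsp N V \<Longrightarrow> v \<in> V \<Longrightarrow> i \<notin> N \<Longrightarrow> v i = 0"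
  unfolding subsp_def by blast+

lemma subsp_diff: "subsp N V \<Longrightarrow> u \<in> V \<Longrightarrow> v \<in> V \<Longrightarrow> (\<lambda>i. u i - v i) \<in> V"
  using subsp_comb[of N V u v "-1"] by simp

lemma subsp_scale: "subsp N V \<Longrightarrow> v \<in> V \<Longrightarrow> (\<lambda>i. t * v i) \<in> V"
  using subsp_comb[of N V "\<lambda>_. 0" v t] subsp_zero[of N V] by simp

lemma subsp_sum:
  assumes "subsp N V" "finite I" "\<And>p. p \<in> I \<Longrightarrow> B p \<in> V"
  shows "(\<lambda>i. \<Sum>p\<in>I. c p * B p i) \<in> V"
  using assms(2,3)
proof (induction I)
  case empty
  show ?case using subsp_zero[OF assms(1)] by simp
next
  case (insert p I)
  from subsp_comb[OF assms(1) insert.IH, of "B p" "c p"] insert show ?case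
    by (simp add: add.commute)
qed

text \<open>A minimal set of coordinates that determines the vectors of a subspace is a set of free
  coordinates; its cardinality serves as the dimension.\<close>

definition determines :: "nat set \<Rightarrow> (nat \<Rightarrow> real) set \<Rightarrow> bool" where
  "determines I V \<longleftrightarrow> (\<forall>v\<in>V. (\<forall>i\<in>I. v i = 0) \<longrightarrow> v = (\<lambda>_. 0))"

definition sdim :: "nat set \<Rightarrow> (nat \<Rightarrow> real) set \<Rightarrow> nat" where
  "sdim N V = (LEAST m. \<exists>I\<subseteq>N. determines I V \<and> card I = m)"

lemma determines_eqI:
  assumes "subsp N V" "determines I V" "u \<in> V" "v \<in> V" "\<And>i. i \<in> I \<Longrightarrow> u i = v i"
  shows "u = v"
proof -
  have "(\<lambda>i. u i - v i) = (\<lambda>_. 0)"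
    using assms subsp_diff[OF assms(1,3,4)] by (auto simp: determines_def)
  then show ?thesis by (simp add: fun_eq_iff)
qed

text \<open>By minimality of \<open>I\<close> for \<open>W\<close>, dropping \<open>p\<close> admits
  a nonzero vector of \<open>W\<close> that vanishes on the rest of \<open>I\<close>; scaled to 1 at
  \<open>p\<close>, these vectors are dual to the coordinates in \<open>I\<close>. They expand all
  of \<open>V\<close> because \<open>I\<close> determines \<open>V\<close>. With
  \<open>W = V\<close> this gives a basis; with a subspace of the same dimension it forces
  equality.\<close>

lemma subsp_coordinates:
  assumes V: "subsp N V" and N: "finite N" and W: "W \<subseteq> V" "subsp N W"
    and I: "I \<subseteq> N" "determines I V" and card: "card I = sdim N W"
  obtains B where "\<And>p. p \<in> I \<Longrightarrow> B p \<in> W"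
    "\<And>p q. p \<in> I \<Longrightarrow> q \<in> I \<Longrightarrow> B p q = (if p = q then 1 else 0)"
    "\<And>v. v \<in> V \<Longrightarrow> v = (\<lambda>i. \<Sum>p\<in>I. v p * B p i)"
proof -
  have "finite I" using I N by (blast intro: finite_subset)
  have "\<exists>b\<in>W. b p = 1 \<and> (\<forall>q\<in>I - {p}. b q = 0)" if p: "p \<in> I" for p
  proof -
    have "card (I - {p}) < sdim N W" using p \<open>finite I\<close> card by (metis card_Diff1_less)
    then have "\<not> determines (I - {p}) W"
      using not_less_Least[of "card (I - {p})" "\<lambda>m. \<exists>I\<subseteq>N. determines I W \<and> card I = m"] I
      unfolding sdim_def by blast
    then obtain v where v: "v \<in> W" "\<forall>q\<in>I - {p}. v q = 0" "v \<noteq> (\<lambda>_. 0)"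
      unfolding determines_def by blast
    then have "v p \<noteq> 0" using I(2) W(1) unfolding determines_def by blast
    with v subsp_scale[OF W(2) v(1), of "1 / v p"]
    show ?thesis by (intro bexI[of _ "\<lambda>i. 1 / v p * v i"]) auto
  qed
  then obtain B where B: "\<And>p. p \<in> I \<Longrightarrow> B p \<in> W" "\<And>p. p \<in> I \<Longrightarrow> B p p = (1::real)"
    "\<And>p q. p \<in> I \<Longrightarrow> q \<in> I - {p} \<Longrightarrow> B p q = 0" by metis
  have "v = (\<lambda>i. \<Sum>p\<in>I. v p * B p i)" if "v \<in> V" for v
  proof (rule determines_eqI[OF V I(2) that])
    show "(\<lambda>i. \<Sum>p\<in>I. v p * B p i) \<in> V"
      using B(1) W(1) by (intro subsp_sum[OF V \<open>finite I\<close>]) blast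
    fix i assume i: "i \<in> I"
    have "(\<Sum>p\<in>I. v p * B p i) = (\<Sum>p\<in>I. if p = i then v i else 0)"
      using B i by (intro sum.cong) auto
    then show "v i = (\<Sum>p\<in>I. v p * B p i)" using i \<open>finite I\<close> by simp
  qed
  with B show thesis by (intro that[of B]) auto
qed

lemma sdim_witness:
  assumes "subsp N V"
  obtains I where "I \<subseteq> N" "determines I V" "card I = sdim N V"
proof -
  have "determines N V"
    using assms unfolding determines_def subsp_def by (auto simp: fun_eq_iff)
  then have "\<exists>m. \<exists>I\<subseteq>N. determines I V \<and> card I = m" by blast
  from LeastI_ex[OF this] show thesis using that unfolding sdim_def by blast
qed

text \<open>If the dimensions agreed, a minimal coordinate set of \<open>V\<close> would be minimal
  for \<open>W\<close>, and the basis obtained inside \<open>W\<close> would span \<open>V\<close>.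
  The dimension serves as the induction measure when a germ changes along a path.\<close>

lemma sdim_strict_mono:
  assumes "subsp N V" "finite N" "subsp N W" "W \<subset> V"
  shows "sdim N W < sdim N V"
proof (rule ccontr)
  assume "\<not> sdim N W < sdim N V"
  obtain I where I: "I \<subseteq> N" "determines I V" "card I = sdim N V" using sdim_witness[OF assms(1)] .
  have "determines I W" using I(2) assms(4) unfolding determines_def by blast
  then have "sdim N W \<le> card I" unfolding sdim_def using I(1) by (intro Least_le) blast
  with I \<open>\<not> sdim N W < sdim N V\<close> have card: "card I = sdim N W" by simp
  obtain B where B: "\<And>p. p \<in> I \<Longrightarrow> B p \<in> W" "\<And>v. v \<in> V \<Longrightarrow> v = (\<lambda>i. \<Sum>p\<in>I. v p * B p i)"
    using subsp_coordinates[OF assms(1,2) psubset_imp_subset[OF assms(4)] assms(3) I(1,2) card]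
    by metis
  have "finite I" using I assms by (blast intro: finite_subset)
  have "V \<subseteq> W"
  proof
    fix v assume "v \<in> V"
    have "(\<lambda>i. \<Sum>p\<in>I. v p * B p i) \<in> W"
      by (rule subsp_sum[OF assms(3) \<open>finite I\<close>]) (rule B(1))
    with B(2)[OF \<open>v \<in> V\<close>] show "v \<in> W" by simp
  qed
  with assms(4) show False by blast
qed

lemma subsp_basis:
  assumes "subsp N V" "finite N"
  obtains I B where "I \<subseteq> N" "determines I V" "\<And>p. p \<in> I \<Longrightarrow> B p \<in> V"
    "\<And>p q. p \<in> I \<Longrightarrow> q \<in> I \<Longrightarrow> B p q = (if p = q then 1 else 0)"
    "\<And>v. v \<in> V \<Longrightarrow> v = (\<lambda>i. \<Sum>p\<in>I. v p * B p i)"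
proof -
  obtain I where I: "I \<subseteq> N" "determines I V" "card I = sdim N V" using sdim_witness[OF assms(1)] .
  show thesis by (rule subsp_coordinates[OF assms order_refl assms(1) I]) (rule that[OF I(1,2)])
qed

text \<open>The basis coefficients of a vector of \<open>V\<close> are its own entries at
  \<open>I\<close>. So approximations of \<open>w\<close> from \<open>V\<close> show that
  \<open>w\<close> is arbitrarily close to the fixed combination with coefficients
  \<open>w p\<close>, which lies in \<open>V\<close>.\<close>

lemma subsp_closed:
  assumes V: "subsp N V" "finite N" and w: "\<And>i. i \<notin> N \<Longrightarrow> w i = 0"
    and lim: "\<And>e. e > 0 \<Longrightarrow> \<exists>v\<in>V. \<forall>i\<in>N. \<bar>w i - v i\<bar> < e"
  shows "w \<in> V"
proof -
  obtain I B where I: "I \<subseteq> N" and B: "\<And>p. p \<in> I \<Longrightarrow> B p \<in> V"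
    "\<And>v. v \<in> V \<Longrightarrow> v = (\<lambda>i. \<Sum>p\<in>I. v p * B p i)"
    by (rule subsp_basis[OF V]) blast
  have "finite I" using I V(2) by (blast intro: finite_subset)
  let ?w = "\<lambda>i. \<Sum>p\<in>I. w p * B p i"
  have mem: "?w \<in> V" by (rule subsp_sum[OF V(1) \<open>finite I\<close>]) (rule B(1))
  have "w i = ?w i" for i
  proof (cases "i \<in> N")
    case False
    then show ?thesis using w subsp_support[OF V(1) mem False] by simp
  next
    case True
    \<comment> \<open>The summand 1 accounts for the error at coordinate \<open>i\<close> itself,
      the others for the errors of the coefficients.\<close>
    let ?C = "1 + (\<Sum>p\<in>I. \<bar>B p i\<bar>)"
    have C: "?C > 0" by (smt (verit) sum_nonneg abs_ge_zero)
    have "\<bar>w i - ?w i\<bar> \<le> e" if "e > 0" for e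
    proof -
      have "e / ?C > 0" using that C by simp
      from lim[OF this] obtain v where v: "v \<in> V" "\<And>j. j \<in> N \<Longrightarrow> \<bar>w j - v j\<bar> < e / ?C" by blast
      have "v i = (\<Sum>p\<in>I. v p * B p i)" using B(2)[OF v(1)] by (rule fun_cong)
      then have "w i - ?w i = (w i - v i) + (\<Sum>p\<in>I. (v p - w p) * B p i)"
        by (simp add: left_diff_distrib sum_subtractf)
      also have "\<bar>\<dots>\<bar> \<le> \<bar>w i - v i\<bar> + (\<Sum>p\<in>I. \<bar>(v p - w p) * B p i\<bar>)"
        by (rule order_trans[OF abs_triangle_ineq add_left_mono[OF sum_abs]])
      also have "\<dots> \<le> e / ?C + (\<Sum>p\<in>I. e / ?C * \<bar>B p i\<bar>)"
      proof (intro add_mono sum_mono)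
        show "\<bar>w i - v i\<bar> \<le> e / ?C" using v(2)[OF True] by simp
        fix p assume "p \<in> I"
        with I v(2)[of p] have "\<bar>v p - w p\<bar> \<le> e / ?C" by (auto simp: abs_minus_commute)
        then show "\<bar>(v p - w p) * B p i\<bar> \<le> e / ?C * \<bar>B p i\<bar>"
          unfolding abs_mult by (rule mult_right_mono) simp
      qed
      also have "\<dots> = e / ?C * ?C" by (simp only: distrib_left sum_distrib_left mult_1_right)
      also have "\<dots> = e" using C by simp
      finally show ?thesis .
    qed
    then have "\<bar>w i - ?w i\<bar> \<le> 0" using field_le_epsilon[of "\<bar>w i - ?w i\<bar>" 0] by simp
    then show ?thesis by simp
  qed
  then have "w = ?w" by (rule ext)
  with mem show ?thesis by simp
qed

lemma bounded_on_finite: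
  fixes v :: "nat \<Rightarrow> real"
  shows "\<exists>M>0. \<forall>i<n. \<bar>v i\<bar> \<le> M"
proof (induction n)
  case 0
  show ?case by (intro exI[of _ 1]) auto
next
  case (Suc n)
  then obtain M where "M > 0" "\<forall>i<n. \<bar>v i\<bar> \<le> M" by blast
  then show ?case by (intro exI[of _ "max M \<bar>v n\<bar>"]) (auto simp: less_Suc_eq max_def)
qed

text \<open>Connectedness of the unit interval, obtained by bisection. It is applied to membership
  and to equality of germs along a segment.\<close>

lemma locally_constant_segment:
  fixes P :: "real \<Rightarrow> bool"
  assumes "\<And>t. 0 \<le> t \<Longrightarrow> t \<le> 1 \<Longrightarrow> \<exists>e>0. \<forall>s. 0 \<le> s \<and> s \<le> 1 \<and> \<bar>s - t\<bar> < e \<longrightarrow> (P s \<longleftrightarrow> P t)"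
  shows "P 0 \<longleftrightarrow> P 1"
proof -
  have "0 \<le> (0::real) \<longrightarrow> (1::real) \<le> 1 \<longrightarrow> (P 0 \<longleftrightarrow> P 1)"
  proof (rule Bolzano[where P = "\<lambda>a b. 0 \<le> a \<longrightarrow> b \<le> 1 \<longrightarrow> (P a \<longleftrightarrow> P b)"])
    show "0 \<le> (1::real)" by simp
    fix a b c :: real
    assume "0 \<le> a \<longrightarrow> b \<le> 1 \<longrightarrow> P a = P b" "0 \<le> b \<longrightarrow> c \<le> 1 \<longrightarrow> P b = P c" "a \<le> b" "b \<le> c"
    then show "0 \<le> a \<longrightarrow> c \<le> 1 \<longrightarrow> P a = P c" by auto
  next
    fix x :: real assume x: "0 \<le> x" "x \<le> 1"
    from assms[OF this] obtain e where e: "e > 0"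
      "\<And>s. 0 \<le> s \<Longrightarrow> s \<le> 1 \<Longrightarrow> \<bar>s - x\<bar> < e \<Longrightarrow> P s = P x" by blast
    have "P a = P b" if "a \<le> x" "x \<le> b" "b - a < e" "0 \<le> a" "b \<le> 1" for a b
    proof -
      have "P a = P x" by (rule e(2)) (use that in auto)
      moreover have "P b = P x" by (rule e(2)) (use that in auto)
      ultimately show ?thesis by simp
    qed
    with e(1) show "\<exists>d>0. \<forall>a b. a \<le> x \<and> x \<le> b \<and> b - a < d \<longrightarrow> 0 \<le> a \<longrightarrow> b \<le> 1 \<longrightarrow> P a = P b"
      by blast
  qed
  then show ?thesis by simp
qed

section \<open>Local periods\<close>

text \<open>The first \<open>k\<close> coordinates are frozen: all notions below are relative to the affine subspace
  of the points that share these coordinates with the base point.\<close>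

definition near :: "nat \<Rightarrow> nat \<Rightarrow> (nat \<Rightarrow> real) \<Rightarrow> real \<Rightarrow> (nat \<Rightarrow> real) \<Rightarrow> bool" where
  "near n k y r u \<longleftrightarrow> (\<forall>i<k. u i = y i) \<and> (\<forall>i<n. k \<le> i \<longrightarrow> \<bar>u i - y i\<bar> < r)"

definition period :: "nat \<Rightarrow> (nat \<Rightarrow> real) set \<Rightarrow> nat \<Rightarrow> (nat \<Rightarrow> real) \<Rightarrow> real \<Rightarrow> (nat \<Rightarrow> real) \<Rightarrow> bool" where
  "period n A k y r w \<longleftrightarrow> near n k (\<lambda>_. 0) r w \<and>
     (\<forall>u. near n k y r u \<longrightarrow> (u \<in> A \<longleftrightarrow> (\<lambda>i. u i + w i) \<in> A))"

text \<open>Real multiples of a vector are not definable. Closedness and closure under midpoints force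
  the local periods to contain, with a vector, the whole segment from the origin to it.\<close>

definition good :: "nat \<Rightarrow> (nat \<Rightarrow> real) set \<Rightarrow> nat \<Rightarrow> (nat \<Rightarrow> real) \<Rightarrow> bool" where
  "good n A k y \<longleftrightarrow> (\<exists>r0>0. \<forall>r. 0 < r \<and> r \<le> r0 \<longrightarrow>
     (\<forall>v w w'. period n A k y r w \<and> period n A k y r w' \<and> (\<forall>i<n. v i + v i = w i + w' i) \<longrightarrow>
        period n A k y r v) \<and>
     (\<forall>w. near n k (\<lambda>_. 0) r w \<and> (\<forall>e>0. \<exists>w'. period n A k y r w' \<and> near n k w e w') \<longrightarrow>
        period n A k y r w) \<and>
     (\<exists>w. period n A k y r w \<and> w k \<noteq> 0))"

definition tame :: "nat \<Rightarrow> (nat \<Rightarrow> real) set \<Rightarrow> bool" where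
  "tame n A \<longleftrightarrow> (\<forall>k<n. \<forall>x. \<exists>m d. d > 0 \<and> (\<forall>y. (\<forall>i<k. y i = x i) \<and> \<not> good n A k y \<longrightarrow>
     \<bar>y k\<bar> < m \<and> (\<forall>z. (\<forall>i<k. z i = x i) \<and> \<not> good n A k z \<and> y k < z k \<longrightarrow> y k + d \<le> z k)))"

lemma near_mono: "near n k y r u \<Longrightarrow> r \<le> r' \<Longrightarrow> near n k y r' u"
  unfolding near_def by force

lemma near_add:
  assumes "near n k y r u" "near n k (\<lambda>_. 0) r' w" "r + r' \<le> R"
  shows "near n k y R (\<lambda>i. u i + w i)"
  unfolding near_def
proof (intro conjI allI impI)
  fix i assume "i < n" "k \<le> i"
  then have "\<bar>u i - y i\<bar> < r" "\<bar>w i - 0\<bar> < r'" using assms(1,2) unfolding near_def by blast+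
  then show "\<bar>u i + w i - y i\<bar> < R" using assms(3) by linarith
qed (use assms in \<open>auto simp: near_def\<close>)

lemma near_finite_radius:
  assumes "finite H" "\<And>h. h \<in> H \<Longrightarrow> \<exists>\<rho>>0. \<forall>u. near n k y \<rho> u \<longrightarrow> Q h u"
  shows "\<exists>\<rho>>0. \<forall>h\<in>H. \<forall>u. near n k y \<rho> u \<longrightarrow> Q h u"
  using assms
proof (induction H)
  case empty
  show ?case by (intro exI[of _ 1]) auto
next
  case (insert h H)
  then obtain \<rho> where \<rho>: "\<rho> > 0" "\<forall>h\<in>H. \<forall>u. near n k y \<rho> u \<longrightarrow> Q h u" by auto
  from insert.prems[of h] obtain \<rho>' where \<rho>': "\<rho>' > 0" "\<forall>u. near n k y \<rho>' u \<longrightarrow> Q h u" by auto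
  have "near n k y \<rho> u" "near n k y \<rho>' u" if "near n k y (min \<rho> \<rho>') u" for u
    using near_mono[OF that] by auto
  with \<rho> \<rho>' show ?case by (intro exI[of _ "min \<rho> \<rho>'"]) auto
qed

lemma affine_sign_near:
  assumes "affine_on K n h" "h y \<noteq> 0"
  shows "\<exists>\<rho>>0. \<forall>u. near n k y \<rho> u \<longrightarrow> sgn (h u) = sgn (h y)"
proof -
  obtain c a where h: "\<And>e. h e = c + (\<Sum>i<n. a i * e i)"
    using assms(1) unfolding affine_on_def by blast
  \<comment> \<open>The sum bounds the variation of \<open>h\<close> relative to the size of the
    box; the summand 1 keeps the radius positive and the estimate strict even for a constant
    form.\<close>
  let ?C = "1 + (\<Sum>i<n. \<bar>a i\<bar>)"
  have C: "?C > 0" by (smt (verit) sum_nonneg abs_ge_zero)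
  have "sgn (h u) = sgn (h y)" if u: "near n k y (\<bar>h y\<bar> / ?C) u" for u
  proof -
    have "\<bar>u i - y i\<bar> \<le> \<bar>h y\<bar> / ?C" if "i < n" for i
      using u that C by (cases "i < k") (auto simp: near_def intro: less_imp_le)
    then have "\<bar>\<Sum>i<n. a i * (u i - y i)\<bar> \<le> (\<Sum>i<n. \<bar>a i\<bar> * (\<bar>h y\<bar> / ?C))"
      by (intro order_trans[OF sum_abs] sum_mono) (simp only: abs_mult, intro mult_left_mono, auto)
    also have "\<dots> = (\<Sum>i<n. \<bar>a i\<bar>) * (\<bar>h y\<bar> / ?C)" by (rule sum_distrib_right[symmetric])
    also have "\<dots> < ?C * (\<bar>h y\<bar> / ?C)" using assms(2) C by (intro mult_strict_right_mono) auto
    also have "\<dots> = \<bar>h y\<bar>" using C by simp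
    finally have "\<bar>h u - h y\<bar> < \<bar>h y\<bar>" by (simp add: h right_diff_distrib sum_subtractf)
    then show ?thesis by (auto simp: sgn_if split: if_splits)
  qed
  then show ?thesis using assms(2) C by (intro exI[of _ "\<bar>h y\<bar> / ?C"]) auto
qed

section \<open>Semilinear sets are tame\<close>

text \<open>Near \<open>y\<close> only the forms vanishing at \<open>y\<close> can change sign, so
  \<open>A\<close> looks like a cone there. In small boxes the periods are, up to irrelevant
  coordinates, the vectors of the lineality space of that cone, and \<open>good\<close> follows
  because this is a closed subspace. The direction \<open>z - y\<close> belongs to it, since the
  relevant forms are constant along it.\<close>

lemma good_of_transversal:
  assumes "finite H" and aff: "\<And>h. h \<in> H \<Longrightarrow> affine_on UNIV n h" and det: "sign_det H UNIV A"
    and "k < n" and z: "\<And>i. i < k \<Longrightarrow> z i = y i" "z k \<noteq> y k"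
    and common: "\<And>h. h \<in> H \<Longrightarrow> h y = 0 \<Longrightarrow> h z = 0"
  shows "good n A k y"
proof -
  define S where "S = {h \<in> H. h y = 0}"
  have "S \<subseteq> H" by (auto simp: S_def)
  obtain \<rho> where \<rho>: "\<rho> > 0" "\<And>h u. h \<in> H - S \<Longrightarrow> near n k y \<rho> u \<Longrightarrow> sgn (h u) = sgn (h y)"
    using near_finite_radius[of "H - S" n k y "\<lambda>h u. sgn (h u) = sgn (h y)"]
      affine_sign_near[OF aff] assms(1) by (auto simp: S_def)
  define L where "L = (\<lambda>(h :: (nat \<Rightarrow> real) \<Rightarrow> real) w. h w - h (\<lambda>_. 0))"
  have line: "h (\<lambda>i. u i + t * w i) = h u + t * L h w" if "h \<in> H" for h u t w
    using affine_on_segment[OF aff[OF that], of u t w "\<lambda>_. 0"] by (simp add: L_def)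
  have add: "h (\<lambda>i. u i + w i) = h u + L h w" if "h \<in> H" for h u w
    using line[OF that, of u 1 w] by simp
  have L_scale: "L h (\<lambda>i. t * w i) = t * L h w" if "h \<in> H" for h t w
    using line[OF that, of "\<lambda>_. 0" t w] by (simp add: L_def)
  have L_line: "L h (\<lambda>i. u i + t * w i) = L h u + t * L h w" if "h \<in> H" for h u t w
    using line[OF that, of u t w] by (simp add: L_def)
  have L_cong: "L h u = L h w" if "h \<in> H" "\<And>i. i < n \<Longrightarrow> u i = w i" for h u w
    using affine_on_cong[OF aff, of h u w] that by (simp add: L_def)

  text \<open>\<open>K\<close> is the tangent cone of \<open>A\<close> at \<open>y\<close>.\<close>
  define K where "K = (\<lambda>u. \<exists>u'. near n k (\<lambda>_. 0) \<rho> u' \<and> (\<lambda>i. y i + u' i) \<in> A \<and>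
    (\<forall>h\<in>S. sgn (L h u') = sgn (L h u)))"
  have K_near: "K u \<longleftrightarrow> (\<lambda>i. y i + u i) \<in> A" if u: "near n k (\<lambda>_. 0) \<rho> u" for u
  proof
    assume "K u"
    then obtain u' where u': "near n k (\<lambda>_. 0) \<rho> u'" "(\<lambda>i. y i + u' i) \<in> A"
      "\<And>h. h \<in> S \<Longrightarrow> sgn (L h u') = sgn (L h u)" unfolding K_def by blast
    have "sgn (h (\<lambda>i. y i + u' i)) = sgn (h (\<lambda>i. y i + u i))" if "h \<in> H" for h
    proof (cases "h \<in> S")
      case True
      then show ?thesis using u'(3)[OF True] that by (simp add: add S_def)
    next
      case False
      then have "h \<in> H - S" using that by simp
      moreover have "near n k y \<rho> (\<lambda>i. y i + u i)" "near n k y \<rho> (\<lambda>i. y i + u' i)"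
        using u u'(1) by (auto simp: near_def)
      ultimately show ?thesis using \<rho>(2) by simp
    qed
    with det u'(2) show "(\<lambda>i. y i + u i) \<in> A" unfolding sign_det_def by blast
  qed (use u in \<open>auto simp: K_def\<close>)
  have K_sgn: "K u \<longleftrightarrow> K w" if "\<And>h. h \<in> S \<Longrightarrow> sgn (L h u) = sgn (L h w)" for u w
    using that unfolding K_def by auto
  have K_scale: "K (\<lambda>i. t * u i) \<longleftrightarrow> K u" if "t > 0" for t u
    using that \<open>S \<subseteq> H\<close> by (intro K_sgn) (auto simp: L_scale sgn_mult)
  have K_cong: "K u \<longleftrightarrow> K w" if "\<And>i. i < n \<Longrightarrow> u i = w i" for u w
  proof (rule K_sgn)
    fix h assume "h \<in> S"
    with \<open>S \<subseteq> H\<close> show "sgn (L h u) = sgn (L h w)" using L_cong[of h u w] that by auto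
  qed
  \<comment> \<open>The lineality space of the cone within the directions that keep the prefix.
    \<open>K\<close> is invariant under positive scaling, so no radius enters.\<close>
  define W where "W = {w. (\<forall>i. i \<notin> {k..<n} \<longrightarrow> w i = 0) \<and>
    (\<forall>u t. (\<forall>i<k. u i = 0) \<longrightarrow> (K (\<lambda>i. u i + t * w i) \<longleftrightarrow> K u))}"
  have W_inv: "K (\<lambda>i. u i + t * w i) \<longleftrightarrow> K u" if "w \<in> W" "\<forall>i<k. u i = 0" for w u t
    using that unfolding W_def by simp
  have W: "subsp {k..<n} W"
    unfolding subsp_def
  proof (intro conjI ballI allI impI)
    fix v w t assume v: "v \<in> W" and w: "w \<in> W"
    have "K (\<lambda>i. u i + s * (v i + t * w i)) \<longleftrightarrow> K u" if "\<forall>i<k. u i = 0" for u s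
    proof -
      have "\<forall>i<k. u i + s * v i = 0" using that v by (simp add: W_def)
      from W_inv[OF w this, of "s * t"]
      have "K (\<lambda>i. (u i + s * v i) + (s * t) * w i) \<longleftrightarrow> K (\<lambda>i. u i + s * v i)" .
      also have "\<dots> \<longleftrightarrow> K u" by (rule W_inv[OF v that])
      finally show ?thesis by (simp add: algebra_simps)
    qed
    with v w show "(\<lambda>i. v i + t * w i) \<in> W" by (auto simp: W_def)
  qed (auto simp: W_def)
  \<comment> \<open>\<open>period\<close> leaves the entries from \<open>n\<close> on free, while
    vectors of \<open>W\<close> vanish there; \<open>tr\<close> mediates.\<close>
  define tr where "tr = (\<lambda>w i. if k \<le> i \<and> i < n then w i else (0::real))"
  have tr: "tr w i = w i" if "\<And>j. j < k \<Longrightarrow> w j = 0" "i < n" for w i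
    using that by (auto simp: tr_def)

  \<comment> \<open>Half the radius, so that both \<open>u - y\<close> and its translate by
    \<open>w\<close> stay within \<open>\<rho>\<close>, where \<open>K_near\<close> applies.\<close>
  have W_imp_period: "period n A k y r w"
    if r: "0 < r" "r \<le> \<rho> / 2" and w: "near n k (\<lambda>_. 0) r w" "tr w \<in> W" for r w
    unfolding period_def
  proof (intro conjI allI impI w(1))
    fix u assume u: "near n k y r u"
    define d where "d = (\<lambda>i. u i - y i)"
    have d: "near n k (\<lambda>_. 0) r d" using u by (auto simp: near_def d_def)
    have dw: "near n k (\<lambda>_. 0) \<rho> (\<lambda>i. d i + w i)"
      by (rule near_add[OF d w(1)]) (use r in simp)
    have "u \<in> A \<longleftrightarrow> K d"
      using K_near[of d] near_mono[OF d] r by (simp add: d_def)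
    also have "\<dots> \<longleftrightarrow> K (\<lambda>i. d i + 1 * tr w i)"
      by (rule W_inv[OF w(2), symmetric]) (use d in \<open>simp add: near_def\<close>)
    also have "\<dots> \<longleftrightarrow> K (\<lambda>i. d i + w i)"
      by (rule K_cong) (use w(1) tr in \<open>auto simp: near_def\<close>)
    also have "\<dots> \<longleftrightarrow> (\<lambda>i. u i + w i) \<in> A"
      using K_near[OF dw] by (simp add: d_def add.assoc[symmetric])
    finally show "u \<in> A \<longleftrightarrow> (\<lambda>i. u i + w i) \<in> A" .
  qed

  have period_imp_W: "tr w \<in> W" if r: "0 < r" "r \<le> \<rho> / 2" and w: "period n A k y r w" for r w
  proof -
    have w0: "\<And>i. i < k \<Longrightarrow> w i = 0" "near n k (\<lambda>_. 0) r w" using w by (auto simp: period_def near_def)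
    \<comment> \<open>A period is known to preserve membership only from the box of radius
      \<open>r\<close>. Scaling by \<open>T\<close> turns this into a shift by \<open>T * w\<close>
      from a box \<open>T\<close> times as large.\<close>
    have far: "K (\<lambda>i. u i + T * w i) \<longleftrightarrow> K u"
      if T: "T > 0" and u: "\<And>i. i < k \<Longrightarrow> u i = 0" "\<And>i. i < n \<Longrightarrow> \<bar>u i\<bar> < T * r" for T u
    proof -
      define d where "d = (\<lambda>i. 1 / T * u i)"
      have d: "near n k (\<lambda>_. 0) r d"
        using u T by (auto simp: near_def d_def abs_mult field_simps)
      have dw: "near n k (\<lambda>_. 0) \<rho> (\<lambda>i. d i + w i)"
        by (rule near_add[OF d w0(2)]) (use r in simp)
      have "near n k y r (\<lambda>i. y i + d i)" using d by (auto simp: near_def)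
      then have "(\<lambda>i. y i + d i) \<in> A \<longleftrightarrow> (\<lambda>i. y i + (d i + w i)) \<in> A"
        using w unfolding period_def by (simp add: add.assoc)
      then have "K d \<longleftrightarrow> K (\<lambda>i. d i + w i)"
        using K_near[of d] near_mono[OF d] K_near[OF dw] r by simp
      moreover have "K (\<lambda>i. T * (d i + w i)) \<longleftrightarrow> K (\<lambda>i. d i + w i)" by (rule K_scale[OF T])
      moreover have "(\<lambda>i. T * (d i + w i)) = (\<lambda>i. u i + T * w i)"
        using T by (simp add: d_def fun_eq_iff distrib_left)
      moreover have "K d \<longleftrightarrow> K u" unfolding d_def by (rule K_scale) (use T in simp)
      ultimately show ?thesis by (simp only:)
    qed
    have "K (\<lambda>i. u i + t * w i) \<longleftrightarrow> K u" if u: "\<forall>i<k. u i = 0" for u t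
    proof -
      obtain M where M: "M > 0" "\<forall>i<n. \<bar>u i\<bar> \<le> M" using bounded_on_finite by blast
      obtain M' where M': "M' > 0" "\<forall>i<n. \<bar>u i + t * w i\<bar> \<le> M'"
        using bounded_on_finite[of n "\<lambda>i. u i + t * w i"] by blast
      \<comment> \<open>Large enough that \<open>far\<close> moves \<open>u\<close> by
        \<open>T * w\<close> and \<open>u + t * w\<close> by \<open>(T - t) * w\<close>. Both arrive
        at \<open>u + T * w\<close>, which compares \<open>u\<close> with \<open>u + t * w\<close>
        for every real \<open>t\<close>.\<close>
      define T where "T = \<bar>t\<bar> + (M + M') / r + 1"
      have Mr: "M / r > 0" "M' / r > 0" using M M' r by auto
      have T: "T > 0" "T > M / r" "T - t > 0" "T - t > M' / r"
        using Mr by (auto simp: T_def add_divide_distrib)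
      have "\<bar>u i\<bar> < T * r" "\<bar>u i + t * w i\<bar> < (T - t) * r" if "i < n" for i
      proof -
        have "M < T * r" "M' < (T - t) * r" using T(2,4) r(1) by (simp_all add: pos_divide_less_eq)
        with M M' that show "\<bar>u i\<bar> < T * r" "\<bar>u i + t * w i\<bar> < (T - t) * r" by force+
      qed
      with far[OF T(1), of u] far[OF T(3), of "\<lambda>i. u i + t * w i"] u w0(1)
      have "K (\<lambda>i. u i + T * w i) \<longleftrightarrow> K u"
        "K (\<lambda>i. u i + t * w i + (T - t) * w i) \<longleftrightarrow> K (\<lambda>i. u i + t * w i)" by auto
      then show ?thesis by (simp add: algebra_simps)
    qed
    moreover have "K (\<lambda>i. u i + t * tr w i) \<longleftrightarrow> K (\<lambda>i. u i + t * w i)" for u t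
      by (rule K_cong) (use tr w0 in auto)
    ultimately show ?thesis by (auto simp: W_def tr_def)
  qed

  show ?thesis
    unfolding good_def
  proof (intro exI[of _ "\<rho> / 2"] conjI allI impI)
    show "\<rho> / 2 > 0" using \<rho> by simp
  next
    fix r v w w' assume "0 < r \<and> r \<le> \<rho> / 2"
      and w: "period n A k y r w \<and> period n A k y r w' \<and> (\<forall>i<n. v i + v i = w i + w' i)"
    then have r: "0 < r" "r \<le> \<rho> / 2" by auto
    have v: "v i = 1 / 2 * (w i + w' i)" if "i < n" for i
      using w that by (simp add: field_simps)
    have "(\<lambda>i. tr w i + 1 * tr w' i) \<in> W"
      using w by (intro subsp_comb[OF W] period_imp_W[OF r]) auto
    from subsp_scale[OF W this, of "1 / 2"] have "(\<lambda>i. 1 / 2 * (tr w i + 1 * tr w' i)) \<in> W" .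
    moreover have "tr v = (\<lambda>i. 1 / 2 * (tr w i + 1 * tr w' i))"
      using v by (auto simp: tr_def fun_eq_iff)
    ultimately have "tr v \<in> W" by simp
    moreover have "near n k (\<lambda>_. 0) r v"
      unfolding near_def
    proof (intro conjI allI impI)
      fix i assume "i < k"
      then show "v i = 0" using w v[of i] \<open>k < n\<close> by (auto simp: period_def near_def)
    next
      fix i assume i: "i < n" "k \<le> i"
      then have "\<bar>w i\<bar> < r" "\<bar>w' i\<bar> < r" using w by (auto simp: period_def near_def)
      moreover have "v i + v i = w i + w' i" using w i(1) by blast
      ultimately show "\<bar>v i - 0\<bar> < r" by (simp add: abs_less_iff)
    qed
    ultimately show "period n A k y r v" using W_imp_period[OF r] by blast
  next
    fix r w assume "0 < r \<and> r \<le> \<rho> / 2"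
      and w: "near n k (\<lambda>_. 0) r w \<and> (\<forall>e>0. \<exists>w'. period n A k y r w' \<and> near n k w e w')"
    then have r: "0 < r" "r \<le> \<rho> / 2" by auto
    have "tr w \<in> W"
    proof (rule subsp_closed[OF W])
      fix e :: real assume "e > 0"
      with w obtain w' where w': "period n A k y r w'" "near n k w e w'" by blast
      have "\<forall>i\<in>{k..<n}. \<bar>tr w i - tr w' i\<bar> < e"
        using w'(2) by (auto simp: near_def tr_def abs_minus_commute)
      with period_imp_W[OF r w'(1)] show "\<exists>v\<in>W. \<forall>i\<in>{k..<n}. \<bar>tr w i - v i\<bar> < e" by blast
    qed (auto simp: tr_def)
    with w W_imp_period[OF r] show "period n A k y r w" by blast
  next
    fix r assume "0 < r \<and> r \<le> \<rho> / 2"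
    then have r: "0 < r" "r \<le> \<rho> / 2" by auto
    \<comment> \<open>The forms of \<open>S\<close> vanish at \<open>y\<close> and at
      \<open>z\<close>, hence their linear parts vanish on the difference.\<close>
    define v where "v = tr (\<lambda>i. z i - y i)"
    have "L h v = 0" if "h \<in> S" for h
    proof -
      have "h \<in> H" using that \<open>S \<subseteq> H\<close> by blast
      have "L h v = L h (\<lambda>i. z i - y i)"
        by (rule L_cong[OF \<open>h \<in> H\<close>]) (use tr z in \<open>auto simp: v_def\<close>)
      also have "\<dots> = h z - h y" using add[OF \<open>h \<in> H\<close>, of y "\<lambda>i. z i - y i"] by simp
      finally show ?thesis using common that by (simp add: S_def)
    qed
    then have "K (\<lambda>i. u i + t * v i) \<longleftrightarrow> K u" for u t
      using \<open>S \<subseteq> H\<close> by (intro K_sgn) (auto simp: L_line)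
    then have "v \<in> W" by (auto simp: W_def v_def tr_def)
    obtain M where M: "M > 0" "\<forall>i<n. \<bar>v i\<bar> \<le> M" using bounded_on_finite by blast
    define w where "w = (\<lambda>i. r / (2 * M) * v i)"
    have "w \<in> W" unfolding w_def by (rule subsp_scale[OF W \<open>v \<in> W\<close>])
    then have "tr w = w" by (auto simp: W_def tr_def)
    have "\<bar>w i\<bar> < r" if "i < n" for i
    proof -
      have "\<bar>w i\<bar> = r / (2 * M) * \<bar>v i\<bar>" using r M by (simp add: w_def abs_mult)
      also have "\<dots> \<le> r / (2 * M) * M" using M r that by (intro mult_left_mono) auto
      also have "\<dots> < r" using M r by simp
      finally show ?thesis .
    qed
    with \<open>w \<in> W\<close> have "near n k (\<lambda>_. 0) r w" by (auto simp: near_def W_def)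
    with W_imp_period[OF r] \<open>w \<in> W\<close> \<open>tr w = w\<close> have "period n A k y r w" by simp
    moreover have "w k \<noteq> 0" using z(2) r M assms(4) by (simp add: w_def v_def tr_def)
    ultimately show "\<exists>w. period n A k y r w \<and> w k \<noteq> 0" by blast
  qed
qed

section \<open>Finite sets of reals as bounded separated sets\<close>

lemma finite_separated:
  fixes B :: "real set"
  assumes "finite B"
  shows "\<exists>m d. d > 0 \<and> (\<forall>a\<in>B. \<bar>a\<bar> < m \<and> (\<forall>b\<in>B. a < b \<longrightarrow> a + d \<le> b))"
proof -
  \<comment> \<open>The element 1 provides a minimum when there are no two distinct points.\<close>
  define D where "D = insert 1 ((\<lambda>(a, b). b - a) ` {(a, b) \<in> B \<times> B. a < b})"
  have "finite {(a, b) \<in> B \<times> B. a < b}"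
    by (rule finite_subset[of _ "B \<times> B"]) (use assms in auto)
  then have D: "finite D" "D \<noteq> {}" by (auto simp: D_def)
  have "Min D > 0" using D by (subst Min_gr_iff) (auto simp: D_def)
  moreover have "a + Min D \<le> b" if "a \<in> B" "b \<in> B" "a < b" for a b
  proof -
    have "b - a \<in> D" using that by (force simp: D_def)
    from Min_le[OF D(1) this] show ?thesis by simp
  qed
  moreover have "\<bar>a\<bar> < Max (insert 0 (abs ` B)) + 1" if "a \<in> B" for a
  proof -
    have "\<bar>a\<bar> \<le> Max (insert 0 (abs ` B))" using assms that by (intro Max_ge) auto
    then show ?thesis by simp
  qed
  ultimately show ?thesis by blast
qed

text \<open>Points at distance at least \<open>d\<close> fall into different intervals of length
  \<open>d\<close>, and only finitely many of these meet the bounded range.\<close>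

lemma separated_finite:
  fixes B :: "real set"
  assumes "d > 0" "\<And>a. a \<in> B \<Longrightarrow> \<bar>a\<bar> < m" "\<And>a b. a \<in> B \<Longrightarrow> b \<in> B \<Longrightarrow> a < b \<Longrightarrow> a + d \<le> b"
  shows "finite B"
proof -
  have "inj_on (\<lambda>a. \<lfloor>a / d\<rfloor>) B"
  proof (rule inj_onI)
    fix a b assume ab: "a \<in> B" "b \<in> B" "\<lfloor>a / d\<rfloor> = \<lfloor>b / d\<rfloor>"
    have less: "\<lfloor>a / d\<rfloor> < \<lfloor>b / d\<rfloor>" if "a \<in> B" "b \<in> B" "a < b" for a b
    proof -
      have "a / d + 1 = (a + d) / d" using assms(1) by (simp add: field_simps)
      also have "\<dots> \<le> b / d" using assms(3)[OF that] assms(1) by (simp add: divide_right_mono)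
      finally show ?thesis by linarith
    qed
    show "a = b" using less[of a b] less[of b a] ab by (cases a b rule: linorder_cases) auto
  qed
  moreover have "(\<lambda>a. \<lfloor>a / d\<rfloor>) ` B \<subseteq> {\<lfloor>- m / d\<rfloor>..\<lfloor>m / d\<rfloor>}"
  proof safe
    fix a assume "a \<in> B"
    from assms(2)[OF this] have "- m \<le> a" "a \<le> m" by auto
    then have "- m / d \<le> a / d" "a / d \<le> m / d" using assms(1) by (intro divide_right_mono; simp)+
    then show "\<lfloor>a / d\<rfloor> \<in> {\<lfloor>- m / d\<rfloor>..\<lfloor>m / d\<rfloor>}" by (auto intro: floor_mono)
  qed
  ultimately show ?thesis by (meson finite_atLeastAtMost_int finite_imageD finite_subset)
qed

lemma tame_iff_finite:
  "tame n A \<longleftrightarrow> (\<forall>k<n. \<forall>x. finite {y k |y. (\<forall>i<k. y i = x i) \<and> \<not> good n A k y})"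
proof -
  have "(\<exists>m d. d > 0 \<and> (\<forall>y. (\<forall>i<k. y i = x i) \<and> \<not> good n A k y \<longrightarrow>
      \<bar>y k\<bar> < m \<and> (\<forall>z. (\<forall>i<k. z i = x i) \<and> \<not> good n A k z \<and> y k < z k \<longrightarrow> y k + d \<le> z k))) \<longleftrightarrow>
    finite {y k |y. (\<forall>i<k. y i = x i) \<and> \<not> good n A k y}" (is "?L \<longleftrightarrow> finite ?B") for k x
  proof
    assume ?L
    then obtain m d where md: "d > 0" "\<And>y. (\<forall>i<k. y i = x i) \<and> \<not> good n A k y \<Longrightarrow> \<bar>y k\<bar> < m"
      "\<And>y z. (\<forall>i<k. y i = x i) \<and> \<not> good n A k y \<Longrightarrow> (\<forall>i<k. z i = x i) \<and> \<not> good n A k z \<Longrightarrow>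
        y k < z k \<Longrightarrow> y k + d \<le> z k" by metis
    show "finite ?B"
    proof (rule separated_finite[OF md(1), of _ m])
      fix a assume "a \<in> ?B"
      then show "\<bar>a\<bar> < m" using md(2) by blast
      fix b assume "b \<in> ?B" "a < b"
      with \<open>a \<in> ?B\<close> show "a + d \<le> b" using md(3) by blast
    qed
  next
    assume "finite ?B"
    from finite_separated[OF this] obtain m d where md: "d > 0"
      "\<forall>a\<in>?B. \<bar>a\<bar> < m \<and> (\<forall>b\<in>?B. a < b \<longrightarrow> a + d \<le> b)" by (elim exE conjE) (rule that)
    have "\<bar>y k\<bar> < m \<and> (\<forall>z. (\<forall>i<k. z i = x i) \<and> \<not> good n A k z \<and> y k < z k \<longrightarrow> y k + d \<le> z k)"
      if y: "(\<forall>i<k. y i = x i) \<and> \<not> good n A k y" for y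
    proof -
      from y have "y k \<in> ?B" by blast
      with md(2) have *: "\<bar>y k\<bar> < m" "\<And>b. b \<in> ?B \<Longrightarrow> y k < b \<Longrightarrow> y k + d \<le> b" by auto
      moreover have "z k \<in> ?B" if "(\<forall>i<k. z i = x i) \<and> \<not> good n A k z" for z using that by blast
      ultimately show ?thesis by blast
    qed
    with md(1) show ?L by blast
  qed
  then show ?thesis unfolding tame_def by simp
qed

lemma sign_det_imp_tame:
  assumes "finite H" "\<And>h. h \<in> H \<Longrightarrow> affine_on UNIV n h" "sign_det H UNIV A"
  shows "tame n A"
  unfolding tame_iff_finite
proof (intro allI impI)
  fix k x assume "k < n"
  define bad where "bad = (\<lambda>y. (\<forall>i<k. y i = x i) \<and> \<not> good n A k y)"
  define Z where "Z = (\<lambda>y. {h \<in> H. h y = 0})"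
  have eq: "y k = z k" if "bad y" "bad z" "Z y = Z z" for y z
  proof (rule ccontr)
    assume "y k \<noteq> z k"
    with that have "good n A k y"
      by (intro good_of_transversal[OF assms \<open>k < n\<close>, of z]) (auto simp: bad_def Z_def)
    with that show False by (simp add: bad_def)
  qed
  \<comment> \<open>By \<open>eq\<close> all bad points with the same vanishing forms share
    coordinate \<open>k\<close>, so the arbitrary choice does not matter.\<close>
  define f where "f = (\<lambda>S. (SOME y. bad y \<and> Z y = S) k)"
  have "y k \<in> f ` Pow H" if "bad y" for y
  proof -
    have "bad (SOME z. bad z \<and> Z z = Z y) \<and> Z (SOME z. bad z \<and> Z z = Z y) = Z y"
      by (rule someI[of _ y]) (use that in simp)
    then have "y k = f (Z y)" using eq[OF that] by (simp add: f_def)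
    then show ?thesis by (auto simp: Z_def)
  qed
  then have "{y k |y. bad y} \<subseteq> f ` Pow H" by blast
  then show "finite {y k |y. (\<forall>i<k. y i = x i) \<and> \<not> good n A k y}"
    using assms(1) unfolding bad_def by (meson finite_Pow_iff finite_imageI finite_subset)
qed

section \<open>Formulas in vector variables\<close>

text \<open>Slot \<open>j\<close> occupies the variables that code the pairs \<open>(j, i)\<close>.
  Quantifying over a point becomes a block of quantifiers, and different slots never
  collide.\<close>

definition vec_env :: "(nat \<Rightarrow> real) \<Rightarrow> nat \<Rightarrow> nat \<Rightarrow> real" where
  "vec_env e = (\<lambda>j i. e (prod_encode (j, i)))"

definition vexpressible :: "nat \<Rightarrow> nat set \<Rightarrow> (real list set \<Rightarrow> (nat \<Rightarrow> nat \<Rightarrow> real) \<Rightarrow> bool) \<Rightarrow> bool" where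
  "vexpressible n J Q \<longleftrightarrow>
     expressible (Some n) (prod_encode ` (J \<times> {..<n})) (\<lambda>X e. Q X (vec_env e))"

definition vterm :: "nat \<Rightarrow> nat set \<Rightarrow> ((nat \<Rightarrow> nat \<Rightarrow> real) \<Rightarrow> real) \<Rightarrow> bool" where
  "vterm n J f \<longleftrightarrow>
     (\<exists>t. vars_tm t \<subseteq> prod_encode ` (J \<times> {..<n}) \<and> (\<forall>e. eval_tm e t = f (vec_env e)))"

definition rel_of :: "nat \<Rightarrow> real list set \<Rightarrow> (nat \<Rightarrow> real) set" where
  "rel_of n X = {x. map x [0..<n] \<in> X}"

lemma rel_of_cong: "(\<And>i. i < n \<Longrightarrow> x i = y i) \<Longrightarrow> x \<in> rel_of n X \<longleftrightarrow> y \<in> rel_of n X"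
proof -
  assume "\<And>i. i < n \<Longrightarrow> x i = y i"
  then have "map x [0..<n] = map y [0..<n]" by simp
  then show ?thesis by (simp only: rel_of_def mem_Collect_eq)
qed

lemma vec_env_surj: "vec_env (\<lambda>c. E (fst (prod_decode c)) (snd (prod_decode c))) = E"
  by (simp add: vec_env_def)

lemma vterm_coord: "j \<in> J \<Longrightarrow> i < n \<Longrightarrow> vterm n J (\<lambda>E. E j i)"
  unfolding vterm_def by (intro exI[of _ "Var (prod_encode (j, i))"]) (auto simp: vec_env_def)

lemma vterm_add:
  assumes "vterm n J f" "vterm n J g"
  shows "vterm n J (\<lambda>E. f E + g E)"
proof -
  from assms obtain s t where "vars_tm s \<subseteq> prod_encode ` (J \<times> {..<n})"
    "vars_tm t \<subseteq> prod_encode ` (J \<times> {..<n})"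
    "\<forall>e. eval_tm e s = f (vec_env e)" "\<forall>e. eval_tm e t = g (vec_env e)"
    unfolding vterm_def by blast
  then show ?thesis unfolding vterm_def by (intro exI[of _ "Add s t"]) auto
qed

lemma vexpressible_less:
  assumes "vterm n J f" "vterm n J g"
  shows "vexpressible n J (\<lambda>X E. f E < g E)"
proof -
  from assms obtain s t where "vars_tm s \<subseteq> prod_encode ` (J \<times> {..<n})"
    "vars_tm t \<subseteq> prod_encode ` (J \<times> {..<n})"
    "\<forall>e. eval_tm e s = f (vec_env e)" "\<forall>e. eval_tm e t = g (vec_env e)"
    unfolding vterm_def by blast
  then show ?thesis unfolding vexpressible_def by (intro expressibleI[of _ "Less s t"]) auto
qed

lemma vexpressible_eq:
  assumes "vterm n J f" "vterm n J g"
  shows "vexpressible n J (\<lambda>X E. f E = g E)"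
proof -
  from assms obtain s t where "vars_tm s \<subseteq> prod_encode ` (J \<times> {..<n})"
    "vars_tm t \<subseteq> prod_encode ` (J \<times> {..<n})"
    "\<forall>e. eval_tm e s = f (vec_env e)" "\<forall>e. eval_tm e t = g (vec_env e)"
    unfolding vterm_def by blast
  then show ?thesis unfolding vexpressible_def by (intro expressibleI[of _ "Eq s t"]) auto
qed

text \<open>Without a zero in the language, the comparison is written as
  \<open>f E < f E + f E\<close>.\<close>

lemma vexpressible_pos: "vterm n J f \<Longrightarrow> vexpressible n J (\<lambda>X E. 0 < f E)"
  using vexpressible_less[OF _ vterm_add, of n J f f f] by simp

lemma vexpressible_zero: "vterm n J f \<Longrightarrow> vexpressible n J (\<lambda>X E. f E = 0)"
  using vexpressible_eq[OF vterm_add, of n J f f f] by simp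

lemma vexpressible_mem:
  assumes "\<And>i. i < n \<Longrightarrow> vterm n J (f i)"
  shows "vexpressible n J (\<lambda>X E. (\<lambda>i. f i E) \<in> rel_of n X)"
proof -
  from assms have "\<forall>i\<in>{..<n}. \<exists>t. vars_tm t \<subseteq> prod_encode ` (J \<times> {..<n}) \<and>
      (\<forall>e. eval_tm e t = f i (vec_env e))"
    unfolding vterm_def by blast
  from bchoice[OF this] obtain t where t: "\<And>i. i < n \<Longrightarrow> vars_tm (t i) \<subseteq> prod_encode ` (J \<times> {..<n})"
    "\<And>i e. i < n \<Longrightarrow> eval_tm e (t i) = f i (vec_env e)" by auto
  have "map (eval_tm e) (map t [0..<n]) = map (\<lambda>i. f i (vec_env e)) [0..<n]" for e
    using t(2) by simp
  then have "sat X e (RelX (map t [0..<n])) \<longleftrightarrow> (\<lambda>i. f i (vec_env e)) \<in> rel_of n X" for X e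
    by (simp only: sat.simps rel_of_def mem_Collect_eq)
  moreover have "free_vars (RelX (map t [0..<n])) \<subseteq> prod_encode ` (J \<times> {..<n})"
    using t(1) by fastforce
  ultimately show ?thesis
    unfolding vexpressible_def by (intro expressibleI[of _ "RelX (map t [0..<n])"]) auto
qed

lemma vexpressible_cell:
  assumes "finite H" "\<And>h. h \<in> H \<Longrightarrow> affine_on \<rat> n h" "j \<in> J"
  shows "vexpressible n J (\<lambda>X E. cell_of H (E j) = cell_of H y)"
  unfolding vexpressible_def
  using expressible_cell[OF assms(1,2), of "\<lambda>i. prod_encode (j, i)"
      "prod_encode ` (J \<times> {..<n})" "Some n" y] assms(3)
  by (auto simp: vec_env_def)

lemma vexpressible_neg: "vexpressible n J Q \<Longrightarrow> vexpressible n J (\<lambda>X E. \<not> Q X E)"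
  unfolding vexpressible_def by (rule expressible_neg)

lemma vexpressible_conj:
  "vexpressible n J Q \<Longrightarrow> vexpressible n J R \<Longrightarrow> vexpressible n J (\<lambda>X E. Q X E \<and> R X E)"
  unfolding vexpressible_def by (rule expressible_conj)

lemma vexpressible_imp:
  "vexpressible n J Q \<Longrightarrow> vexpressible n J R \<Longrightarrow> vexpressible n J (\<lambda>X E. Q X E \<longrightarrow> R X E)"
  unfolding vexpressible_def by (rule expressible_imp)

lemma vexpressible_iff:
  "vexpressible n J Q \<Longrightarrow> vexpressible n J R \<Longrightarrow> vexpressible n J (\<lambda>X E. Q X E \<longleftrightarrow> R X E)"
  unfolding vexpressible_def by (rule expressible_iff)

lemma vexpressible_ball:
  "finite I \<Longrightarrow> (\<And>i. i \<in> I \<Longrightarrow> vexpressible n J (Q i)) \<Longrightarrow> vexpressible n J (\<lambda>X E. \<forall>i\<in>I. Q i X E)"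
  unfolding vexpressible_def by (rule expressible_ball)

lemma sat_foldr_Ex:
  "sat X e (foldr Ex vs \<phi>) \<longleftrightarrow> (\<exists>f. sat X (\<lambda>c. if c \<in> set vs then f c else e c) \<phi>)"
proof (induction vs arbitrary: e)
  case (Cons v vs)
  have "sat X e (foldr Ex (v # vs) \<phi>) \<longleftrightarrow>
      (\<exists>a f. sat X (\<lambda>c. if c \<in> set vs then f c else (e(v := a)) c) \<phi>)"
    by (simp add: Cons)
  also have "\<dots> \<longleftrightarrow> (\<exists>f. sat X (\<lambda>c. if c \<in> set (v # vs) then f c else e c) \<phi>)"
  proof
    assume "\<exists>a f. sat X (\<lambda>c. if c \<in> set vs then f c else (e(v := a)) c) \<phi>"
    then obtain a f where "sat X (\<lambda>c. if c \<in> set vs then f c else (e(v := a)) c) \<phi>" by blast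
    moreover have "(\<lambda>c. if c \<in> set vs then f c else (e(v := a)) c)
        = (\<lambda>c. if c \<in> set (v # vs) then if c \<in> set vs then f c else a else e c)" by auto
    ultimately have "sat X (\<lambda>c. if c \<in> set (v # vs) then if c \<in> set vs then f c else a else e c) \<phi>"
      by (simp only:)
    then show "\<exists>f. sat X (\<lambda>c. if c \<in> set (v # vs) then f c else e c) \<phi>"
      by (intro exI[of _ "\<lambda>c. if c \<in> set vs then f c else a"])
  next
    assume "\<exists>f. sat X (\<lambda>c. if c \<in> set (v # vs) then f c else e c) \<phi>"
    then obtain f where "sat X (\<lambda>c. if c \<in> set (v # vs) then f c else e c) \<phi>" by blast
    moreover have "(\<lambda>c. if c \<in> set (v # vs) then f c else e c)
        = (\<lambda>c. if c \<in> set vs then f c else (e(v := f v)) c)" by auto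
    ultimately show "\<exists>a f. sat X (\<lambda>c. if c \<in> set vs then f c else (e(v := a)) c) \<phi>" by auto
  qed
  finally show ?case .
qed simp

text \<open>The bound vector is stored in slot \<open>j\<close>, and \<open>indep\<close> expresses
  that this slot is fresh: \<open>Q\<close> reads it only through its last argument.\<close>

lemma vexpressible_ex:
  assumes "vexpressible n (insert j J) (\<lambda>X E. Q X E (E j))"
    and indep: "\<And>X E v w. Q X (E(j := v)) w \<longleftrightarrow> Q X E w"
  shows "vexpressible n J (\<lambda>X E. \<exists>v. Q X E v)"
proof -
  from assms(1) obtain \<phi> where \<phi>: "X_arity n \<phi>" "free_vars \<phi> \<subseteq> prod_encode ` (insert j J \<times> {..<n})"
    "\<And>X e. sat X e \<phi> \<longleftrightarrow> Q X (vec_env e) (vec_env e j)"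
    unfolding vexpressible_def expressible_def by auto
  define vs where "vs = map (\<lambda>i. prod_encode (j, i)) [0..<n]"
  have vs: "set vs = prod_encode ` ({j} \<times> {..<n})" by (auto simp: vs_def)
  have "X_arity n (foldr Ex us \<phi>)" "free_vars (foldr Ex us \<phi>) = free_vars \<phi> - set us" for us
    using \<phi>(1) by (induction us) auto
  moreover have "sat X e (foldr Ex vs \<phi>) \<longleftrightarrow> (\<exists>v. Q X (vec_env e) v)" for X e
  proof
    assume "sat X e (foldr Ex vs \<phi>)"
    then obtain f where f: "sat X (\<lambda>c. if c \<in> set vs then f c else e c) \<phi>"
      unfolding sat_foldr_Ex by blast
    let ?e = "\<lambda>c. if c \<in> set vs then f c else e c"
    have "vec_env ?e = (vec_env e)(j := vec_env ?e j)"
      by (auto simp: vec_env_def vs fun_eq_iff)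
    then have "Q X (vec_env ?e) w \<longleftrightarrow> Q X (vec_env e) w" for w using indep by metis
    with f \<phi>(3) show "\<exists>v. Q X (vec_env e) v" by blast
  next
    assume "\<exists>v. Q X (vec_env e) v"
    then obtain v where v: "Q X (vec_env e) v" ..
    let ?f = "\<lambda>c. v (snd (prod_decode c))"
    \<comment> \<open>Here \<open>v\<close> is stored in full, although the block of quantifiers
      binds only its first \<open>n\<close> entries; the others are not free in
      \<open>\<phi>\<close>.\<close>
    let ?e = "\<lambda>c. if fst (prod_decode c) = j then ?f c else e c"
    have "vec_env ?e = (vec_env e)(j := v)" by (auto simp: vec_env_def fun_eq_iff)
    then have "sat X ?e \<phi>" using v by (simp add: \<phi>(3) indep)
    moreover have "?e c = (if c \<in> set vs then ?f c else e c)" if "c \<in> free_vars \<phi>" for c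
      using that \<phi>(2) by (auto simp: vs)
    ultimately have "sat X (\<lambda>c. if c \<in> set vs then ?f c else e c) \<phi>"
      by (subst sat_cong[of \<phi> _ ?e]) auto
    then show "sat X e (foldr Ex vs \<phi>)" unfolding sat_foldr_Ex by (intro exI[of _ ?f])
  qed
  ultimately show ?thesis
    unfolding vexpressible_def using \<phi>(2)
    by (intro expressibleI[of _ "foldr Ex vs \<phi>"]) (auto simp: vs)
qed

lemma vexpressible_all:
  assumes "vexpressible n (insert j J) (\<lambda>X E. Q X E (E j))"
    and "\<And>X E v w. Q X (E(j := v)) w \<longleftrightarrow> Q X E w"
  shows "vexpressible n J (\<lambda>X E. \<forall>v. Q X E v)"
  using vexpressible_neg[OF vexpressible_ex[of n j J "\<lambda>X E v. \<not> Q X E v"]]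
    vexpressible_neg[OF assms(1)] assms(2) by simp

lemma vexpressible_ex_real:
  assumes "vexpressible n (insert j J) (\<lambda>X E. Q X E (E j 0))"
    and "\<And>X E v w. Q X (E(j := v)) w \<longleftrightarrow> Q X E w"
  shows "vexpressible n J (\<lambda>X E. \<exists>r::real. Q X E r)"
proof -
  have "(\<exists>r. Q X E r) \<longleftrightarrow> (\<exists>v::nat \<Rightarrow> real. Q X E (v 0))" for X E
    by (auto intro: exI[of _ "\<lambda>_. r" for r])
  with vexpressible_ex[of n j J "\<lambda>X E v. Q X E (v 0)"] assms show ?thesis by simp
qed

lemma vexpressible_all_real:
  assumes "vexpressible n (insert j J) (\<lambda>X E. Q X E (E j 0))"
    and "\<And>X E v w. Q X (E(j := v)) w \<longleftrightarrow> Q X E w"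
  shows "vexpressible n J (\<lambda>X E. \<forall>r::real. Q X E r)"
  using vexpressible_neg[OF vexpressible_ex_real[of n j J "\<lambda>X E v. \<not> Q X E v"]]
    vexpressible_neg[OF assms(1)] assms(2) by simp

lemma vexpressible_near:
  assumes "n \<ge> 1" "k < n" "a \<in> J" "b \<in> J" "c \<in> J"
  shows "vexpressible n J (\<lambda>X E. near n k (E a) (E b 0) (E c))"
proof -
  have eq: "near n k y r u \<longleftrightarrow>
      (\<forall>i\<in>{..<k}. u i = y i) \<and> (\<forall>i\<in>{k..<n}. u i < y i + r \<and> y i < u i + r)" for y r u
  proof -
    have "\<bar>u i - y i\<bar> < r \<longleftrightarrow> u i < y i + r \<and> y i < u i + r" for i by linarith
    then show ?thesis unfolding near_def by auto
  qed
  show ?thesis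
    unfolding eq using assms
    by (intro vexpressible_conj vexpressible_ball vexpressible_eq vexpressible_less vterm_add
        vterm_coord) auto
qed

lemma vexpressible_near_zero:
  assumes "n \<ge> 1" "k < n" "b \<in> J" and f: "\<And>i. i < n \<Longrightarrow> vterm n J (f i)"
  shows "vexpressible n J (\<lambda>X E. near n k (\<lambda>_. 0) (E b 0) (\<lambda>i. f i E))"
proof -
  have eq: "near n k (\<lambda>_. 0) r w \<longleftrightarrow>
      (\<forall>i\<in>{..<k}. w i = 0) \<and> (\<forall>i\<in>{k..<n}. w i < r \<and> 0 < w i + r)" for r w
  proof -
    have "\<bar>w i - 0\<bar> < r \<longleftrightarrow> w i < r \<and> 0 < w i + r" for i by linarith
    then show ?thesis unfolding near_def by auto
  qed
  show ?thesis
    unfolding eq using assms(1-3)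
    by (intro vexpressible_conj vexpressible_ball vexpressible_zero vexpressible_pos
        vexpressible_less vterm_add vterm_coord f) auto
qed

text \<open>In the formulas below the vector variable \<open>10\<close> is reserved for the point bound in \<open>period\<close>
  and \<open>5, \<dots>, 9\<close> for those bound in \<open>good\<close>; reals are stored in coordinate \<open>0\<close>.\<close>

lemma vexpressible_period:
  assumes "n \<ge> 1" "k < n" "a \<in> J" "b \<in> J" "a \<noteq> 10" "b \<noteq> 10"
    and f: "\<And>i. i < n \<Longrightarrow> vterm n J (f i)" "\<And>i E v. f i (E(10 := v)) = f i E"
  shows "vexpressible n J (\<lambda>X E. period n (rel_of n X) k (E a) (E b 0) (\<lambda>i. f i E))"
proof -
  have mono: "vterm n (insert 10 J) g" if "vterm n J g" for g
    using that unfolding vterm_def by blast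
  have "vexpressible n J (\<lambda>X E. near n k (\<lambda>_. 0) (E b 0) (\<lambda>i. f i E))"
    using assms by (intro vexpressible_near_zero) auto
  moreover have "vexpressible n J (\<lambda>X E. \<forall>u. near n k (E a) (E b 0) u \<longrightarrow>
      (u \<in> rel_of n X \<longleftrightarrow> (\<lambda>i. u i + f i E) \<in> rel_of n X))"
  proof (rule vexpressible_all[where j = 10])
    have mem: "vexpressible n (insert 10 J) (\<lambda>X E. (\<lambda>i. E 10 i) \<in> rel_of n X)"
      by (intro vexpressible_mem vterm_coord) auto
    show "vexpressible n (insert 10 J) (\<lambda>X E. near n k (E a) (E b 0) (E 10) \<longrightarrow>
      (E 10 \<in> rel_of n X \<longleftrightarrow> (\<lambda>i. E 10 i + f i E) \<in> rel_of n X))"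
      using assms(1-4)
      by (intro vexpressible_imp vexpressible_iff vexpressible_near mem
          vexpressible_mem vterm_add vterm_coord mono f(1)) auto
  qed (use assms in simp)
  ultimately show ?thesis unfolding period_def by (rule vexpressible_conj)
qed

lemma vexpressible_good:
  assumes "n \<ge> 1" "k < n" "a \<in> J" "a < 5"
  shows "vexpressible n J (\<lambda>X E. good n (rel_of n X) k (E a))"
  unfolding good_def
proof (intro vexpressible_ex_real[where j = 5] vexpressible_all_real[where j = 6]
    vexpressible_conj vexpressible_imp)
  let ?J = "insert 6 (insert 5 J)"
  show "vexpressible n (insert 5 J) (\<lambda>X E. 0 < E 5 0)"
    using assms by (intro vexpressible_pos vterm_coord) auto
  show "vexpressible n ?J (\<lambda>X E. 0 < E 6 0)"
    using assms by (intro vexpressible_pos vterm_coord) auto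
  show "vexpressible n ?J (\<lambda>X E. E 6 0 \<le> E 5 0)"
    unfolding not_less[symmetric]
    using assms by (intro vexpressible_neg vexpressible_less vterm_coord) auto
  have per: "vexpressible n J' (\<lambda>X E. period n (rel_of n X) k (E a) (E 6 0) (E c))"
    if "a \<in> J'" "6 \<in> J'" "c \<in> J'" "c \<noteq> 10" for J' c
    using vexpressible_period[of n k a J' 6 "\<lambda>i E. E c i"] that assms vterm_coord by simp
  have mid: "(\<forall>i<n. v i + v i = w i + w' i) \<longleftrightarrow> (\<forall>i\<in>{..<n}. v i + v i = w i + w' i)"
    for v w w' :: "nat \<Rightarrow> real" by auto
  show "vexpressible n ?J (\<lambda>X E. \<forall>v w w'. period n (rel_of n X) k (E a) (E 6 0) w \<and>
      period n (rel_of n X) k (E a) (E 6 0) w' \<and> (\<forall>i<n. v i + v i = w i + w' i) \<longrightarrow>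
      period n (rel_of n X) k (E a) (E 6 0) v)"
    unfolding mid
    by (rule vexpressible_all[where j = 9], rule vexpressible_all[where j = 7],
        rule vexpressible_all[where j = 8], intro vexpressible_imp vexpressible_conj per
        vexpressible_ball vexpressible_eq vterm_add vterm_coord) (use assms in auto)
  show "vexpressible n ?J (\<lambda>X E. \<exists>w. period n (rel_of n X) k (E a) (E 6 0) w \<and> w k \<noteq> 0)"
    using assms
    by (intro vexpressible_ex[where j = 7] vexpressible_conj per vexpressible_neg vexpressible_zero
        vterm_coord) auto
  have near0: "vexpressible n J' (\<lambda>X E. near n k (\<lambda>_. 0) (E 6 0) (E 7))"
    if "6 \<in> J'" "7 \<in> J'" for J'
    using vexpressible_near_zero[of n k 6 J' "\<lambda>i E. E 7 i"] that assms vterm_coord by simp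
  show "vexpressible n ?J (\<lambda>X E. \<forall>w. near n k (\<lambda>_. 0) (E 6 0) w \<and>
      (\<forall>e>0. \<exists>w'. period n (rel_of n X) k (E a) (E 6 0) w' \<and> near n k w e w') \<longrightarrow>
      period n (rel_of n X) k (E a) (E 6 0) w)"
    using assms
    by (intro vexpressible_all[where j = 7] vexpressible_imp vexpressible_conj near0 per
        vexpressible_all_real[where j = 9] vexpressible_ex[where j = 8] vexpressible_pos
        vexpressible_near vterm_coord) auto
qed (use assms in auto)

lemma vexpressible_tame:
  assumes "n \<ge> 1"
  shows "vexpressible n {} (\<lambda>X E. tame n (rel_of n X))"
proof -
  have eq: "tame n A \<longleftrightarrow> (\<forall>k\<in>{..<n}. \<forall>x. \<exists>m d. d > 0 \<and>
      (\<forall>y. (\<forall>i\<in>{..<k}. y i = x i) \<and> \<not> good n A k y \<longrightarrow> (y k < m \<and> 0 < y k + m) \<and>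
        (\<forall>z. (\<forall>i\<in>{..<k}. z i = x i) \<and> \<not> good n A k z \<and> y k < z k \<longrightarrow> \<not> z k < y k + d)))" for A
  proof -
    have "\<bar>a\<bar> < m \<longleftrightarrow> a < m \<and> 0 < a + m" for a m :: real by linarith
    then show ?thesis unfolding tame_def by (simp add: not_less Ball_def)
  qed
  show ?thesis
    unfolding eq
  proof (rule vexpressible_ball, goal_cases)
    case (2 k)
    note intros = vexpressible_ball vexpressible_conj vexpressible_imp vexpressible_neg
      vexpressible_good vexpressible_pos vexpressible_eq vexpressible_less vterm_add vterm_coord
    \<comment> \<open>Slot 0 holds \<open>x\<close>, slots 1 and 2 the reals \<open>m\<close> and
      \<open>d\<close>, slots 3 and 4 the points \<open>y\<close> and \<open>z\<close>; all points
      stay below 5, as \<open>vexpressible_good\<close> requires.\<close>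
    have z: "vexpressible n {3, 2, 1, 0} (\<lambda>X E. \<forall>z. (\<forall>i\<in>{..<k}. z i = E 0 i) \<and>
        \<not> good n (rel_of n X) k z \<and> E 3 k < z k \<longrightarrow> \<not> z k < E 3 k + E 2 0)"
      by (rule vexpressible_all[where j = 4], intro intros) (use 2 assms in auto)
    have "vexpressible n {2, 1, 0} (\<lambda>X E. \<forall>y. (\<forall>i\<in>{..<k}. y i = E 0 i) \<and>
        \<not> good n (rel_of n X) k y \<longrightarrow> (y k < E 1 0 \<and> 0 < y k + E 1 0) \<and>
        (\<forall>z. (\<forall>i\<in>{..<k}. z i = E 0 i) \<and> \<not> good n (rel_of n X) k z \<and> y k < z k \<longrightarrow>
          \<not> z k < y k + E 2 0))"
      by (rule vexpressible_all[where j = 3], intro z intros) (use 2 assms in auto)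
    then show ?case
      by (rule_tac vexpressible_all[where j = 0], rule_tac vexpressible_ex_real[where j = 1],
        rule_tac vexpressible_ex_real[where j = 2], rule_tac vexpressible_conj[OF vexpressible_pos[OF vterm_coord]])
        (use assms in auto)
  qed simp
qed

section \<open>Rational points\<close>

definition rational_points :: "nat \<Rightarrow> real list set \<Rightarrow> bool" where
  "rational_points n X \<longleftrightarrow>
     (\<forall>m Y. definable_RX n X m Y \<and> Y \<noteq> {} \<longrightarrow> (\<exists>y\<in>Y. set y \<subseteq> \<rat>))"

lemma finite_vars_tm: "finite (vars_tm t)"
  by (induction t) auto

lemma finite_free_vars: "finite (free_vars \<phi>)"
  by (induction \<phi>) (auto simp: finite_vars_tm)

text \<open>Definability admits no parameters, but fixing a variable to a rational value is itself
  expressible. With these equations added to \<open>\<phi>\<close>, the rational point supplied by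
  the hypothesis keeps the prescribed values.\<close>

lemma rational_assignment:
  assumes RP: "rational_points n X" and "X_arity n \<phi>" "sat X e \<phi>" "\<And>c. c \<in> C \<Longrightarrow> e c \<in> \<rat>"
  shows "\<exists>e'. sat X e' \<phi> \<and> (\<forall>c\<in>C. e' c = e c) \<and> (\<forall>c. e' c \<in> \<rat>)"
proof -
  obtain M0 where "free_vars \<phi> \<subseteq> {..<M0}" using finite_free_vars[of \<phi>]
    unfolding finite_nat_set_iff_bounded by blast
  \<comment> \<open>Definable relations have arity at least 1, also when \<open>\<phi>\<close> is
    closed.\<close>
  then have "free_vars \<phi> \<subseteq> {..<Suc M0}" by auto
  then obtain M where M: "M \<ge> 1" "free_vars \<phi> \<subseteq> {..<M}" by (metis le_add1 plus_1_eq_Suc)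
  have fixed: "expressible (Some n) {..<M} (\<lambda>X e'. e' c - e c = 0)" if "c \<in> C \<inter> {..<M}" for c
  proof -
    have "affine_on \<rat> 1 (\<lambda>x. x 0 - e c)"
      using assms(4) that by (intro affine_on_diff affine_on_coord affine_on_const) auto
    from expressible_affine(1)[OF this, of "\<lambda>_. c" "{..<M}"] that show ?thesis by auto
  qed
  have "expressible (Some n) {..<M} (\<lambda>X e. sat X e \<phi>)"
    using assms(2) M(2) by (intro expressibleI[of _ \<phi>]) auto
  then have "expressible (Some n) {..<M} (\<lambda>X e'. sat X e' \<phi> \<and> (\<forall>c\<in>C \<inter> {..<M}. e' c - e c = 0))"
    by (intro expressible_conj expressible_ball fixed) auto
  then obtain \<psi> where \<psi>: "X_arity n \<psi>" "free_vars \<psi> \<subseteq> {..<M}"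
    "\<And>X e'. sat X e' \<psi> \<longleftrightarrow> sat X e' \<phi> \<and> (\<forall>c\<in>C \<inter> {..<M}. e' c - e c = 0)"
    unfolding expressible_def by auto
  define Y where "Y = {xs \<in> tuples M. sat X (nth xs) \<psi>}"
  have "definable_RX n X M Y"
    unfolding definable_RX_def using M(1) \<psi>(1,2) by (auto simp: Y_def)
  moreover have "map e [0..<M] \<in> Y"
  proof -
    have "sat X (nth (map e [0..<M])) \<psi> \<longleftrightarrow> sat X e \<psi>"
      using \<psi>(2) by (intro sat_cong) auto
    then show ?thesis using assms(3) \<psi>(3)[of X e] by (simp add: Y_def tuples_def)
  qed
  ultimately obtain y where y: "y \<in> Y" "set y \<subseteq> \<rat>"
    using RP unfolding rational_points_def by blast
  \<comment> \<open>From \<open>M\<close> on the formula reads nothing: the old values are kept on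
    \<open>C\<close>, and 0 is a rational default elsewhere.\<close>
  define e' where "e' = (\<lambda>c. if c < M then y ! c else if c \<in> C then e c else 0)"
  have "length y = M" and "sat X (nth y) \<psi>" using y(1) by (auto simp: Y_def tuples_def)
  then have "sat X (nth y) \<phi>" "\<And>c. c \<in> C \<Longrightarrow> c < M \<Longrightarrow> y ! c = e c" using \<psi>(3) by auto
  moreover have "sat X e' \<phi> \<longleftrightarrow> sat X (nth y) \<phi>"
    using M(2) by (intro sat_cong) (auto simp: e'_def)
  moreover have "y ! c \<in> \<rat>" if "c < M" for c using y(2) that \<open>length y = M\<close> nth_mem by blast
  ultimately show ?thesis using assms(4) by (intro exI[of _ e']) (auto simp: e'_def)
qed

text \<open>The form in which the hypothesis on \<open>X\<close> is applied: the slots in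
  \<open>C\<close> carry rational parameters, the other slots receive rational witnesses.\<close>

lemma rational_vectors:
  assumes "rational_points n X" "vexpressible n J Q" "Q X E"
    and "\<And>j i. j \<in> C \<Longrightarrow> i < n \<Longrightarrow> E j i \<in> \<rat>"
  shows "\<exists>E'. Q X E' \<and> (\<forall>j\<in>C. \<forall>i<n. E' j i = E j i) \<and> (\<forall>j i. E' j i \<in> \<rat>)"
proof -
  obtain \<phi> where \<phi>: "X_arity n \<phi>" "\<And>X e. sat X e \<phi> \<longleftrightarrow> Q X (vec_env e)"
    using assms(2) unfolding vexpressible_def expressible_def by auto
  let ?e = "\<lambda>c. E (fst (prod_decode c)) (snd (prod_decode c))"
  have "sat X ?e \<phi>" using assms(3) by (simp add: \<phi>(2) vec_env_surj)
  moreover have "?e c \<in> \<rat>" if "c \<in> prod_encode ` (C \<times> {..<n})" for c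
    using that assms(4) by auto
  ultimately obtain e' where "sat X e' \<phi>" "\<forall>c\<in>prod_encode ` (C \<times> {..<n}). e' c = ?e c" "\<forall>c. e' c \<in> \<rat>"
    using rational_assignment[OF assms(1) \<phi>(1), of ?e "prod_encode ` (C \<times> {..<n})"] by blast
  then show ?thesis using \<phi>(2) by (intro exI[of _ "vec_env e'"]) (auto simp: vec_env_def)
qed

section \<open>Germs and strata\<close>

text \<open>Unlike \<open>period\<close>, this asks for all small real multiples of a vector, which
  makes it a subspace but not directly a formula of the language; \<open>good_strata\<close> links
  the two notions.\<close>

definition strata :: "nat \<Rightarrow> real list set \<Rightarrow> nat \<Rightarrow> (nat \<Rightarrow> real) \<Rightarrow> (nat \<Rightarrow> real) set" where
  "strata n X k y = {v. (\<forall>i. i \<notin> {k..<n} \<longrightarrow> v i = 0) \<and>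
     (\<exists>r>0. \<forall>u t. near n k y r u \<longrightarrow> \<bar>t\<bar> < r \<longrightarrow>
        (u \<in> rel_of n X \<longleftrightarrow> (\<lambda>i. u i + t * v i) \<in> rel_of n X))}"

text \<open>Neighbourhoods are compared after translation, so germs at points of different sections
  can agree.\<close>

definition germ_eq :: "nat \<Rightarrow> real list set \<Rightarrow> nat \<Rightarrow> (nat \<Rightarrow> real) \<Rightarrow> (nat \<Rightarrow> real) \<Rightarrow> bool" where
  "germ_eq n X k y z \<longleftrightarrow> (\<exists>r>0. \<forall>u. near n k (\<lambda>_. 0) r u \<longrightarrow>
     ((\<lambda>i. y i + u i) \<in> rel_of n X \<longleftrightarrow> (\<lambda>i. z i + u i) \<in> rel_of n X))"

lemma small_real:
  fixes a b M :: real
  assumes "a > 0" "b > 0" "M > 0"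
  shows "\<exists>s>0. s < a \<and> s * M < b"
proof (intro exI[of _ "min (a / 2) (b / (2 * M))"] conjI)
  have "min (a / 2) (b / (2 * M)) * M \<le> b / (2 * M) * M" using assms by (intro mult_right_mono) auto
  also have "\<dots> < b" using assms by simp
  finally show "min (a / 2) (b / (2 * M)) * M < b" .
qed (use assms in auto)

lemma near_refl: "r > 0 \<Longrightarrow> near n k y r y"
  by (simp add: near_def)

lemma near_move:
  assumes "near n k y r u" "\<And>i. i < k \<Longrightarrow> v i = 0" "\<And>i. i < n \<Longrightarrow> \<bar>v i\<bar> \<le> M" "r + \<bar>t\<bar> * M \<le> R"
  shows "near n k y R (\<lambda>i. u i + t * v i)"
  unfolding near_def
proof (intro conjI allI impI)
  fix i assume i: "i < n" "k \<le> i"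
  then have "\<bar>u i - y i\<bar> < r" using assms(1) by (simp add: near_def)
  moreover have "\<bar>t * v i\<bar> \<le> \<bar>t\<bar> * M"
    unfolding abs_mult using assms(3)[OF i(1)] by (rule mult_left_mono) simp
  ultimately show "\<bar>u i + t * v i - y i\<bar> < R" using assms(4) by linarith
qed (use assms in \<open>auto simp: near_def\<close>)

lemma near_cong: "(\<And>i. i < n \<Longrightarrow> y i = z i) \<Longrightarrow> k < n \<Longrightarrow> near n k y r u \<longleftrightarrow> near n k z r u"
  unfolding near_def by auto

context
  fixes n :: nat and X :: "real list set"
begin

lemma strataE:
  assumes "v \<in> strata n X k y"
  obtains r where "r > 0"
    "\<And>u t. near n k y r u \<Longrightarrow> \<bar>t\<bar> < r \<Longrightarrow> u \<in> rel_of n X \<longleftrightarrow> (\<lambda>i. u i + t * v i) \<in> rel_of n X"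
  using assms unfolding strata_def by blast

lemma strataI:
  assumes "\<And>i. i \<notin> {k..<n} \<Longrightarrow> v i = 0" "r > 0"
    "\<And>u t. near n k y r u \<Longrightarrow> \<bar>t\<bar> < r \<Longrightarrow> u \<in> rel_of n X \<longleftrightarrow> (\<lambda>i. u i + t * v i) \<in> rel_of n X"
  shows "v \<in> strata n X k y"
  using assms unfolding strata_def by blast

lemma strata_support: "v \<in> strata n X k y \<Longrightarrow> i \<notin> {k..<n} \<Longrightarrow> v i = 0"
  unfolding strata_def by blast

lemma strata_subsp: "subsp {k..<n} (strata n X k y)"
  unfolding subsp_def
proof (intro conjI ballI allI impI)
  show "(\<lambda>_. 0) \<in> strata n X k y" by (rule strataI[of _ _ 1]) auto
next
  fix v i assume "v \<in> strata n X k y" "i \<notin> {k..<n}"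
  then show "v i = 0" by (rule strata_support)
next
  fix u v s assume u: "u \<in> strata n X k y" and v: "v \<in> strata n X k y"
  obtain r1 where r1: "r1 > 0"
    "\<And>w t. near n k y r1 w \<Longrightarrow> \<bar>t\<bar> < r1 \<Longrightarrow> w \<in> rel_of n X \<longleftrightarrow> (\<lambda>i. w i + t * u i) \<in> rel_of n X" using u by (rule strataE) blast
  obtain r2 where r2: "r2 > 0"
    "\<And>w t. near n k y r2 w \<Longrightarrow> \<bar>t\<bar> < r2 \<Longrightarrow> w \<in> rel_of n X \<longleftrightarrow> (\<lambda>i. w i + t * v i) \<in> rel_of n X" using v by (rule strataE) blast
  obtain M where M: "M > 0" "\<forall>i<n. \<bar>u i\<bar> \<le> M" using bounded_on_finite by blast
  \<comment> \<open>The factor of \<open>r\<close> collects the starting box, the first move by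
    \<open>t * u\<close>, and the multiple \<open>t * s\<close> of the second move.\<close>
  obtain r where r: "r > 0" "r < r1" "r * (1 + M + \<bar>s\<bar>) < r2"
    using small_real[OF r1(1) r2(1) add_pos_nonneg[OF add_pos_pos[OF zero_less_one M(1)] abs_ge_zero]]
    by blast
  show "(\<lambda>i. u i + s * v i) \<in> strata n X k y"
  proof (rule strataI[OF _ r(1)])
    fix w t assume w: "near n k y r w" and t: "\<bar>t\<bar> < r"
    have "\<bar>t\<bar> * M \<le> r * M" "\<bar>t\<bar> * \<bar>s\<bar> \<le> r * \<bar>s\<bar>" using t M by (intro mult_right_mono; simp)+
    moreover have "r * M > 0" "r * \<bar>s\<bar> \<ge> 0" "r + r * M + r * \<bar>s\<bar> < r2"
      using r M(1) by (simp_all add: algebra_simps)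
    ultimately have le: "r + \<bar>t\<bar> * M \<le> r2" "\<bar>t * s\<bar> < r2"
      unfolding abs_mult using r(1) by linarith+
    have "w \<in> rel_of n X \<longleftrightarrow> (\<lambda>i. w i + t * u i) \<in> rel_of n X"
      using r1(2)[OF near_mono[OF w]] r t by simp
    also have "\<dots> \<longleftrightarrow> (\<lambda>i. w i + t * u i + (t * s) * v i) \<in> rel_of n X"
      using M(2) le strata_support[OF u] by (intro r2(2) near_move[OF w, of _ M]) auto
    also have "(\<lambda>i. w i + t * u i + (t * s) * v i) = (\<lambda>i. w i + t * (u i + s * v i))"
      by (simp add: algebra_simps)
    finally show "w \<in> rel_of n X \<longleftrightarrow> (\<lambda>i. w i + t * (u i + s * v i)) \<in> rel_of n X" .
  qed (use strata_support[OF u] strata_support[OF v] in auto)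
qed

lemma germ_eqE:
  assumes "germ_eq n X k y z"
  obtains r where "r > 0"
    "\<And>u. near n k (\<lambda>_. 0) r u \<Longrightarrow> (\<lambda>i. y i + u i) \<in> rel_of n X \<longleftrightarrow> (\<lambda>i. z i + u i) \<in> rel_of n X"
  using assms unfolding germ_eq_def by blast

lemma germ_eq_refl: "germ_eq n X k y y"
  unfolding germ_eq_def by (intro exI[of _ 1]) auto

lemma germ_eq_sym: "germ_eq n X k y z \<Longrightarrow> germ_eq n X k z y"
  unfolding germ_eq_def by blast

lemma germ_eq_trans:
  assumes "germ_eq n X k x y" "germ_eq n X k y z"
  shows "germ_eq n X k x z"
proof -
  obtain r1 where r1: "r1 > 0"
    "\<And>u. near n k (\<lambda>_. 0) r1 u \<Longrightarrow> (\<lambda>i. x i + u i) \<in> rel_of n X \<longleftrightarrow> (\<lambda>i. y i + u i) \<in> rel_of n X"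
    using assms(1) by (rule germ_eqE) blast
  obtain r2 where r2: "r2 > 0"
    "\<And>u. near n k (\<lambda>_. 0) r2 u \<Longrightarrow> (\<lambda>i. y i + u i) \<in> rel_of n X \<longleftrightarrow> (\<lambda>i. z i + u i) \<in> rel_of n X"
    using assms(2) by (rule germ_eqE) blast
  have "(\<lambda>i. x i + u i) \<in> rel_of n X \<longleftrightarrow> (\<lambda>i. z i + u i) \<in> rel_of n X" if "near n k (\<lambda>_. 0) (min r1 r2) u" for u
    using r1(2)[OF near_mono[OF that]] r2(2)[OF near_mono[OF that]] by simp
  then show ?thesis unfolding germ_eq_def using r1 r2 by (intro exI[of _ "min r1 r2"]) auto
qed

lemma germ_eq_strata_subset:
  assumes "germ_eq n X k y z"
  shows "strata n X k y \<subseteq> strata n X k z"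
proof
  fix v assume v: "v \<in> strata n X k y"
  obtain r1 where r1: "r1 > 0"
    "\<And>w t. near n k y r1 w \<Longrightarrow> \<bar>t\<bar> < r1 \<Longrightarrow> w \<in> rel_of n X \<longleftrightarrow> (\<lambda>i. w i + t * v i) \<in> rel_of n X" using v by (rule strataE) blast
  obtain r2 where r2: "r2 > 0"
    "\<And>u. near n k (\<lambda>_. 0) r2 u \<Longrightarrow> (\<lambda>i. y i + u i) \<in> rel_of n X \<longleftrightarrow> (\<lambda>i. z i + u i) \<in> rel_of n X"
    using assms(1) by (rule germ_eqE) blast
  obtain M where M: "M > 0" "\<forall>i<n. \<bar>v i\<bar> \<le> M" using bounded_on_finite by blast
  obtain r where r: "r > 0" "r < r1" "r * (1 + M) < r2"
    using small_real[OF r1(1) r2(1), of "1 + M"] M by auto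
  show "v \<in> strata n X k z"
  proof (rule strataI[OF _ r(1)])
    fix u t assume u: "near n k z r u" and t: "\<bar>t\<bar> < r"
    define d where "d = (\<lambda>i. u i - z i)"
    have d: "near n k (\<lambda>_. 0) r d" using u by (auto simp: near_def d_def)
    have "\<bar>t\<bar> * M \<le> r * M" "r * M > 0" using t M r by (auto intro!: mult_right_mono)
    then have le: "r \<le> r2" "r + \<bar>t\<bar> * M \<le> r2" using r by (auto simp: algebra_simps)
    have yd: "near n k y r1 (\<lambda>i. y i + d i)" using near_mono[OF d, of r1] r by (auto simp: near_def)
    have "u \<in> rel_of n X \<longleftrightarrow> (\<lambda>i. y i + d i) \<in> rel_of n X"
      using r2(2)[OF near_mono[OF d le(1)]] by (simp add: d_def)
    also have "\<dots> \<longleftrightarrow> (\<lambda>i. y i + d i + t * v i) \<in> rel_of n X" using r1(2)[OF yd] t r by simp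
    also have "\<dots> \<longleftrightarrow> (\<lambda>i. y i + (d i + t * v i)) \<in> rel_of n X" by (simp only: add.assoc)
    also have "\<dots> \<longleftrightarrow> (\<lambda>i. z i + (d i + t * v i)) \<in> rel_of n X"
      using M(2) le strata_support[OF v] by (intro r2(2) near_move[OF d, of _ M]) auto
    also have "(\<lambda>i. z i + (d i + t * v i)) = (\<lambda>i. u i + t * v i)" by (simp add: d_def)
    finally show "u \<in> rel_of n X \<longleftrightarrow> (\<lambda>i. u i + t * v i) \<in> rel_of n X" .
  qed (use strata_support[OF v] in auto)
qed

lemma germ_eq_strata: "germ_eq n X k y z \<Longrightarrow> strata n X k y = strata n X k z"
  using germ_eq_strata_subset germ_eq_sym by blast

text \<open>A box half as large leaves room for a neighbourhood of each of its points, which turns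
  invariance of membership into equality of germs.\<close>

lemma germ_eq_along_stratum:
  assumes "v \<in> strata n X k y"
  shows "\<exists>r>0. \<forall>u t. near n k y r u \<longrightarrow> \<bar>t\<bar> < r \<longrightarrow> germ_eq n X k u (\<lambda>i. u i + t * v i)"
proof -
  obtain R where R: "R > 0"
    "\<And>w t. near n k y R w \<Longrightarrow> \<bar>t\<bar> < R \<Longrightarrow> w \<in> rel_of n X \<longleftrightarrow> (\<lambda>i. w i + t * v i) \<in> rel_of n X"
    using assms by (rule strataE) blast
  have "germ_eq n X k u (\<lambda>i. u i + t * v i)" if u: "near n k y (R / 2) u" and t: "\<bar>t\<bar> < R / 2" for u t
    unfolding germ_eq_def
  proof (intro exI[of _ "R / 2"] conjI allI impI)
    fix d assume d: "near n k (\<lambda>_. 0) (R / 2) d"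
    have "near n k y R (\<lambda>i. u i + d i)" by (rule near_add[OF u d]) simp
    from R(2)[OF this, of t] t R(1)
    show "(\<lambda>i. u i + d i) \<in> rel_of n X \<longleftrightarrow> (\<lambda>i. u i + t * v i + d i) \<in> rel_of n X" by (simp add: add_ac)
  qed (use R in simp)
  then show ?thesis using R by (intro exI[of _ "R / 2"]) auto
qed

lemma germ_eq_shift:
  assumes "germ_eq n X k y z"
  shows "\<exists>r>0. \<forall>d. near n k (\<lambda>_. 0) r d \<longrightarrow> germ_eq n X k (\<lambda>i. y i + d i) (\<lambda>i. z i + d i)"
proof -
  obtain R where R: "R > 0"
    "\<And>u. near n k (\<lambda>_. 0) R u \<Longrightarrow> (\<lambda>i. y i + u i) \<in> rel_of n X \<longleftrightarrow> (\<lambda>i. z i + u i) \<in> rel_of n X"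
    using assms(1) by (rule germ_eqE) blast
  have "germ_eq n X k (\<lambda>i. y i + d i) (\<lambda>i. z i + d i)" if d: "near n k (\<lambda>_. 0) (R / 2) d" for d
    unfolding germ_eq_def
  proof (intro exI[of _ "R / 2"] conjI allI impI)
    fix u assume u: "near n k (\<lambda>_. 0) (R / 2) u"
    have "near n k (\<lambda>_. 0) R (\<lambda>i. d i + u i)" by (rule near_add[OF d u]) simp
    from R(2)[OF this] show "(\<lambda>i. y i + d i + u i) \<in> rel_of n X \<longleftrightarrow> (\<lambda>i. z i + d i + u i) \<in> rel_of n X"
      by (simp add: add.assoc)
  qed (use R in simp)
  then show ?thesis using R by (intro exI[of _ "R / 2"]) auto
qed

text \<open>Semicontinuity: strata persist at neighbouring points, where further ones may appear, so
  in a limit the dimension can only drop.\<close>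

lemma strata_lower:
  assumes "v \<in> strata n X k y"
  shows "\<exists>r>0. \<forall>u. near n k y r u \<longrightarrow> v \<in> strata n X k u"
proof -
  obtain R where R: "R > 0"
    "\<And>w t. near n k y R w \<Longrightarrow> \<bar>t\<bar> < R \<Longrightarrow> w \<in> rel_of n X \<longleftrightarrow> (\<lambda>i. w i + t * v i) \<in> rel_of n X"
    using assms by (rule strataE) blast
  have "v \<in> strata n X k u" if u: "near n k y (R / 2) u" for u
  proof (rule strataI[of _ _ "R / 2"])
    fix w t assume w: "near n k u (R / 2) w" and t: "\<bar>t\<bar> < R / 2"
    have "near n k (\<lambda>_. 0) (R / 2) (\<lambda>i. w i - u i)" using w by (auto simp: near_def)
    from near_add[OF u this, of R] have "near n k y R w" by simp
    from R(2)[OF this] t R(1) show "w \<in> rel_of n X \<longleftrightarrow> (\<lambda>i. w i + t * v i) \<in> rel_of n X" by simp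
  qed (use R strata_support[OF assms] in auto)
  then show ?thesis using R by (intro exI[of _ "R / 2"]) auto
qed

text \<open>The passage from the first-order condition to strata. Midpoints starting from 0 and
  \<open>w\<close> give the dyadic multiples of a period, closedness gives all multiples between 0
  and 1, and negative multiples arise by undoing a positive one.\<close>

lemma good_strata:
  assumes "good n (rel_of n X) k y" "k < n"
  shows "\<exists>r0>0. \<forall>r w. 0 < r \<and> r \<le> r0 \<and> period n (rel_of n X) k y r w \<longrightarrow>
      (\<lambda>i. if k \<le> i \<and> i < n then w i else 0) \<in> strata n X k y"
    and "\<exists>v\<in>strata n X k y. v k = 1"
proof -
  obtain r0 where r0: "r0 > 0" and mid: "\<And>r v w w'. 0 < r \<Longrightarrow> r \<le> r0 \<Longrightarrow> period n (rel_of n X) k y r w \<Longrightarrow>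
      period n (rel_of n X) k y r w' \<Longrightarrow> (\<forall>i<n. v i + v i = w i + w' i) \<Longrightarrow> period n (rel_of n X) k y r v"
    and closed: "\<And>r w. 0 < r \<Longrightarrow> r \<le> r0 \<Longrightarrow> near n k (\<lambda>_. 0) r w \<Longrightarrow>
      (\<forall>e>0. \<exists>w'. period n (rel_of n X) k y r w' \<and> near n k w e w') \<Longrightarrow> period n (rel_of n X) k y r w"
    and trans: "\<And>r. 0 < r \<Longrightarrow> r \<le> r0 \<Longrightarrow> \<exists>w. period n (rel_of n X) k y r w \<and> w k \<noteq> 0"
    using assms(1) unfolding good_def by blast
  define tr where "tr = (\<lambda>w i. if k \<le> i \<and> i < n then w i else (0::real))"
  have *: "tr w \<in> strata n X k y" if r: "0 < r" "r \<le> r0" and w: "period n (rel_of n X) k y r w" for r w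
  proof -
    have w0: "\<And>i. i < k \<Longrightarrow> w i = 0" "near n k (\<lambda>_. 0) r w" using w by (auto simp: period_def near_def)
    obtain M where M: "M > 0" "\<forall>i<n. \<bar>w i\<bar> \<le> M" using bounded_on_finite by blast
    have dyadic: "period n (rel_of n X) k y r (\<lambda>i. real j / 2 ^ m * w i)" if "j \<le> 2 ^ m" for j m
      using that
    proof (induction m arbitrary: j)
      case 0
      then consider "j = 0" | "j = 1" by force
      then show ?case
      proof cases
        case 1
        then show ?thesis using r by (simp add: period_def near_def)
      qed (use w in simp)
    next
      case (Suc m)
      \<comment> \<open>The halves of \<open>j\<close>, rounded down and up, give two fractions of
        the previous level whose midpoint is the new fraction.\<close>
      have j: "real (j div 2) + real ((j + 1) div 2) = real j"
        unfolding of_nat_add[symmetric] by (rule arg_cong[of _ _ real]) presburger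
      have j_le: "j div 2 \<le> 2 ^ m" "(j + 1) div 2 \<le> 2 ^ m" using Suc.prems by auto
      have "real j / 2 ^ Suc m * w i + real j / 2 ^ Suc m * w i
            = (real (j div 2) + real ((j + 1) div 2)) / 2 ^ m * w i" for i
          unfolding j by simp
        then have "\<forall>i<n. real j / 2 ^ Suc m * w i + real j / 2 ^ Suc m * w i
            = real (j div 2) / 2 ^ m * w i + real ((j + 1) div 2) / 2 ^ m * w i"
          by (simp add: add_divide_distrib distrib_right)
      from mid[OF r Suc.IH[OF j_le(1)] Suc.IH[OF j_le(2)] this] show ?case .
    qed
    have unit: "period n (rel_of n X) k y r (\<lambda>i. t * w i)" if t: "0 \<le> t" "t \<le> 1" for t
    proof (rule closed[OF r])
      show "near n k (\<lambda>_. 0) r (\<lambda>i. t * w i)"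
        unfolding near_def
      proof (intro conjI allI impI)
        fix i assume i: "i < n" "k \<le> i"
        have "\<bar>t * w i\<bar> \<le> 1 * \<bar>w i\<bar>" unfolding abs_mult using t by (intro mult_right_mono) auto
        also have "\<dots> < r" using w0(2) i by (simp add: near_def)
        finally show "\<bar>t * w i - 0\<bar> < r" by simp
      qed (use w0 in auto)
      show "\<forall>e>0. \<exists>w'. period n (rel_of n X) k y r w' \<and> near n k (\<lambda>i. t * w i) e w'"
      proof (intro allI impI)
        fix e :: real assume "e > 0"
        obtain m where m: "M / e < 2 ^ m" using real_arch_pow[of 2 "M / e"] by auto
        \<comment> \<open>The fraction \<open>j / 2 ^ m\<close> approximates \<open>t\<close> with
          error at most \<open>1 / 2 ^ m\<close>, which the choice of \<open>m\<close> makes smaller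
          than \<open>e / M\<close>.\<close>
        define j where "j = nat \<lfloor>t * 2 ^ m\<rfloor>"
        have j: "real j = of_int \<lfloor>t * 2 ^ m\<rfloor>" using t by (simp add: j_def)
        have "real j \<le> t * 2 ^ m" "t * 2 ^ m < real j + 1" unfolding j by linarith+
        then have close: "\<bar>real j - t * 2 ^ m\<bar> \<le> 1" by linarith
        have "t * 2 ^ m \<le> 1 * (2 ^ m :: real)" using t(2) by (intro mult_right_mono) auto
        with \<open>real j \<le> t * 2 ^ m\<close> have "real j \<le> 2 ^ m" by linarith
        then have "j \<le> 2 ^ m" by simp
        have "near n k (\<lambda>i. t * w i) e (\<lambda>i. real j / 2 ^ m * w i)"
          unfolding near_def
        proof (intro conjI allI impI)
          fix i assume i: "i < n" "k \<le> i"
          have "real j / 2 ^ m * w i - t * w i = (real j - t * 2 ^ m) * w i / 2 ^ m"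
            by (simp add: field_simps)
          then have "\<bar>real j / 2 ^ m * w i - t * w i\<bar> = \<bar>real j - t * 2 ^ m\<bar> * \<bar>w i\<bar> / 2 ^ m"
            by (simp add: abs_mult)
          also have "\<dots> \<le> 1 * M / 2 ^ m"
            using close M i by (intro divide_right_mono mult_mono) auto
          also have "\<dots> < e" using m \<open>e > 0\<close> by (simp add: field_simps)
          finally show "\<bar>real j / 2 ^ m * w i - t * w i\<bar> < e" .
        qed (use w0 in auto)
        with dyadic[OF \<open>j \<le> 2 ^ m\<close>]
        show "\<exists>w'. period n (rel_of n X) k y r w' \<and> near n k (\<lambda>i. t * w i) e w'" by blast
      qed
    qed
    obtain s where s: "s > 0" "s < min 1 r" "s * (1 + M) < r"
      using small_real[of "min 1 r" r "1 + M"] r(1) M by auto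
    show "tr w \<in> strata n X k y"
    proof (rule strataI[OF _ s(1)])
      fix u t assume u: "near n k y s u" and t: "\<bar>t\<bar> < s"
      have u_r: "near n k y r u" using near_mono[OF u] s by simp
      have "(\<lambda>i. u i + t * tr w i) \<in> rel_of n X \<longleftrightarrow> (\<lambda>i. u i + t * w i) \<in> rel_of n X"
        by (rule rel_of_cong) (use w0 in \<open>auto simp: tr_def\<close>)
      also have "\<dots> \<longleftrightarrow> u \<in> rel_of n X"
      proof (cases "t \<ge> 0")
        case True
        then have "period n (rel_of n X) k y r (\<lambda>i. t * w i)" using unit t s by simp
        then show ?thesis using u_r unfolding period_def by blast
      next
        case False
        \<comment> \<open>For negative \<open>t\<close> the period \<open>- t * w\<close> is applied
          at the point already moved by \<open>t * w\<close>, which \<open>s * (1 + M) < r\<close>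
          keeps in the box.\<close>
        then have per: "period n (rel_of n X) k y r (\<lambda>i. - t * w i)" using unit[of "- t"] t s by simp
        have "\<bar>t\<bar> * M \<le> s * M" using t M by (intro mult_right_mono) auto
        moreover have "s + s * M < r" using s(3) by (simp add: algebra_simps)
        ultimately have "s + \<bar>t\<bar> * M \<le> r" by linarith
        then have "near n k y r (\<lambda>i. u i + t * w i)"
          using M s by (intro near_move[OF u w0(1), where M = M]) auto
        with per have "(\<lambda>i. u i + t * w i) \<in> rel_of n X \<longleftrightarrow> (\<lambda>i. u i + t * w i + - t * w i) \<in> rel_of n X"
          unfolding period_def by blast
        then show ?thesis by simp
      qed
      finally show "u \<in> rel_of n X \<longleftrightarrow> (\<lambda>i. u i + t * tr w i) \<in> rel_of n X" by blast
    qed (auto simp: tr_def)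
  qed
  then show "\<exists>r0>0. \<forall>r w. 0 < r \<and> r \<le> r0 \<and> period n (rel_of n X) k y r w \<longrightarrow>
      (\<lambda>i. if k \<le> i \<and> i < n then w i else 0) \<in> strata n X k y"
    using r0 unfolding tr_def by blast
  obtain w where w: "period n (rel_of n X) k y r0 w" "w k \<noteq> 0" using trans[of r0] r0 by auto
  have "(\<lambda>i. 1 / w k * tr w i) \<in> strata n X k y"
    by (rule subsp_scale[OF strata_subsp *[OF r0 order_refl w(1)]])
  moreover have "1 / w k * tr w k = 1" using w(2) assms(2) by (simp add: tr_def)
  ultimately show "\<exists>v\<in>strata n X k y. v k = 1" 
    by (intro bexI[where x = "\<lambda>i. 1 / w k * tr w i"])
qed

end

section \<open>Transporting germs between parallel sections\<close>

text \<open>Meant for an affine form along a segment, with end values \<open>a\<close> and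
  \<open>b\<close>. Multiplied by \<open>a\<close>, an intermediate value becomes a convex
  combination of \<open>a * a\<close> and \<open>a * b\<close>, both positive unless
  \<open>a\<close> is 0.\<close>

lemma same_sign_zero:
  fixes a b t :: real
  assumes "sgn a = sgn b" "a + t * (b - a) = 0" "0 \<le> t" "t \<le> 1"
  shows "a = 0"
proof (rule ccontr)
  assume "a \<noteq> 0"
  have "a * (a + t * (b - a)) = (1 - t) * (a * a) + t * (a * b)" by (simp add: algebra_simps)
  moreover have "a * a > 0" "a * b > 0"
    using \<open>a \<noteq> 0\<close> assms(1) by (auto simp: sgn_if zero_less_mult_iff split: if_splits)
  then have "(1 - t) * (a * a) + t * (a * b) > 0"
    using assms(3,4) by (cases "t = 0") (auto intro: add_nonneg_pos)
  ultimately show False using assms(2) by simp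
qed

context
  fixes n :: nat and X :: "real list set"
begin

text \<open>Follow a stratum of \<open>y\<close> towards the section \<open>b\<close>. At the first point where the germ changes
  the stratum space is strictly smaller, so the claim holds for that point by induction on the
  dimension, and a small shift moves the result back to the germ of \<open>y\<close>.\<close>

lemma germ_transport:
  assumes conv: "\<And>s t u. s \<in> J \<Longrightarrow> u \<in> J \<Longrightarrow> s \<le> t \<Longrightarrow> t \<le> u \<Longrightarrow> t \<in> J"
    and trans: "\<And>y. (\<forall>i<k. y i = x i) \<Longrightarrow> y k \<in> J \<Longrightarrow> \<exists>v\<in>strata n X k y. v k = 1"
    and "k < n" "b \<in> J" "\<forall>i<k. y i = x i" "y k \<in> J"
  shows "\<exists>z. germ_eq n X k y z \<and> (\<lambda>i. z i - y i) \<in> strata n X k y \<and> z k = b"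
  using assms(5,6)
proof (induction "sdim {k..<n} (strata n X k y)" arbitrary: y rule: less_induct)
  case less
  obtain v0 where v0: "v0 \<in> strata n X k y" "v0 k = 1" using trans[OF less.prems] by blast
  \<comment> \<open>Scaled so that \<open>p 1\<close> lies on the section \<open>b\<close>.\<close>
  define v where "v = (\<lambda>i. (b - y k) * v0 i)"
  have v: "v \<in> strata n X k y" unfolding v_def by (rule subsp_scale[OF strata_subsp v0(1)])
  have vk: "v k = b - y k" using v0 by (simp add: v_def)
  have v_pre: "v i = 0" if "i < k" for i using strata_support[OF v, of i] that by simp
  define p where "p = (\<lambda>t i. y i + t * v i)"
  show ?case
  proof (cases "\<forall>t. 0 \<le> t \<and> t \<le> 1 \<longrightarrow> germ_eq n X k y (p t)")
    case True
    have "(\<lambda>i. p 1 i - y i) = v" by (simp add: p_def)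
    moreover have "germ_eq n X k y (p 1)" using True by simp
    moreover have "p 1 k = b" using vk by (simp add: p_def)
    ultimately show ?thesis using v by (intro exI[of _ "p 1"]) simp
  next
    case False
    define T where "T = {t. 0 \<le> t \<and> t \<le> 1 \<and> \<not> germ_eq n X k y (p t)}"
    define t0 where "t0 = Inf T"
    have T: "T \<noteq> {}" "bdd_below T" using False by (auto simp: T_def intro: bdd_belowI[of _ 0])
    have t0: "0 \<le> t0" "t0 \<le> 1"
    proof -
      show "0 \<le> t0" unfolding t0_def using T(1) by (intro cInf_greatest) (auto simp: T_def)
      obtain t where "t \<in> T" using T(1) by blast
      then have "t0 \<le> t" "t \<le> 1" unfolding t0_def using T(2) by (auto intro: cInf_lower simp: T_def)
      then show "t0 \<le> 1" by simp
    qed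
    have before: "germ_eq n X k y (p t)" if "0 \<le> t" "t < t0" for t
    proof (rule ccontr)
      assume "\<not> germ_eq n X k y (p t)"
      then have "t \<in> T" using that t0 by (simp add: T_def)
      then have "t0 \<le> t" unfolding t0_def using T(2) by (rule cInf_lower)
      with that show False by simp
    qed
    define z where "z = p t0"
    have shift: "p (t0 + t) = (\<lambda>i. z i + t * v i)" for t by (simp add: p_def z_def algebra_simps)
    have z_pre: "\<forall>i<k. z i = x i" using less.prems v_pre by (simp add: z_def p_def)
    have z_J: "z k \<in> J"
    proof -
      have zk: "z k = y k + t0 * (b - y k)" by (simp add: z_def p_def vk)
      show ?thesis
      proof (cases "y k \<le> b")
        case True
        then have "0 \<le> t0 * (b - y k)" "t0 * (b - y k) \<le> 1 * (b - y k)"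
          using t0 by (simp, intro mult_right_mono, simp_all)
        with zk have "y k \<le> z k" "z k \<le> b" by auto
        with conv less.prems \<open>b \<in> J\<close> show ?thesis by blast
      next
        case False
        then have "0 \<le> t0 * (y k - b)" "t0 * (y k - b) \<le> 1 * (y k - b)"
          using t0 by (simp, intro mult_right_mono, simp_all)
        with zk have "b \<le> z k" "z k \<le> y k" by (auto simp: algebra_simps)
        with conv less.prems \<open>b \<in> J\<close> show ?thesis by blast
      qed
    qed
    \<comment> \<open>Otherwise \<open>v\<close> would be a stratum at \<open>z\<close> and the germ
      would persist beyond \<open>t0\<close>.\<close>
    have not_z: "\<not> germ_eq n X k y z"
    proof
      assume yz: "germ_eq n X k y z"
      then have "v \<in> strata n X k z" using v germ_eq_strata by blast
      from germ_eq_along_stratum[OF this] near_refl obtain r where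
        r: "r > 0" "\<And>t. \<bar>t\<bar> < r \<Longrightarrow> germ_eq n X k z (\<lambda>i. z i + t * v i)" by metis
      have "Inf T < t0 + r" using r by (simp add: t0_def)
      from cInf_lessD[OF T(1) this] obtain t where t: "t \<in> T" "t < t0 + r" by blast
      have "t0 \<le> t" unfolding t0_def using t(1) T(2) by (rule cInf_lower)
      with r(2)[of "t - t0"] t have "germ_eq n X k z (p t)" using shift[of "t - t0"] by simp
      with yz have "germ_eq n X k y (p t)" by (rule germ_eq_trans)
      with t(1) show False by (simp add: T_def)
    qed
    have "t0 \<noteq> 0"
    proof
      assume "t0 = 0"
      then have "z = y" by (simp add: z_def p_def)
      with not_z germ_eq_refl show False by metis
    qed
    with t0 have "t0 > 0" by simp
    \<comment> \<open>Otherwise the germ at \<open>z\<close> would agree with those just before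
      \<open>t0\<close>, which are the germ of \<open>y\<close>.\<close>
    have v_z: "v \<notin> strata n X k z"
    proof
      assume "v \<in> strata n X k z"
      from germ_eq_along_stratum[OF this] near_refl obtain r where
        r: "r > 0" "\<And>t. \<bar>t\<bar> < r \<Longrightarrow> germ_eq n X k z (\<lambda>i. z i + t * v i)" by metis
      define s where "s = min (r / 2) (t0 / 2)"
      have s: "0 < s" "s < r" "s < t0" using r \<open>t0 > 0\<close> by (auto simp: s_def)
      have "germ_eq n X k z (p (t0 - s))" using r(2)[of "- s"] s shift[of "- s"] by simp
      moreover have "germ_eq n X k y (p (t0 - s))" using before s by simp
      ultimately show False using not_z germ_eq_sym germ_eq_trans by blast
    qed
    obtain M where M: "M > 0" "\<forall>i<n. \<bar>v i\<bar> \<le> M" using bounded_on_finite by blast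
    have near_z: "near n k z R (\<lambda>i. z i + - s * v i)" "near n k (\<lambda>_. 0) R (\<lambda>i. - s * v i)"
      if "0 < s" "s * M < R" for s R
    proof -
      have "\<bar>- s * v i\<bar> < R" if "i < n" for i
      proof -
        have "\<bar>- s * v i\<bar> \<le> s * M" unfolding abs_mult using M that \<open>0 < s\<close> by (intro mult_mono) auto
        with \<open>s * M < R\<close> show ?thesis by simp
      qed
      with v_pre show "near n k z R (\<lambda>i. z i + - s * v i)" "near n k (\<lambda>_. 0) R (\<lambda>i. - s * v i)"
        by (auto simp: near_def)
    qed
    \<comment> \<open>A stratum at \<open>z\<close> persists just before \<open>t0\<close>, where
      the germ is still that of \<open>y\<close>.\<close>
    have sub: "strata n X k z \<subseteq> strata n X k y"
    proof
      fix w assume "w \<in> strata n X k z"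
      from strata_lower[OF this] obtain r where
        r: "r > 0" "\<And>u. near n k z r u \<Longrightarrow> w \<in> strata n X k u" by blast
      obtain s where s: "s > 0" "s < t0" "s * M < r"
        using small_real[OF \<open>t0 > 0\<close> r(1) M(1)] by blast
      have "w \<in> strata n X k (p (t0 + - s))"
        unfolding shift by (rule r(2)[OF near_z(1)]) (use s in auto)
      moreover have "germ_eq n X k y (p (t0 + - s))" using before s by simp
      ultimately show "w \<in> strata n X k y" using germ_eq_strata by blast
    qed
    have "sdim {k..<n} (strata n X k z) < sdim {k..<n} (strata n X k y)"
      using sub v v_z by (intro sdim_strict_mono strata_subsp) auto
    from less.hyps[OF this z_pre z_J] obtain z' where
      z': "germ_eq n X k z z'" "(\<lambda>i. z' i - z i) \<in> strata n X k z" "z' k = b" by blast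
    obtain w0 where w0: "w0 \<in> strata n X k z" "w0 k = 1" using trans[OF z_pre z_J] by blast
    define w where "w = (\<lambda>i. v k * w0 i)"
    have w: "w \<in> strata n X k z" unfolding w_def by (rule subsp_scale[OF strata_subsp w0(1)])
    then have "w \<in> strata n X k z'" using germ_eq_strata[OF z'(1)] by simp
    from germ_eq_along_stratum[OF this] obtain r1 where r1: "r1 > 0"
      "\<And>u t. near n k z' r1 u \<Longrightarrow> \<bar>t\<bar> < r1 \<Longrightarrow> germ_eq n X k u (\<lambda>i. u i + t * w i)" by blast
    from germ_eq_shift[OF z'(1)] obtain r2 where r2: "r2 > 0"
      "\<And>d. near n k (\<lambda>_. 0) r2 d \<Longrightarrow> germ_eq n X k (\<lambda>i. z i + d i) (\<lambda>i. z' i + d i)" by blast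
    have pos: "min t0 r1 > 0" "min r1 r2 > 0" using \<open>t0 > 0\<close> r1 r2 by auto
    obtain s where s: "s > 0" "s < min t0 r1" "s * M < min r1 r2"
      using small_real[OF pos M(1)] by blast
    \<comment> \<open>The shift of \<open>z'\<close> by \<open>- s * v\<close> mirrors a step back
      from \<open>z\<close>, to where the germ is that of \<open>y\<close>. It leaves the section
      \<open>b\<close>; since \<open>w k = v k\<close>, adding \<open>s * w\<close> returns to it
      along a stratum at \<open>z'\<close>.\<close>
    define y' where "y' = (\<lambda>i. z' i + - s * v i + s * w i)"
    have "germ_eq n X k y (\<lambda>i. z i + - s * v i)"
      using before[of "t0 + - s"] s unfolding shift by simp
    also have "germ_eq n X k (\<lambda>i. z i + - s * v i) (\<lambda>i. z' i + - s * v i)"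
      using r2(2)[OF near_z(2)[of s r2]] s by simp
    finally (germ_eq_trans) have "germ_eq n X k y (\<lambda>i. z' i + - s * v i)" .
    also have "near n k z' r1 (\<lambda>i. z' i + - s * v i)"
      using near_z(2)[of s r1] s by (auto simp: near_def)
    then have "germ_eq n X k (\<lambda>i. z' i + - s * v i) y'"
      unfolding y'_def by (rule r1(2)) (use s in simp)
    finally (germ_eq_trans) have "germ_eq n X k y y'" .
    moreover have "(\<lambda>i. y' i - y i) \<in> strata n X k y"
    proof -
      have "(\<lambda>i. (z' i - z i) + s * w i) \<in> strata n X k y"
        using z'(2) w sub by (intro subsp_comb[OF strata_subsp]) auto
      from subsp_comb[OF strata_subsp this v, of "t0 - s"]
      show ?thesis by (simp add: y'_def z_def p_def algebra_simps)
    qed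
    moreover have "y' k = b" using z'(3) w0(2) by (simp add: y'_def w_def)
    ultimately show ?thesis by blast
  qed
qed

text \<open>Within one cell of a semilinear section \<open>y k = a\<close> the germ is constant: near the section the
  relation is the product of the section with a transversal stratum.\<close>

lemma cell_germ:
  assumes "k < n" "finite H" and aff: "\<And>h. h \<in> H \<Longrightarrow> affine_on K n h"
    and det: "sign_det H {y. \<forall>i<Suc k. y i = x i} (rel_of n X)"
    and trans: "\<And>y. (\<forall>i<Suc k. y i = x i) \<Longrightarrow> \<exists>v\<in>strata n X k y. v k = 1"
    and y: "\<forall>i<Suc k. y i = x i" and y': "\<forall>i<Suc k. y' i = x i"
    and outside: "\<And>i. i \<notin> {k..<n} \<Longrightarrow> y' i = y i"
    and cell: "\<forall>h\<in>H. sgn (h y) = sgn (h y')"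
  shows "germ_eq n X k y y'" "(\<lambda>i. y' i - y i) \<in> strata n X k y"
proof -
  define d where "d = (\<lambda>i. y' i - y i)"
  have d_out: "d i = 0" if "i \<notin> {k..<n}" for i using outside[OF that] by (simp add: d_def)
  have dk: "d k = 0" using y y' by (simp add: d_def)
  define p where "p = (\<lambda>t i. y i + t * d i)"
  have p_pre: "\<forall>i<Suc k. p t i = x i" for t using y dk d_out by (auto simp: p_def less_Suc_eq)
  have line: "h (\<lambda>i. u i + s * d i) = h u + s * (h y' - h y)" if "h \<in> H" for h u s
    unfolding d_def by (rule affine_on_segment[OF aff[OF that]])
  \<comment> \<open>A form that vanishes somewhere on the segment and has equal signs at the ends
    vanishes at both ends, so it is constant along \<open>d\<close>.\<close>
  have zero: "h y' = h y" if "h \<in> H" "h (p t) = 0" "0 \<le> t" "t \<le> 1" for h t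
  proof -
    have "h y + t * (h y' - h y) = 0" using line[OF that(1), of y t] that(2) by (simp add: p_def)
    moreover have sg: "sgn (h y) = sgn (h y')" using cell that(1) by blast
    ultimately have "h y = 0" using that(3,4) by (intro same_sign_zero[of "h y" "h y'"])
    with sg show ?thesis by (simp add: sgn_if split: if_splits)
  qed
  have d_p: "d \<in> strata n X k (p t)" if t: "0 \<le> t" "t \<le> 1" for t
  proof -
    obtain r1 where r1: "r1 > 0"
      "\<And>h u. h \<in> H \<Longrightarrow> h (p t) \<noteq> 0 \<Longrightarrow> near n k (p t) r1 u \<Longrightarrow> sgn (h u) = sgn (h (p t))"
      using near_finite_radius[of "{h \<in> H. h (p t) \<noteq> 0}" n k "p t" "\<lambda>h u. sgn (h u) = sgn (h (p t))"]
        affine_sign_near[OF aff] assms(2) by auto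
    obtain v where v: "v \<in> strata n X k (p t)" "v k = 1" using trans[OF p_pre] by blast
    obtain r2 where r2: "r2 > 0"
      "\<And>w s. near n k (p t) r2 w \<Longrightarrow> \<bar>s\<bar> < r2 \<Longrightarrow> w \<in> rel_of n X \<longleftrightarrow> (\<lambda>i. w i + s * v i) \<in> rel_of n X"
      using v(1) by (rule strataE) blast
    obtain M where M: "M > 0" "\<forall>i<n. \<bar>v i\<bar> \<le> M" using bounded_on_finite by blast
    obtain M' where M': "M' > 0" "\<forall>i<n. \<bar>d i\<bar> \<le> M'" using bounded_on_finite by blast
    have pos: "min r1 r2 > 0" "1 + M + M' > 0" using r1 r2 M M' by auto
    obtain r where r: "r > 0" "r < min r1 r2" "r * (1 + M + M') < min r1 r2"
      using small_real[OF pos(1) pos] by blast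
    show ?thesis
    proof (rule strataI[OF d_out r(1)])
      fix u s assume u: "near n k (p t) r u" and s: "\<bar>s\<bar> < r"
      define \<tau> where "\<tau> = u k - x k"
      have \<tau>: "\<bar>\<tau>\<bar> < r" 
      proof -
        have "p t k = x k" using p_pre by blast
        moreover have "\<bar>u k - p t k\<bar> < r" using u \<open>k < n\<close> unfolding near_def by blast
        ultimately show ?thesis by (simp add: \<tau>_def)
      qed
      \<comment> \<open>\<open>u'\<close> is the projection of \<open>u\<close> to the section along
        \<open>v\<close>. There the move by \<open>s * d\<close> is controlled by \<open>H\<close>,
        and afterwards \<open>\<tau> * v\<close> leads back.\<close>
      define u' where "u' = (\<lambda>i. u i + - \<tau> * v i)"
      define u'' where "u'' = (\<lambda>i. u' i + s * d i)"
      have "\<bar>\<tau>\<bar> * M \<le> r * M" "\<bar>s\<bar> * M' \<le> r * M'" using \<tau> s M M' by (intro mult_right_mono; simp)+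
      moreover have "r * M > 0" "r * M' > 0" using r M M' by auto
      moreover have "r + r * M + r * M' < min r1 r2" using r(3) by (simp add: algebra_simps)
      ultimately have le: "r + \<bar>- \<tau>\<bar> * M \<le> r + r * M" "r + r * M \<le> min r1 r2"
        "r + r * M + \<bar>s\<bar> * M' \<le> min r1 r2" by auto
      have near': "near n k (p t) (r + r * M) u'"
        unfolding u'_def using strata_support[OF v(1)] M(2) le(1) by (intro near_move[OF u]) auto
      have near'': "near n k (p t) (min r1 r2) u''"
        unfolding u''_def using d_out M'(2) le(3) by (intro near_move[OF near']) auto
      have pre': "\<forall>i<Suc k. u' i = x i" "\<forall>i<Suc k. u'' i = x i"
      proof -
        show "\<forall>i<Suc k. u' i = x i"
        proof (intro allI impI)
          fix i assume "i < Suc k"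
          then consider "i < k" | "i = k" by linarith
          then show "u' i = x i"
          proof cases
            case 1
            with u p_pre[of t] strata_support[OF v(1), of i] show ?thesis by (simp add: near_def u'_def)
          qed (use v in \<open>simp add: u'_def \<tau>_def\<close>)
        qed
        then show "\<forall>i<Suc k. u'' i = x i" using d_out dk by (auto simp: u''_def less_Suc_eq)
      qed
      have "sgn (h u') = sgn (h u'')" if "h \<in> H" for h
      proof (cases "h (p t) = 0")
        case True
        then show ?thesis using zero[OF that True t] line[OF that, of u' s] by (simp add: u''_def)
      next
        case False
        have "near n k (p t) r1 u'" "near n k (p t) r1 u''"
          using near_mono[OF near'] near_mono[OF near''] le by auto
        then show ?thesis using r1(2)[OF that False] by simp
      qed
      with det pre' have mid: "u' \<in> rel_of n X \<longleftrightarrow> u'' \<in> rel_of n X" unfolding sign_det_def by blast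
      have "u \<in> rel_of n X \<longleftrightarrow> u' \<in> rel_of n X"
        unfolding u'_def using near_mono[OF u] \<tau> r by (intro r2(2)) auto
      moreover have "u'' \<in> rel_of n X \<longleftrightarrow> (\<lambda>i. u'' i + \<tau> * v i) \<in> rel_of n X"
        using near_mono[OF near''] \<tau> r by (intro r2(2)) auto
      moreover have "(\<lambda>i. u'' i + \<tau> * v i) = (\<lambda>i. u i + s * d i)" by (simp add: u''_def u'_def)
      ultimately show "u \<in> rel_of n X \<longleftrightarrow> (\<lambda>i. u i + s * d i) \<in> rel_of n X" using mid by simp
    qed
  qed
  have "p 0 = y" "p 1 = y'" by (simp_all add: p_def d_def)
  with d_p[of 0] show "(\<lambda>i. y' i - y i) \<in> strata n X k y" by (simp add: d_def)
  have "germ_eq n X k y (p 0) \<longleftrightarrow> germ_eq n X k y (p 1)"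
  proof (rule locally_constant_segment[where P = "\<lambda>t. germ_eq n X k y (p t)"])
    fix t :: real assume t: "0 \<le> t" "t \<le> 1"
    from germ_eq_along_stratum[OF d_p[OF t]] near_refl obtain r where
      r: "r > 0" "\<And>s. \<bar>s\<bar> < r \<Longrightarrow> germ_eq n X k (p t) (\<lambda>i. p t i + s * d i)" by metis
    have "germ_eq n X k y (p s) \<longleftrightarrow> germ_eq n X k y (p t)" if "\<bar>s - t\<bar> < r" for s
    proof -
      have "(\<lambda>i. p t i + (s - t) * d i) = p s" by (simp add: p_def algebra_simps)
      with r(2)[OF that] have "germ_eq n X k (p t) (p s)" by simp
      then show ?thesis using germ_eq_sym germ_eq_trans by blast
    qed
    with r(1) show "\<exists>e>0. \<forall>s. 0 \<le> s \<and> s \<le> 1 \<and> \<bar>s - t\<bar> < e \<longrightarrow>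
      germ_eq n X k y (p s) = germ_eq n X k y (p t)" by blast
  qed
  then show "germ_eq n X k y y'"
    using germ_eq_refl[of n X k y] unfolding \<open>p 0 = y\<close> \<open>p 1 = y'\<close> by blast
qed

end

section \<open>Tame relations with rational points are semilinear\<close>

text \<open>The basis vectors of the stratum space at a rational point are rational, since a small
  multiple of each is the only period with prescribed rational values at the free coordinates.\<close>

lemma rational_flat:
  assumes RP: "rational_points n X" and "n \<ge> 1" "k < n" and good: "good n (rel_of n X) k y"
    and rat: "\<And>i. i < n \<Longrightarrow> y i \<in> \<rat>"
  shows "\<exists>G. finite G \<and> (\<forall>g\<in>G. affine_on \<rat> n g) \<and>
    (\<forall>z. (\<forall>i. i \<notin> {k..<n} \<longrightarrow> z i = y i) \<longrightarrow>
      ((\<forall>g\<in>G. g z = 0) \<longleftrightarrow> (\<lambda>i. z i - y i) \<in> strata n X k y))"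
proof -
  let ?V = "strata n X k y"
  have V: "subsp {k..<n} ?V" by (rule strata_subsp)
  obtain I B where I: "I \<subseteq> {k..<n}" "determines I ?V" and B: "\<And>p. p \<in> I \<Longrightarrow> B p \<in> ?V"
    "\<And>p q. p \<in> I \<Longrightarrow> q \<in> I \<Longrightarrow> B p q = (if p = q then 1 else 0)"
    "\<And>v. v \<in> ?V \<Longrightarrow> v = (\<lambda>i. \<Sum>p\<in>I. v p * B p i)"
    using subsp_basis[OF V] by blast
  have "finite I" using I by (blast intro: finite_subset)
  obtain r0 where r0: "r0 > 0" "\<And>r w. 0 < r \<Longrightarrow> r \<le> r0 \<Longrightarrow> period n (rel_of n X) k y r w \<Longrightarrow>
      (\<lambda>i. if k \<le> i \<and> i < n then w i else 0) \<in> ?V"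
    using good_strata(1)[OF good \<open>k < n\<close>] by blast
  have B_rat: "B p i \<in> \<rat>" if p: "p \<in> I" for p i
  proof (cases "i \<in> {k..<n}")
    case False
    then show ?thesis using strata_support[OF B(1)[OF p]] by simp
  next
    case True
    obtain r1 where r1: "r1 > 0"
      "\<And>u t. near n k y r1 u \<Longrightarrow> \<bar>t\<bar> < r1 \<Longrightarrow> u \<in> rel_of n X \<longleftrightarrow> (\<lambda>i. u i + t * B p i) \<in> rel_of n X"
      using B(1)[OF p] by (rule strataE) blast
    obtain r where r: "r \<in> \<rat>" "0 < r" "r < min r0 r1"
      using Rats_dense_in_real[of 0 "min r0 r1"] r0 r1 by auto
    obtain M where M: "M > 0" "\<forall>i<n. \<bar>B p i\<bar> \<le> M" using bounded_on_finite by blast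
    obtain s where s: "s > 0" "s < r1" "s * M < r" using small_real[OF r1(1) r(2) M(1)] by blast
    \<comment> \<open>Small enough that \<open>e * B p\<close> is a period at radius
      \<open>r\<close>, and rational so that its entry at \<open>p\<close>, which equals
      \<open>e\<close>, can serve as a parameter.\<close>
    obtain e where e: "e \<in> \<rat>" "0 < e" "e < s" using Rats_dense_in_real[OF s(1)] by blast
    have pre: "B p i = 0" if "i < k" for i using strata_support[OF B(1)[OF p], of i] that by simp
    have per: "period n (rel_of n X) k y r (\<lambda>i. e * B p i)"
      unfolding period_def
    proof (intro conjI allI impI)
      have "\<bar>e * B p i\<bar> < r" if "i < n" for i
      proof -
        have "\<bar>e * B p i\<bar> \<le> s * M" unfolding abs_mult using M e that by (intro mult_mono) auto
        with s show ?thesis by simp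
      qed
      with pre show "near n k (\<lambda>_. 0) r (\<lambda>i. e * B p i)" by (simp add: near_def)
      fix u assume "near n k y r u"
      then have "near n k y r1 u" by (rule near_mono) (use r in simp)
      then show "u \<in> rel_of n X \<longleftrightarrow> (\<lambda>i. u i + e * B p i) \<in> rel_of n X"
        by (rule r1(2)) (use s e in simp)
    qed
    \<comment> \<open>Slot 2 is the only unknown. A rational solution there, cut to the coordinates
      from \<open>k\<close> below \<open>n\<close>, is a stratum that agrees with
      \<open>e * B p\<close> on \<open>I\<close>, hence equals it.\<close>
    define Q where "Q = (\<lambda>X (E :: nat \<Rightarrow> nat \<Rightarrow> real). period n (rel_of n X) k (E 0) (E 1 0) (E 2) \<and>
      E 2 p = E 3 0 \<and> (\<forall>q\<in>I - {p}. E 2 q = 0))"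
    have "vexpressible n {0, 1, 2, 3} (\<lambda>X E. period n (rel_of n X) k (E 0) (E 1 0) (E 2))"
      using vexpressible_period[of n k 0 "{0, 1, 2, 3}" 1 "\<lambda>i E. E 2 i"] assms(2,3) vterm_coord by simp
    moreover have "p < n" "\<And>q. q \<in> I - {p} \<Longrightarrow> q < n" using I p by auto
    ultimately have Q: "vexpressible n {0, 1, 2, 3} Q"
      unfolding Q_def using \<open>finite I\<close> assms(2)
      by (intro vexpressible_conj vexpressible_ball vexpressible_eq vexpressible_zero vterm_coord) auto
    define E where "E = (\<lambda>j::nat. if j = 0 then y else if j = 1 then (\<lambda>_. r)
      else if j = 2 then (\<lambda>i. e * B p i) else (\<lambda>_::nat. e))"
    have "Q X E" unfolding Q_def E_def using per B(2)[OF p] p by auto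
    moreover have "E j i \<in> \<rat>" if "j \<in> {0, 1, 3}" "i < n" for i j
      using that rat r(1) e(1) by (auto simp: E_def)
    ultimately obtain E' where
      E': "Q X E'" "\<forall>j\<in>{0, 1, 3}. \<forall>i<n. E' j i = E j i" "\<forall>j i. E' j i \<in> \<rat>"
      using rational_vectors[OF RP Q, of E "{0, 1, 3}"] by blast
    have E'_eq: "E' 0 i = y i" "E' 1 i = r" "E' 3 i = e" if "i < n" for i
      using E'(2) that by (auto simp: E_def)
    define w where "w = (\<lambda>i. if k \<le> i \<and> i < n then E' 2 i else 0)"
    have "period n (rel_of n X) k (E' 0) r (E' 2)"
      using E'(1) E'_eq(2)[of 0] assms(2) by (simp add: Q_def)
    then have "period n (rel_of n X) k y r (E' 2)"
      unfolding period_def using near_cong[of n "E' 0" y k r] E'_eq(1) \<open>k < n\<close> by simp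
    then have "w \<in> ?V" unfolding w_def by (rule r0(2)[rotated 2]) (use r in auto)
    moreover have "(\<lambda>i. e * B p i) \<in> ?V" by (rule subsp_scale[OF V B(1)[OF p]])
    moreover have "w q = e * B p q" if "q \<in> I" for q
    proof -
      have "w q = E' 2 q" using that I by (auto simp: w_def)
      also have "\<dots> = (if q = p then e else 0)"
        using E'(1) that E'_eq(3)[of 0] assms(2) by (auto simp: Q_def)
      finally show ?thesis using B(2)[OF p that] by auto
    qed
    ultimately have "w = (\<lambda>i. e * B p i)" by (rule determines_eqI[OF V I(2)])
    then have "w i = e * B p i" by (rule fun_cong)
    then have "B p i = E' 2 i / e" using True e by (simp add: w_def)
    then show ?thesis using E'(3) e by (simp add: Rats_divide)
  qed
  \<comment> \<open>\<open>g i\<close> compares entry \<open>i\<close> of \<open>z - y\<close> with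
    the value that the entries at the free coordinates prescribe.\<close>
  define g where "g = (\<lambda>i z. (z i - y i) - (\<Sum>p\<in>I. (z p - y p) * B p i))"
  have aff: "affine_on \<rat> n (g i)" if "i \<in> {k..<n}" for i
    unfolding g_def using that I rat B_rat \<open>finite I\<close>
    by (intro affine_on_diff affine_on_sum affine_on_coord affine_on_const) auto
  have "(\<forall>h\<in>g ` {k..<n}. h z = 0) \<longleftrightarrow> (\<lambda>i. z i - y i) \<in> ?V"
    if z: "\<forall>i. i \<notin> {k..<n} \<longrightarrow> z i = y i" for z
  proof
    let ?v = "\<lambda>i. z i - y i"
    let ?w = "\<lambda>i. \<Sum>p\<in>I. ?v p * B p i"
    assume "\<forall>h\<in>g ` {k..<n}. h z = 0"
    then have "?v i = ?w i" if "i \<in> {k..<n}" for i using that by (auto simp: g_def)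
    moreover have mem: "?w \<in> ?V" by (rule subsp_sum[OF V \<open>finite I\<close>]) (rule B(1))
    moreover have "?v i = ?w i" if "i \<notin> {k..<n}" for i
      using z subsp_support[OF V mem that] that by simp
    ultimately have "?v = ?w" by blast
    with mem show "?v \<in> ?V" by simp
  next
    assume *: "(\<lambda>i. z i - y i) \<in> ?V"
    have "g i z = 0" for i unfolding g_def right_minus_eq by (rule fun_cong[OF B(3)[OF *]])
    then show "\<forall>h\<in>g ` {k..<n}. h z = 0" by blast
  qed
  with aff show ?thesis by (intro exI[of _ "g ` {k..<n}"]) auto
qed

text \<open>Both the transport to the section \<open>a\<close> and the move within its cell displace
  a point by vectors of its own stratum space. Hence each point of the strip lies on the flat
  through a cell representative, not merely on a parallel one, and \<open>H'\<close> needs only the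
  forms of these flats.\<close>

lemma strip_semilinear:
  assumes RP: "rational_points n X" and "n \<ge> 1" "k < n" and x: "\<And>i. i < k \<Longrightarrow> x i \<in> \<rat>"
    and conv: "\<And>s t u. s \<in> J \<Longrightarrow> u \<in> J \<Longrightarrow> s \<le> t \<Longrightarrow> t \<le> u \<Longrightarrow> t \<in> J"
    and good: "\<And>y. (\<forall>i<k. y i = x i) \<Longrightarrow> y k \<in> J \<Longrightarrow> good n (rel_of n X) k y"
    and a: "a \<in> J" "a \<in> \<rat>"
    and sect: "\<exists>H. finite H \<and> (\<forall>h\<in>H. affine_on \<rat> n h) \<and>
      sign_det H {y. \<forall>i<Suc k. y i = (x(k := a)) i} (rel_of n X)"
  shows "\<exists>H. finite H \<and> (\<forall>h\<in>H. affine_on \<rat> n h) \<and>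
    sign_det H {y. (\<forall>i<k. y i = x i) \<and> y k \<in> J} (rel_of n X)"
proof -
  obtain H where H: "finite H" "\<And>h. h \<in> H \<Longrightarrow> affine_on \<rat> n h"
    "sign_det H {y. \<forall>i<Suc k. y i = (x(k := a)) i} (rel_of n X)" using sect by blast
  have trans: "\<exists>v\<in>strata n X k y. v k = 1" if "\<forall>i<k. y i = x i" "y k \<in> J" for y
    by (rule good_strata(2)[OF good[OF that] \<open>k < n\<close>])
  \<comment> \<open>Coordinates from \<open>n\<close> on are normalised to 0, because strata vanish
    there and differences of points are to be compared with strata.\<close>
  define Sec where "Sec = {y :: nat \<Rightarrow> real. (\<forall>i<k. y i = x i) \<and> (\<forall>i\<ge>n. y i = 0)}"
  define C where "C = cell_of H ` {y \<in> Sec. y k = a}"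
  have "finite C" unfolding C_def by (rule finite_cells[OF H(1)])
  have "\<exists>y G. y \<in> Sec \<and> y k = a \<and> cell_of H y = c \<and> finite G \<and> (\<forall>g\<in>G. affine_on \<rat> n g) \<and>
    (\<forall>z\<in>Sec. (\<forall>g\<in>G. g z = 0) \<longleftrightarrow> (\<lambda>i. z i - y i) \<in> strata n X k y)" if "c \<in> C" for c
  proof -
    obtain y where y: "y \<in> Sec" "y k = a" "c = cell_of H y" using \<open>c \<in> C\<close> unfolding C_def by auto
    define Q where "Q = (\<lambda>(X :: real list set) E. (\<forall>i\<in>{..<k}. E 0 i = E 1 i) \<and>
      E 0 k = E 2 0 \<and> cell_of H (E (0::nat)) = cell_of H y)"
    have Q: "vexpressible n {0, 1, 2} Q"
      unfolding Q_def using assms(2,3) H(2)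
      by (intro vexpressible_conj vexpressible_ball vexpressible_eq vterm_coord
          vexpressible_cell[OF H(1)]) auto
    define E where "E = (\<lambda>j::nat. if j = 0 then y
      else if j = 1 then (\<lambda>i. if i < k then x i else 0) else (\<lambda>_. a))"
    have "Q X E" using y(1,2) by (simp add: Q_def E_def Sec_def)
    moreover have "E j i \<in> \<rat>" if "j \<in> {1, 2}" for i j using that x a(2) by (auto simp: E_def)
    ultimately obtain E' where E': "Q X E'" "\<forall>j\<in>{1, 2}. \<forall>i<n. E' j i = E j i" "\<forall>j i. E' j i \<in> \<rat>"
      using rational_vectors[OF RP Q, of E "{1, 2}"] by blast
    define z where "z = (\<lambda>i. if i < n then E' 0 i else 0)"
    have z: "z \<in> Sec" "z k = a" "z i \<in> \<rat>" for i
      using E' assms(2,3) by (auto simp: z_def Sec_def Q_def E_def)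
    have "h z = h (E' 0)" if "h \<in> H" for h
      by (rule affine_on_cong[OF H(2)[OF that]]) (simp add: z_def)
    then have "cell_of H z = cell_of H (E' 0)" 
      unfolding cell_of_eq_iff by (intro ballI arg_cong[of _ _ sgn])
    then have "cell_of H z = c" using E'(1) y(3) by (simp add: Q_def)
    have "good n (rel_of n X) k z" using z a by (intro good) (auto simp: Sec_def)
    from rational_flat[OF RP assms(2,3) this z(3)] obtain G where
      "finite G" "\<forall>g\<in>G. affine_on \<rat> n g" and G: "\<And>u. (\<forall>i. i \<notin> {k..<n} \<longrightarrow> u i = z i) \<Longrightarrow>
        (\<forall>g\<in>G. g u = 0) \<longleftrightarrow> (\<lambda>i. u i - z i) \<in> strata n X k z" by auto
    moreover have "(\<forall>g\<in>G. g u = 0) \<longleftrightarrow> (\<lambda>i. u i - z i) \<in> strata n X k z" if "u \<in> Sec" for u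
      using that z(1) by (intro G) (auto simp: Sec_def not_less)
    ultimately show ?thesis using z \<open>cell_of H z = c\<close> by blast
  qed
  then have "\<forall>c\<in>C. \<exists>y G. y \<in> Sec \<and> y k = a \<and> cell_of H y = c \<and> finite G \<and>
      (\<forall>g\<in>G. affine_on \<rat> n g) \<and>
      (\<forall>z\<in>Sec. (\<forall>g\<in>G. g z = 0) \<longleftrightarrow> (\<lambda>i. z i - y i) \<in> strata n X k y)" by blast
  from bchoice[OF this] obtain yf where "\<forall>c\<in>C. \<exists>G. yf c \<in> Sec \<and> yf c k = a \<and>
      cell_of H (yf c) = c \<and> finite G \<and> (\<forall>g\<in>G. affine_on \<rat> n g) \<and>
      (\<forall>z\<in>Sec. (\<forall>g\<in>G. g z = 0) \<longleftrightarrow> (\<lambda>i. z i - yf c i) \<in> strata n X k (yf c))" ..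
  from bchoice[OF this] obtain Gf where yG: "\<forall>c\<in>C. yf c \<in> Sec \<and> yf c k = a \<and>
      cell_of H (yf c) = c \<and> finite (Gf c) \<and> (\<forall>g\<in>Gf c. affine_on \<rat> n g) \<and>
      (\<forall>z\<in>Sec. (\<forall>g\<in>Gf c. g z = 0) \<longleftrightarrow> (\<lambda>i. z i - yf c i) \<in> strata n X k (yf c))" ..
  define H' where "H' = (\<Union>c\<in>C. Gf c)"
  have H': "finite H'" "\<And>h. h \<in> H' \<Longrightarrow> affine_on \<rat> n h"
    using yG \<open>finite C\<close> by (auto simp: H'_def)

  have main: "z \<in> rel_of n X \<longleftrightarrow> z' \<in> rel_of n X"
    if z: "z \<in> Sec" "z k \<in> J" and z': "z' \<in> Sec" "z' k \<in> J"
      and sg: "\<forall>h\<in>H'. sgn (h z) = sgn (h z')" for z z'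
  proof -
    define d where "d = (\<lambda>i. z' i - z i)"
    define p where "p = (\<lambda>t i. z i + t * d i)"
    have d_p: "d \<in> strata n X k (p t)" if t: "0 \<le> t" "t \<le> 1" for t
    proof -
      have pSec: "p t \<in> Sec" using z z' by (auto simp: Sec_def p_def d_def)
      have pJ: "p t k \<in> J"
      proof (cases "z k \<le> z' k")
        case True
        then have "0 \<le> t * (z' k - z k)" "t * (z' k - z k) \<le> z' k - z k"
          using t by (auto simp: mult_left_le_one_le)
        then show ?thesis using conv[OF z(2) z'(2)] by (simp add: p_def d_def)
      next
        case False
        then have "0 \<le> t * (z k - z' k)" "t * (z k - z' k) \<le> z k - z' k"
          using t by (auto simp: mult_left_le_one_le)
        then have "z' k \<le> p t k" "p t k \<le> z k" by (auto simp: p_def d_def algebra_simps)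
        then show ?thesis by (rule conv[OF z'(2) z(2)])
      qed
      have "\<forall>i<k. p t i = x i" using pSec by (simp add: Sec_def)
      have "\<exists>q. germ_eq n X k (p t) q \<and> (\<lambda>i. q i - p t i) \<in> strata n X k (p t) \<and> q k = a"
      proof (rule germ_transport[where J = J and x = x])
        show "\<And>s t u. s \<in> J \<Longrightarrow> u \<in> J \<Longrightarrow> s \<le> t \<Longrightarrow> t \<le> u \<Longrightarrow> t \<in> J" by (rule conv)
        show "\<And>y. \<forall>i<k. y i = x i \<Longrightarrow> y k \<in> J \<Longrightarrow> \<exists>v\<in>strata n X k y. v k = 1" by (rule trans)
      qed fact+
      then obtain q where q: "germ_eq n X k (p t) q" "(\<lambda>i. q i - p t i) \<in> strata n X k (p t)" "q k = a"
        by auto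
      have q_out: "q i = p t i" if "i \<notin> {k..<n}" for i
        using strata_support[OF q(2) that] by simp
      have qSec: "q \<in> Sec" using pSec q_out \<open>k < n\<close> by (auto simp: Sec_def)
      define c y G where "c = cell_of H q" and "y = yf c" and "G = Gf c"
      have "c \<in> C" using qSec q(3) by (auto simp: c_def C_def)
      with yG have y: "y \<in> Sec" "y k = a" "cell_of H y = cell_of H q"
        and G: "\<And>u. u \<in> Sec \<Longrightarrow> (\<forall>g\<in>G. g u = 0) \<longleftrightarrow> (\<lambda>i. u i - y i) \<in> strata n X k y"
        unfolding y_def G_def by (auto simp: c_def)
      have "G \<subseteq> H'" using \<open>c \<in> C\<close> by (auto simp: G_def H'_def)
      have tr: "\<exists>v\<in>strata n X k u. v k = 1" if "\<forall>i<Suc k. u i = (x(k := a)) i" for u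
        using that a(1) by (intro trans) auto
      have pre: "\<forall>i<Suc k. y i = (x(k := a)) i" "\<forall>i<Suc k. q i = (x(k := a)) i"
        using y qSec q(3) by (auto simp: Sec_def less_Suc_eq)
      have out: "q i = y i" if "i \<notin> {k..<n}" for i
        using that qSec y(1) by (auto simp: Sec_def not_less)
      have sgq: "\<forall>h\<in>H. sgn (h y) = sgn (h q)" using y(3) by (simp add: cell_of_eq_iff)
      note germs = cell_germ[OF \<open>k < n\<close> H(1,2,3) tr pre out sgq]
      have V: "strata n X k (p t) = strata n X k y"
        using germ_eq_strata[OF q(1)] germ_eq_strata[OF germs(1)] by simp
      have "(\<lambda>i. (q i - y i) - (q i - p t i)) \<in> strata n X k y"
        by (rule subsp_diff[OF strata_subsp germs(2) q(2)[unfolded V]])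
      then have "(\<lambda>i. p t i - y i) \<in> strata n X k y" by simp
      with G[OF pSec] have pG: "\<forall>g\<in>G. g (p t) = 0" by blast
      \<comment> \<open>The flat through \<open>p t\<close> contains both ends of the segment: a
        form vanishing at \<open>p t\<close> with equal signs at the ends vanishes at the ends too.
        So \<open>d\<close> is a difference of two vectors of the stratum space.\<close>
      have zeros: "g z = 0 \<and> g z' = 0" if "g \<in> G" for g
      proof -
        have "g \<in> H'" using that \<open>G \<subseteq> H'\<close> by blast
        have "g (p t) = g z + t * (g z' - g z)"
          unfolding p_def d_def by (rule affine_on_segment[OF H'(2)[OF \<open>g \<in> H'\<close>]])
        moreover have "g (p t) = 0" using pG that by blast
        ultimately have "g z + t * (g z' - g z) = 0" by (simp only:)
        with sg \<open>g \<in> H'\<close> have "g z = 0" by (intro same_sign_zero[OF _ _ t, of "g z" "g z'"]) auto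
        moreover have "sgn (g z) = sgn (g z')" using sg \<open>g \<in> H'\<close> by blast
        ultimately show ?thesis by (simp add: sgn_if split: if_splits)
      qed
      then have "(\<lambda>i. z i - y i) \<in> strata n X k y" "(\<lambda>i. z' i - y i) \<in> strata n X k y"
        using G[OF z(1)] G[OF z'(1)] by blast+
      from subsp_diff[OF strata_subsp this(2,1)] show ?thesis by (simp add: V d_def)
    qed
    have "p 0 \<in> rel_of n X \<longleftrightarrow> p 1 \<in> rel_of n X"
    proof (rule locally_constant_segment[where P = "\<lambda>t. p t \<in> rel_of n X"])
      fix t :: real assume "0 \<le> t" "t \<le> 1"
      from d_p[OF this] obtain r where r: "r > 0" "\<And>u s. near n k (p t) r u \<Longrightarrow> \<bar>s\<bar> < r \<Longrightarrow>
          u \<in> rel_of n X \<longleftrightarrow> (\<lambda>i. u i + s * d i) \<in> rel_of n X" by (rule strataE) blast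
      have "p s \<in> rel_of n X \<longleftrightarrow> p t \<in> rel_of n X" if "\<bar>s - t\<bar> < r" for s
      proof -
        have "(\<lambda>i. p t i + (s - t) * d i) = p s" by (simp add: p_def algebra_simps)
        with r(2)[OF near_refl[OF r(1)] that] show ?thesis by simp
      qed
      with r(1) show "\<exists>e>0. \<forall>s. 0 \<le> s \<and> s \<le> 1 \<and> \<bar>s - t\<bar> < e \<longrightarrow>
        (p s \<in> rel_of n X) = (p t \<in> rel_of n X)" by blast
    qed
    then show ?thesis by (simp add: p_def d_def)
  qed
  have "sign_det H' {y. (\<forall>i<k. y i = x i) \<and> y k \<in> J} (rel_of n X)"
    unfolding sign_det_def
  proof (intro ballI impI)
    fix z z' assume z: "z \<in> {y. (\<forall>i<k. y i = x i) \<and> y k \<in> J}" "z' \<in> {y. (\<forall>i<k. y i = x i) \<and> y k \<in> J}"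
      and sg: "\<forall>h\<in>H'. sgn (h z) = sgn (h z')"
    \<comment> \<open>Forms and membership read only the first \<open>n\<close> coordinates, so
      arbitrary points reduce to those in \<open>Sec\<close>.\<close>
    define cut where "cut = (\<lambda>z i. if i < n then z i else (0::real))"
    have cut_eq: "h (cut u) = h u" if "h \<in> H'" for h u
      by (rule affine_on_cong[OF H'(2)[OF that]]) (simp add: cut_def)
    have "\<forall>h\<in>H'. sgn (h (cut z)) = sgn (h (cut z'))"
    proof
      fix h assume "h \<in> H'"
      then show "sgn (h (cut z)) = sgn (h (cut z'))"
        unfolding cut_eq[OF \<open>h \<in> H'\<close>] by (rule bspec[OF sg])
    qed
    then have "cut z \<in> rel_of n X \<longleftrightarrow> cut z' \<in> rel_of n X"
      using z \<open>k < n\<close> by (intro main) (auto simp: cut_def Sec_def)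
    moreover have "cut u \<in> rel_of n X \<longleftrightarrow> u \<in> rel_of n X" for u
      by (rule rel_of_cong) (simp add: cut_def)
    ultimately show "z \<in> rel_of n X \<longleftrightarrow> z' \<in> rel_of n X" by simp
  qed
  with H' show ?thesis by blast
qed

text \<open>The prefix is only ever extended by a bad value or by a reference value chosen in a gap.
  Both are rational, so the induction can be confined to rational prefixes.\<close>

lemma section_semilinear:
  assumes RP: "rational_points n X" and "n \<ge> 1" and tame: "tame n (rel_of n X)" and "k \<le> n"
  shows "\<forall>x. (\<forall>i<k. x i \<in> \<rat>) \<longrightarrow> (\<exists>H. finite H \<and> (\<forall>h\<in>H. affine_on \<rat> n h) \<and>
    sign_det H {y. \<forall>i<k. y i = x i} (rel_of n X))"
  using \<open>k \<le> n\<close>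
proof (induction rule: inc_induct)
  case base
  have "sign_det {} {y. \<forall>i<n. y i = x i} (rel_of n X)" for x
    unfolding sign_det_def by (intro ballI impI rel_of_cong) simp
  then show ?case by blast
next
  case (step k)
  show ?case
  proof (intro allI impI)
    fix x :: "nat \<Rightarrow> real" assume x: "\<forall>i<k. x i \<in> \<rat>"
    define bad where "bad = {y k |y. (\<forall>i<k. y i = x i) \<and> \<not> good n (rel_of n X) k y}"
    have "finite bad" using tame \<open>k < n\<close> unfolding tame_iff_finite bad_def by blast
    have bad_rat: "a \<in> \<rat>" if "a \<in> bad" for a
    proof -
      obtain m d where d: "d > 0" "\<forall>a\<in>bad. \<bar>a\<bar> < m \<and> (\<forall>b\<in>bad. a < b \<longrightarrow> a + d \<le> b)"
        using finite_separated[OF \<open>finite bad\<close>] by auto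
      \<comment> \<open>Rational bounds within distance \<open>d\<close> of \<open>a\<close> isolate
        it among the bad values, so a rational bad point between them has \<open>a\<close> as its
        coordinate \<open>k\<close>.\<close>
      obtain l where l: "l \<in> \<rat>" "a - d < l" "l < a" using Rats_dense_in_real[of "a - d" a] d by auto
      obtain u where u: "u \<in> \<rat>" "a < u" "u < a + d" using Rats_dense_in_real[of a "a + d"] d by auto
      obtain y where y: "y k = a" "\<forall>i<k. y i = x i" "\<not> good n (rel_of n X) k y"
        using \<open>a \<in> bad\<close> unfolding bad_def by auto
      define Q where "Q = (\<lambda>X E. (\<forall>i\<in>{..<k}. E 0 i = E 1 i) \<and> \<not> good n (rel_of n X) k (E (0::nat)) \<and>
        E 2 0 < E 0 k \<and> E 0 k < E 3 0)"
      have Q: "vexpressible n {0, 1, 2, 3} Q"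
        unfolding Q_def using assms(2) \<open>k < n\<close>
        by (intro vexpressible_conj vexpressible_ball vexpressible_eq vexpressible_neg
            vexpressible_good vexpressible_less vterm_coord) auto
      define E where "E = (\<lambda>j::nat. if j = 0 then y else if j = 1 then (\<lambda>i. if i < k then x i else 0)
        else if j = 2 then (\<lambda>_. l) else (\<lambda>_. u))"
      have "Q X E" using y l u by (simp add: Q_def E_def)
      moreover have "E j i \<in> \<rat>" if "j \<in> {1, 2, 3}" for j i using that x l u by (auto simp: E_def)
      ultimately obtain E' where E': "Q X E'" "\<forall>j\<in>{1, 2, 3}. \<forall>i<n. E' j i = E j i" "\<forall>j i. E' j i \<in> \<rat>"
        using rational_vectors[OF RP Q, of E "{1, 2, 3}"] by blast
      have "E' 1 i = x i" if "i < k" for i using E'(2) that \<open>k < n\<close> by (simp add: E_def)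
      then have "E' 0 k \<in> bad" using E'(1) unfolding bad_def Q_def by auto
      moreover have "l < E' 0 k" "E' 0 k < u" using E'(1,2) assms(2) by (auto simp: Q_def E_def)
      ultimately have "E' 0 k = a"
        using d(2) that l u by (cases "E' 0 k" a rule: linorder_cases) force+
      then show ?thesis using E'(3) by metis
    qed
    have section_at: "\<exists>H. finite H \<and> (\<forall>h\<in>H. affine_on \<rat> n h) \<and>
        sign_det H {y. \<forall>i<Suc k. y i = (x(k := a)) i} (rel_of n X)" if "a \<in> \<rat>" for a
    proof -
      have "\<forall>i<Suc k. (x(k := a)) i \<in> \<rat>" using x that by (auto simp: less_Suc_eq)
      with step.IH show ?thesis by blast
    qed
    have "\<forall>a\<in>bad. \<exists>H. finite H \<and> (\<forall>h\<in>H. affine_on \<rat> n h) \<and>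
        sign_det H {y. \<forall>i<Suc k. y i = (x(k := a)) i} (rel_of n X)"
      using section_at bad_rat by blast
    from bchoice[OF this] obtain H1 where H1: "\<forall>a\<in>bad. finite (H1 a) \<and> (\<forall>h\<in>H1 a. affine_on \<rat> n h) \<and>
        sign_det (H1 a) {y. \<forall>i<Suc k. y i = (x(k := a)) i} (rel_of n X)" by auto

    text \<open>The complement of \<open>bad\<close> splits into intervals, indexed by the bad points below them.\<close>
    define gap where "gap = (\<lambda>L. {t. t \<notin> bad \<and> {b \<in> bad. b < t} = L})"
    have "\<exists>H. finite H \<and> (\<forall>h\<in>H. affine_on \<rat> n h) \<and>
        sign_det H {y. (\<forall>i<k. y i = x i) \<and> y k \<in> gap L} (rel_of n X)" for L
    proof (cases "gap L = {}")
      case True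
      then show ?thesis by (intro exI[of _ "{}"]) (simp add: sign_det_def)
    next
      case False
      then obtain t where t: "t \<in> gap L" by blast
      \<comment> \<open>No bad value lies strictly between \<open>t\<close> and \<open>s\<close>;
        the element \<open>t + 1\<close> keeps the minimum defined when no bad value exceeds
        \<open>t\<close>.\<close>
      define s where "s = Min (insert (t + 1) {b \<in> bad. t < b})"
      have fin: "finite (insert (t + 1) {b \<in> bad. t < b})" using \<open>finite bad\<close> by simp
      have "t < s" unfolding s_def using fin by (subst Min_gr_iff) auto
      then obtain a where a: "a \<in> \<rat>" "t < a" "a < s" using Rats_dense_in_real by blast
      have above: "a < b" if "b \<in> bad" "t < b" for b
      proof -
        have "s \<le> b" unfolding s_def using fin that by (intro Min_le) auto
        with a show ?thesis by simp
      qed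
      have "t \<notin> bad" "{b \<in> bad. b < t} = L" using t by (auto simp: gap_def)
      have iff: "b < a \<longleftrightarrow> b < t" if "b \<in> bad" for b
        using above[OF that] a(2) that \<open>t \<notin> bad\<close> by (cases b t rule: linorder_cases) auto
      have "a \<notin> bad"
        using above[of a] a(2) by auto
      moreover have "{b \<in> bad. b < a} = L"
        using iff \<open>{b \<in> bad. b < t} = L\<close> by blast
      ultimately have "a \<in> gap L" by (simp add: gap_def)
      show ?thesis
      proof (rule strip_semilinear[OF RP assms(2) \<open>k < n\<close> _ _ _ \<open>a \<in> gap L\<close> a(1) section_at[OF a(1)]])
        fix s t u assume su: "s \<in> gap L" "u \<in> gap L" "s \<le> t" "t \<le> u"
        have low: "b < s" if "b \<in> bad" "b < u" for b using su(1,2) that by (auto simp: gap_def)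
        have "t \<notin> bad"
        proof
          assume "t \<in> bad"
          moreover have "u \<notin> bad" using su by (simp add: gap_def)
          ultimately have "t < u" using su(4) by (cases "t = u") auto
          with low[OF \<open>t \<in> bad\<close>] su(3) show False by simp
        qed
        moreover have "{b \<in> bad. b < t} = {b \<in> bad. b < s}"
          using low su(3,4) by (auto intro: order.strict_trans2)
        ultimately show "t \<in> gap L" using su(1) by (simp add: gap_def)
      next
        fix y assume "\<forall>i<k. y i = x i" "y k \<in> gap L"
        then show "good n (rel_of n X) k y" unfolding gap_def bad_def by blast
      qed (use x in blast)
    qed
    then have "\<forall>L. \<exists>H. finite H \<and> (\<forall>h\<in>H. affine_on \<rat> n h) \<and>
        sign_det H {y. (\<forall>i<k. y i = x i) \<and> y k \<in> gap L} (rel_of n X)" ..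
    from choice[OF this] obtain H2 where H2: "\<And>L. finite (H2 L)" "\<And>L h. h \<in> H2 L \<Longrightarrow> affine_on \<rat> n h"
      "\<And>L. sign_det (H2 L) {y. (\<forall>i<k. y i = x i) \<and> y k \<in> gap L} (rel_of n X)" by auto
    \<comment> \<open>The forms \<open>y k - b\<close> tell which bad value or gap contains
      coordinate \<open>k\<close>; the forms from \<open>H1\<close> and \<open>H2\<close> then
      decide membership over it.\<close>
    define H where "H = (\<Union>a\<in>bad. H1 a) \<union> (\<Union>L\<in>Pow bad. H2 L) \<union> (\<lambda>b y. y k - b) ` bad"
    have "finite H" using \<open>finite bad\<close> H1 H2(1) by (auto simp: H_def)
    moreover have "\<forall>h\<in>H. affine_on \<rat> n h"
      using H1 H2(2) bad_rat \<open>k < n\<close>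
      by (auto simp: H_def intro!: affine_on_diff affine_on_coord affine_on_const)
    moreover have "sign_det H {y. \<forall>i<k. y i = x i} (rel_of n X)"
      unfolding sign_det_def
    proof (intro ballI impI)
      fix y z assume y: "y \<in> {y. \<forall>i<k. y i = x i}" and z: "z \<in> {y. \<forall>i<k. y i = x i}"
        and sg: "\<forall>h\<in>H. sgn (h y) = sgn (h z)"
      have sgb: "sgn (y k - b) = sgn (z k - b)" if "b \<in> bad" for b
      proof -
        have "(\<lambda>y. y k - b) \<in> H" using that by (auto simp: H_def)
        with sg show ?thesis by (rule bspec)
      qed
      have lt: "b < y k \<longleftrightarrow> b < z k" and eq: "y k = b \<longleftrightarrow> z k = b" if "b \<in> bad" for b
        using sgb[OF that] by (auto simp: sgn_if split: if_splits)
      show "y \<in> rel_of n X \<longleftrightarrow> z \<in> rel_of n X"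
      proof (cases "y k \<in> bad")
        case True
        then have "z k = y k" using eq by blast
        have "sign_det (H1 (y k)) {u. \<forall>i<Suc k. u i = (x(k := y k)) i} (rel_of n X)"
          using H1 True by blast
        moreover have "\<forall>h\<in>H1 (y k). sgn (h y) = sgn (h z)" using sg True by (auto simp: H_def)
        moreover have "\<forall>i<Suc k. y i = (x(k := y k)) i" "\<forall>i<Suc k. z i = (x(k := y k)) i"
          using y z \<open>z k = y k\<close> by (auto simp: less_Suc_eq)
        ultimately show ?thesis unfolding sign_det_def by blast
      next
        case False
        define L where "L = {b \<in> bad. b < y k}"
        have "z k \<notin> bad" using eq[of "z k"] False by auto
        moreover have "{b \<in> bad. b < z k} = L" unfolding L_def by (intro Collect_cong conj_cong refl lt[symmetric])
        ultimately have "y k \<in> gap L" "z k \<in> gap L" using False by (simp_all add: gap_def L_def)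
        moreover have "L \<in> Pow bad" by (auto simp: L_def)
        then have "H2 L \<subseteq> H" unfolding H_def by (intro le_supI1 le_supI2 UN_upper)
        then have "\<forall>h\<in>H2 L. sgn (h y) = sgn (h z)" using sg by (meson subset_iff)
        ultimately show ?thesis using H2(3)[of L] y z unfolding sign_det_def by blast
      qed
    qed
    ultimately show "\<exists>H. finite H \<and> (\<forall>h\<in>H. affine_on \<rat> n h) \<and>
      sign_det H {y. \<forall>i<k. y i = x i} (rel_of n X)" by blast
  qed
qed

theorem theorem5p8:
  fixes n :: nat
  assumes "n \<ge> 1"
  shows "\<exists>\<Phi>. is_sentence n \<Phi> \<and>
    (\<forall>X. X \<subseteq> tuples n \<longrightarrow>
       (\<forall>m Y. definable_RX n X m Y \<and> Y \<noteq> {} \<longrightarrow> (\<exists>y\<in>Y. set y \<subseteq> \<rat>)) \<longrightarrow>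
       (holds X \<Phi> \<longleftrightarrow> definable_R n X))"
proof -
  obtain \<Phi> where \<Phi>: "X_arity n \<Phi>" "free_vars \<Phi> = {}"
    and sat: "\<And>X e. sat X e \<Phi> \<longleftrightarrow> tame n (rel_of n X)"
    using vexpressible_tame[OF assms] unfolding vexpressible_def expressible_def by auto
  have "tame n (rel_of n X) \<longleftrightarrow> definable_R n X"
    if X: "X \<subseteq> tuples n" and RP: "rational_points n X" for X
  proof
    assume "tame n (rel_of n X)"
    \<comment> \<open>With \<open>k = 0\<close> no coordinate is frozen and the section is the whole
      space.\<close>
    from section_semilinear[OF RP assms this, of 0]
    obtain H where "finite H" "\<forall>h\<in>H. affine_on \<rat> n h" "sign_det H UNIV (rel_of n X)" by auto
    then show "definable_R n X"
      using sign_det_imp_definable[OF assms X, of H] by (simp add: rel_of_def)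
  next
    assume "definable_R n X"
    then obtain H where "finite H" "\<forall>h\<in>H. affine_on UNIV n h" "sign_det H UNIV (rel_of n X)"
      using definable_imp_sign_det unfolding rel_of_def by blast
    then show "tame n (rel_of n X)" using sign_det_imp_tame by blast
  qed
  then show ?thesis
    using \<Phi> by (intro exI[of _ \<Phi>]) (auto simp: is_sentence_def holds_def sat rational_points_def)
qed

end
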